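(* Let $(M^{2n+1},\Phi,\xi,\eta,g)$ be an ACR-manifold of the class of Kenmotsu type, and let $B$ be its generalized curvature tensor with scalars $a_0,a_1,a_2$, where $a_0,a_1\neq0$. Then $M$ has flat generalized curvature tensor (that is, $B=0$) if and only if $M$ is an $\eta$-Einstein manifold, $r_{ij}=\lambda g_{ij}+\mu\eta_i\eta_j$, with $$\lambda=\frac1{a_1}(a_0+2na_1-2a_2s),\qquad \mu=-(2n+\lambda),$$ and on the AG-structure space $$A^a_{bcd}=0,\qquad A^{ad}_{bc}=B^{ah}{}_cB_{bh}{}^d+\frac{a_1}{a_0}\mu\,\delta^a_c\delta^d_b,\qquad B^{ab}{}_{[cd]}=\frac{a_1}{a_0}\mu\,\delta^a_{[c}\delta^b_{d]}.$$
   Context: ACR-manifold: a smooth manifold $M^{2n+1}$ with an endomorphism $\Phi$ of $X(M)$ (smooth vector fields), $\xi\in X(M)$, a Riemannian metric $g$ and $\eta(\cdot)=g(\cdot,\xi)$ such that $\Phi\xi=0$, $\eta(\xi)=1$, $\eta\circ\Phi=0$, $\Phi^2=-\mathrm{id}+\eta\otimes\xi$, $g(\Phi X,\Phi Y)=g(X,Y)-\eta(X)\eta(Y)$. It is of the class of Kenmotsu type if $\nabla_X(\Phi)Y-\nabla_{\Phi X}(\Phi)\Phi Y=-\eta(Y)\Phi X$ for all $X,Y\in X(M)$ ($\nabla$ the Levi-Civita connection). It is $\eta$-Einstein if $r_{ij}=\lambda g_{ij}+\mu\eta_i\eta_j$ with scalars $\lambda,\mu$. A-frames and AG-structure space: $a,b,c,d,h\in\{1,\dots,n\}$,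 $\hat a=a+n$, $\hat{\hat a}=a$, $\hat 0=0$; $i,j,k,l\in\{0,1,\dots,2n\}$; repeated indices are summed. For an orthonormal frame $\{\xi,e_1,\dots,e_n,\Phi e_1,\dots,\Phi e_n\}$ set $\varepsilon_0=\xi$, $\varepsilon_a=\frac1{\sqrt2}(\mathrm{id}-\sqrt{-1}\Phi)e_a$, $\varepsilon_{\hat a}=\frac1{\sqrt2}(\mathrm{id}+\sqrt{-1}\Phi)e_a$. The set of all these (complex) frames is the AG-structure space, and components of tensors are taken in such frames: $g_{00}=1$, $g_{a0}=g_{ab}=g_{\hat a\hat b}=0$, $g_{\hat ab}=\delta^a_b$; $\Phi\varepsilon_a=\sqrt{-1}\varepsilon_a$, $\Phi\varepsilon_{\hat a}=-\sqrt{-1}\varepsilon_{\hat a}$. The conjugate of a component replaces each index $i$ by $\hat i$ and takes the complex conjugate. Brackets $[\,\cdot\,\cdot\,]$ denote antisymmetrization with factor $\frac12$. $R(X,Y)Z=R^i_{jkl}X^kY^lZ^j\varepsilon_i$ is the Riemann tensor; for a $(3,1)$-tensor $T$, $T(X,Y,Z,W)=g(T(Z,W)Y,X)$, so $R_{ijkl}=R^{\hat i}_{jkl}$. $r_{jl}=g^{ik}R_{ijkl}$ is the Ricci tensor and $s$ the scalar curvature. Generalized curvature tensor, with scalars $a_0,a_1,a_2$: $B_{ijkl}=a_0R_{ijkl}+a_1\{g_{ik}r_{jl}-g_{il}r_{jk}+r_{ik}g_{jl}-r_{il}g_{jk}\}+2a_2s\{g_{ik}g_{jl}-g_{il}g_{jk}\}$.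 Structure functions of the class of Kenmotsu type (distinct from the tensor $B_{ijkl}$): $B^{ab}{}_c$ (first Kirichenko tensor, $B^{ab}{}_c=-B^{ba}{}_c$), with conjugate $B_{ab}{}^c$, is determined in the dual coframe ($\omega=\omega^0$, $\omega_a=\omega^{\hat a}$) by $d\omega^a=\omega^a_b\wedge\omega^b+B^{ab}{}_c\,\omega^c\wedge\omega_b-\omega^a\wedge\omega$, $d\omega_a=-\omega^b_a\wedge\omega_b+B_{ab}{}^c\,\omega_c\wedge\omega^b-\omega_a\wedge\omega$, $d\omega=0$. The functions $A^a_{bcd}$ (antisymmetric in $c,d$), $A^{ad}_{bc}$, $B^{ab}{}_{cd}$, $B^{abd}{}_c$ come from the further structure equations and are related to the curvature by the known formulas $R^a_{0c0}=-\delta^a_c$; $R^a_{\hat bcd}=2(B^{ab}{}_{[cd]}-\delta^a_{[c}\delta^b_{d]})$; $R^a_{\hat bc\hat d}=B^{abd}{}_c-B^{ab}{}_hB^{hd}{}_c$; $R^a_{bcd}=2A^a_{bcd}$; $R^a_{bc\hat d}=A^{ad}_{bc}-B^{ah}{}_cB_{bh}{}^d-\delta^a_c\delta^d_b$; the remaining components of $R$ follow by the first Bianchi identity or conjugation or vanish identically. *)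

theory Defs
  imports "HOL-Analysis.Analysis" "HOL-Library.Function_Algebras"
begin

section \<open>Smooth manifolds, tangent vectors and vector fields\<close>

text \<open>
  The manifold is a whole type \<open>'a\<close>, with an atlas of charts \<open>(U, \<phi>)\<close> into a Euclidean
  space \<open>'e\<close>; its dimension is \<open>DIM('e)\<close>.
\<close>

fun Ck_on :: "nat \<Rightarrow> 'e::euclidean_space set \<Rightarrow> ('e \<Rightarrow> 'f::real_normed_vector) \<Rightarrow> bool" where
  "Ck_on 0 S f \<longleftrightarrow> continuous_on S f"
| "Ck_on (Suc k) S f \<longleftrightarrow>
     (\<forall>x\<in>S. f differentiable (at x)) \<and> (\<forall>v. Ck_on k S (\<lambda>x. frechet_derivative f (at x) v))"

text \<open>Used for open \<open>S\<close> only.\<close>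

definition smooth_on :: "'e::euclidean_space set \<Rightarrow> ('e \<Rightarrow> 'f::real_normed_vector) \<Rightarrow> bool" where
  "smooth_on S f \<longleftrightarrow> (\<forall>k. Ck_on k S f)"

type_synonym ('a, 'e) chart = "'a set \<times> ('a \<Rightarrow> 'e)"

definition smooth_manifold ::
  "('a::{t2_space, second_countable_topology}, 'e::euclidean_space) chart set \<Rightarrow> bool" where
  "smooth_manifold A \<longleftrightarrow>
     (\<Union>(U, \<phi>)\<in>A. U) = UNIV \<and>
     (\<forall>(U, \<phi>)\<in>A. open U \<and> open (\<phi> ` U) \<and> homeomorphism U (\<phi> ` U) \<phi> (inv_into U \<phi>)) \<and>
     (\<forall>(U, \<phi>)\<in>A. \<forall>(V, \<psi>)\<in>A. smooth_on (\<phi> ` (U \<inter> V)) (\<psi> \<circ> inv_into U \<phi>))"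

definition smooth_fun :: "('a, 'e::euclidean_space) chart set \<Rightarrow> ('a \<Rightarrow> real) \<Rightarrow> bool" where
  "smooth_fun A f \<longleftrightarrow> (\<forall>(U, \<phi>)\<in>A. smooth_on (\<phi> ` U) (f \<circ> inv_into U \<phi>))"

type_synonym 'a tvec = "('a \<Rightarrow> real) \<Rightarrow> real"
type_synonym 'a vfield = "'a \<Rightarrow> 'a tvec"

text \<open>
  Tangent vectors at \<open>p\<close> are the derivations at \<open>p\<close> of the algebra of smooth functions. They are
  set to \<open>0\<close> on non-smooth functions, so that equality of tangent vectors is equality in HOL.
\<close>

definition tangent_space :: "('a, 'e::euclidean_space) chart set \<Rightarrow> 'a \<Rightarrow> 'a tvec set" where
  "tangent_space A p = {v.
     (\<forall>f h. smooth_fun A f \<longrightarrow> smooth_fun A h \<longrightarrow> v (\<lambda>q. f q + h q) = v f + v h) \<and>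
     (\<forall>c f. smooth_fun A f \<longrightarrow> v (\<lambda>q. c * f q) = c * v f) \<and>
     (\<forall>f h. smooth_fun A f \<longrightarrow> smooth_fun A h \<longrightarrow> v (\<lambda>q. f q * h q) = f p * v h + h p * v f) \<and>
     (\<forall>f. \<not> smooth_fun A f \<longrightarrow> v f = 0)}"

definition tsmult :: "real \<Rightarrow> 'a tvec \<Rightarrow> 'a tvec" where
  "tsmult c v = (\<lambda>f. c * v f)"

definition vfields :: "('a, 'e::euclidean_space) chart set \<Rightarrow> 'a vfield set" where
  "vfields A = {X. (\<forall>p. X p \<in> tangent_space A p) \<and>
                   (\<forall>f. smooth_fun A f \<longrightarrow> smooth_fun A (\<lambda>p. X p f))}"

definition vsmult :: "('a \<Rightarrow> real) \<Rightarrow> 'a vfield \<Rightarrow> 'a vfield" where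
  "vsmult f X = (\<lambda>p. tsmult (f p) (X p))"

definition lie_bracket :: "'a vfield \<Rightarrow> 'a vfield \<Rightarrow> 'a vfield" where
  "lie_bracket X Y = (\<lambda>p f. X p (\<lambda>q. Y q f) - Y p (\<lambda>q. X q f))"

text \<open>
  Tensors given as \<open>C\<^sup>\<infinity>(M)\<close>-multilinear maps on vector fields are evaluated on tangent
  vectors through this extension of a tangent vector to a vector field; by tensoriality the
  value does not depend on the choice.
\<close>

definition extend :: "('a, 'e::euclidean_space) chart set \<Rightarrow> 'a \<Rightarrow> 'a tvec \<Rightarrow> 'a vfield" where
  "extend A p v = (SOME X. X \<in> vfields A \<and> X p = v)"

section \<open>Riemannian geometry\<close>

type_synonym 'a metric = "'a \<Rightarrow> 'a tvec \<Rightarrow> 'a tvec \<Rightarrow> real"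
type_synonym 'a connection = "'a vfield \<Rightarrow> 'a vfield \<Rightarrow> 'a vfield"

definition riemannian_metric :: "('a, 'e::euclidean_space) chart set \<Rightarrow> 'a metric \<Rightarrow> bool" where
  "riemannian_metric A g \<longleftrightarrow>
     (\<forall>p. \<forall>u\<in>tangent_space A p. \<forall>v\<in>tangent_space A p.
        g p u v = g p v u \<and>
        (\<forall>c. g p (tsmult c u) v = c * g p u v) \<and>
        (\<forall>w\<in>tangent_space A p. g p (u + w) v = g p u v + g p w v)) \<and>
     (\<forall>p. \<forall>u\<in>tangent_space A p. u \<noteq> 0 \<longrightarrow> g p u u > 0) \<and>
     (\<forall>X\<in>vfields A. \<forall>Y\<in>vfields A. smooth_fun A (\<lambda>p. g p (X p) (Y p)))"

definition affine_connection ::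
  "('a, 'e::euclidean_space) chart set \<Rightarrow> 'a connection \<Rightarrow> bool" where
  "affine_connection A nab \<longleftrightarrow>
     (\<forall>X\<in>vfields A. \<forall>Y\<in>vfields A. \<forall>Z\<in>vfields A. \<forall>f. smooth_fun A f \<longrightarrow>
        nab X Y \<in> vfields A \<and>
        nab (X + Y) Z = nab X Z + nab Y Z \<and>
        nab (vsmult f X) Y = vsmult f (nab X Y) \<and>
        nab X (Y + Z) = nab X Y + nab X Z \<and>
        nab X (vsmult f Y) = vsmult (\<lambda>p. X p f) Y + vsmult f (nab X Y))"

definition levi_civita ::
  "('a, 'e::euclidean_space) chart set \<Rightarrow> 'a metric \<Rightarrow> 'a connection \<Rightarrow> bool" where
  "levi_civita A g nab \<longleftrightarrow> affine_connection A nab \<and>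
     (\<forall>X\<in>vfields A. \<forall>Y\<in>vfields A. nab X Y - nab Y X = lie_bracket X Y) \<and>
     (\<forall>X\<in>vfields A. \<forall>Y\<in>vfields A. \<forall>Z\<in>vfields A. \<forall>p.
        X p (\<lambda>q. g q (Y q) (Z q)) = g p (nab X Y p) (Z p) + g p (Y p) (nab X Z p))"

definition curvature :: "'a connection \<Rightarrow> 'a vfield \<Rightarrow> 'a vfield \<Rightarrow> 'a vfield \<Rightarrow> 'a vfield" where
  "curvature nab X Y Z =
     nab X (nab Y Z) - nab Y (nab X Z) - nab (lie_bracket X Y) Z"

text \<open>Argument order: \<open>R(X,Y,Z,W) = g(R(Z,W)Y, X)\<close>.\<close>

definition riem ::
  "('a, 'e::euclidean_space) chart set \<Rightarrow> 'a metric \<Rightarrow> 'a connection \<Rightarrow> 'a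
     \<Rightarrow> 'a tvec \<Rightarrow> 'a tvec \<Rightarrow> 'a tvec \<Rightarrow> 'a tvec \<Rightarrow> real" where
  "riem A g nab p x y z w =
     g p (curvature nab (extend A p z) (extend A p w) (extend A p y) p) x"

definition orthonormal_basis ::
  "('a, 'e::euclidean_space) chart set \<Rightarrow> 'a metric \<Rightarrow> 'a \<Rightarrow> (nat \<Rightarrow> 'a tvec) \<Rightarrow> bool" where
  "orthonormal_basis A g p E \<longleftrightarrow>
     (\<forall>i<DIM('e). E i \<in> tangent_space A p) \<and>
     (\<forall>i<DIM('e). \<forall>j<DIM('e). g p (E i) (E j) = (if i = j then 1 else 0))"

text \<open>
  The contraction \<open>r\<^sub>j\<^sub>l = g\<^sup>i\<^sup>k R\<^sub>i\<^sub>j\<^sub>k\<^sub>l\<close> and the trace \<open>s = g\<^sup>j\<^sup>l r\<^sub>j\<^sub>l\<close>, which do not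
  depend on the frame, are taken in an orthonormal frame, where \<open>g\<^sup>i\<^sup>k = \<delta>\<^sup>i\<^sup>k\<close>.
\<close>

definition ricci ::
  "('a, 'e::euclidean_space) chart set \<Rightarrow> 'a metric \<Rightarrow> 'a connection \<Rightarrow> 'a
     \<Rightarrow> 'a tvec \<Rightarrow> 'a tvec \<Rightarrow> real" where
  "ricci A g nab p y w =
     (let E = (SOME E. orthonormal_basis A g p E)
      in \<Sum>i<DIM('e). riem A g nab p (E i) y (E i) w)"

definition scalar_curvature ::
  "('a, 'e::euclidean_space) chart set \<Rightarrow> 'a metric \<Rightarrow> 'a connection \<Rightarrow> 'a \<Rightarrow> real" where
  "scalar_curvature A g nab p =
     (let E = (SOME E. orthonormal_basis A g p E)
      in \<Sum>i<DIM('e). ricci A g nab p (E i) (E i))"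

definition gen_curvature ::
  "('a, 'e::euclidean_space) chart set \<Rightarrow> 'a metric \<Rightarrow> 'a connection
     \<Rightarrow> ('a \<Rightarrow> real) \<Rightarrow> ('a \<Rightarrow> real) \<Rightarrow> ('a \<Rightarrow> real)
     \<Rightarrow> 'a \<Rightarrow> 'a tvec \<Rightarrow> 'a tvec \<Rightarrow> 'a tvec \<Rightarrow> 'a tvec \<Rightarrow> real" where
  "gen_curvature A g nab a0 a1 a2 p x y z w =
     a0 p * riem A g nab p x y z w
     + a1 p * (g p x z * ricci A g nab p y w - g p x w * ricci A g nab p y z
               + ricci A g nab p x z * g p y w - ricci A g nab p x w * g p y z)
     + 2 * a2 p * scalar_curvature A g nab p * (g p x z * g p y w - g p x w * g p y z)"

definition flat_gen_curvature ::
  "('a, 'e::euclidean_space) chart set \<Rightarrow> 'a metric \<Rightarrow> 'a connection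
     \<Rightarrow> ('a \<Rightarrow> real) \<Rightarrow> ('a \<Rightarrow> real) \<Rightarrow> ('a \<Rightarrow> real) \<Rightarrow> bool" where
  "flat_gen_curvature A g nab a0 a1 a2 \<longleftrightarrow>
     (\<forall>p. \<forall>x\<in>tangent_space A p. \<forall>y\<in>tangent_space A p.
          \<forall>z\<in>tangent_space A p. \<forall>w\<in>tangent_space A p.
        gen_curvature A g nab a0 a1 a2 p x y z w = 0)"

section \<open>ACR-manifolds and the class of Kenmotsu type\<close>

definition eta :: "'a metric \<Rightarrow> 'a vfield \<Rightarrow> 'a \<Rightarrow> 'a tvec \<Rightarrow> real" where
  "eta g \<xi> p u = g p u (\<xi> p)"

definition acr_manifold ::
  "('a::{t2_space, second_countable_topology}, 'e::euclidean_space) chart set \<Rightarrow> nat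
     \<Rightarrow> ('a vfield \<Rightarrow> 'a vfield) \<Rightarrow> 'a vfield \<Rightarrow> 'a metric \<Rightarrow> bool" where
  "acr_manifold A n \<Phi> \<xi> g \<longleftrightarrow>
     smooth_manifold A \<and> DIM('e) = 2 * n + 1 \<and>
     riemannian_metric A g \<and> \<xi> \<in> vfields A \<and>
     (\<forall>X\<in>vfields A. \<Phi> X \<in> vfields A) \<and>
     (\<forall>X\<in>vfields A. \<forall>Y\<in>vfields A. \<Phi> (X + Y) = \<Phi> X + \<Phi> Y) \<and>
     (\<forall>f. \<forall>X\<in>vfields A. smooth_fun A f \<longrightarrow> \<Phi> (vsmult f X) = vsmult f (\<Phi> X)) \<and>
     \<Phi> \<xi> = 0 \<and>
     (\<forall>p. eta g \<xi> p (\<xi> p) = 1) \<and>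
     (\<forall>X\<in>vfields A. \<forall>p. eta g \<xi> p (\<Phi> X p) = 0) \<and>
     (\<forall>X\<in>vfields A. \<Phi> (\<Phi> X) = - X + vsmult (\<lambda>p. eta g \<xi> p (X p)) \<xi>) \<and>
     (\<forall>X\<in>vfields A. \<forall>Y\<in>vfields A. \<forall>p.
        g p (\<Phi> X p) (\<Phi> Y p) = g p (X p) (Y p) - eta g \<xi> p (X p) * eta g \<xi> p (Y p))"

definition cov_deriv_endo ::
  "'a connection \<Rightarrow> ('a vfield \<Rightarrow> 'a vfield) \<Rightarrow> 'a vfield \<Rightarrow> 'a vfield \<Rightarrow> 'a vfield" where
  "cov_deriv_endo nab \<Phi> X Y = nab X (\<Phi> Y) - \<Phi> (nab X Y)"

definition kenmotsu_type ::
  "('a, 'e::euclidean_space) chart set \<Rightarrow> ('a vfield \<Rightarrow> 'a vfield) \<Rightarrow> 'a vfield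
     \<Rightarrow> 'a metric \<Rightarrow> 'a connection \<Rightarrow> bool" where
  "kenmotsu_type A \<Phi> \<xi> g nab \<longleftrightarrow>
     (\<forall>X\<in>vfields A. \<forall>Y\<in>vfields A.
        cov_deriv_endo nab \<Phi> X Y - cov_deriv_endo nab \<Phi> (\<Phi> X) (\<Phi> Y)
          = - vsmult (\<lambda>p. eta g \<xi> p (Y p)) (\<Phi> X))"

text \<open>The scalars \<open>\<lambda>\<close>, \<open>\<mu>\<close> (like \<open>a\<^sub>0\<close>, \<open>a\<^sub>1\<close>, \<open>a\<^sub>2\<close> above) are real functions on the manifold.\<close>

definition eta_einstein ::
  "('a, 'e::euclidean_space) chart set \<Rightarrow> 'a vfield \<Rightarrow> 'a metric \<Rightarrow> 'a connection
     \<Rightarrow> ('a \<Rightarrow> real) \<Rightarrow> ('a \<Rightarrow> real) \<Rightarrow> bool" where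
  "eta_einstein A \<xi> g nab lam mu \<longleftrightarrow>
     (\<forall>p. \<forall>u\<in>tangent_space A p. \<forall>v\<in>tangent_space A p.
        ricci A g nab p u v = lam p * g p u v + mu p * eta g \<xi> p u * eta g \<xi> p v)"

section \<open>The AG-structure space\<close>

text \<open>
  Complex tangent vectors \<open>u + \<i> v\<close> are represented by \<open>\<lambda>f. u f + \<i> v f\<close>.
\<close>

type_synonym 'a ctvec = "('a \<Rightarrow> real) \<Rightarrow> complex"
type_synonym 'a cframe = "nat \<Rightarrow> 'a ctvec"

definition cextend :: "('a tvec \<Rightarrow> complex) \<Rightarrow> 'a ctvec \<Rightarrow> complex" where
  "cextend T w = T (\<lambda>f. Re (w f)) + \<i> * T (\<lambda>f. Im (w f))"

definition cextend2 :: "('a tvec \<Rightarrow> 'a tvec \<Rightarrow> real) \<Rightarrow> 'a ctvec \<Rightarrow> 'a ctvec \<Rightarrow> complex" where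
  "cextend2 T x y = cextend (\<lambda>u. cextend (\<lambda>v. complex_of_real (T u v)) y) x"

definition cextend4 ::
  "('a tvec \<Rightarrow> 'a tvec \<Rightarrow> 'a tvec \<Rightarrow> 'a tvec \<Rightarrow> real)
     \<Rightarrow> 'a ctvec \<Rightarrow> 'a ctvec \<Rightarrow> 'a ctvec \<Rightarrow> 'a ctvec \<Rightarrow> complex" where
  "cextend4 T x y z w =
     cextend (\<lambda>a. cextend (\<lambda>b. cextend (\<lambda>c. cextend (\<lambda>d.
       complex_of_real (T a b c d)) w) z) y) x"

definition hat :: "nat \<Rightarrow> nat \<Rightarrow> nat" where
  "hat n i = (if i = 0 then 0 else if i \<le> n then i + n else i - n)"

definition Phi_at ::
  "('a, 'e::euclidean_space) chart set \<Rightarrow> ('a vfield \<Rightarrow> 'a vfield) \<Rightarrow> 'a \<Rightarrow> 'a tvec \<Rightarrow> 'a tvec" where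
  "Phi_at A \<Phi> p v = \<Phi> (extend A p v) p"

text \<open>The frame \<open>{\<xi>, e\<^sub>1, \<dots>, e\<^sub>n, \<Phi> e\<^sub>1, \<dots>, \<Phi> e\<^sub>n}\<close>, numbered \<open>0, \<dots>, 2n\<close>.\<close>

definition real_frame ::
  "('a, 'e::euclidean_space) chart set \<Rightarrow> nat \<Rightarrow> ('a vfield \<Rightarrow> 'a vfield) \<Rightarrow> 'a vfield
     \<Rightarrow> 'a \<Rightarrow> (nat \<Rightarrow> 'a tvec) \<Rightarrow> nat \<Rightarrow> 'a tvec" where
  "real_frame A n \<Phi> \<xi> p e i =
     (if i = 0 then \<xi> p else if i \<le> n then e i else Phi_at A \<Phi> p (e (i - n)))"

definition adapted ::
  "('a, 'e::euclidean_space) chart set \<Rightarrow> nat \<Rightarrow> ('a vfield \<Rightarrow> 'a vfield) \<Rightarrow> 'a vfield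
     \<Rightarrow> 'a metric \<Rightarrow> 'a \<Rightarrow> (nat \<Rightarrow> 'a tvec) \<Rightarrow> bool" where
  "adapted A n \<Phi> \<xi> g p e \<longleftrightarrow>
     (\<forall>a\<in>{1..n}. e a \<in> tangent_space A p) \<and>
     (\<forall>i\<in>{0..2*n}. \<forall>j\<in>{0..2*n}.
        g p (real_frame A n \<Phi> \<xi> p e i) (real_frame A n \<Phi> \<xi> p e j) = (if i = j then 1 else 0))"

definition a_frame ::
  "('a, 'e::euclidean_space) chart set \<Rightarrow> nat \<Rightarrow> ('a vfield \<Rightarrow> 'a vfield) \<Rightarrow> 'a vfield
     \<Rightarrow> 'a \<Rightarrow> (nat \<Rightarrow> 'a tvec) \<Rightarrow> 'a cframe" where
  "a_frame A n \<Phi> \<xi> p e i =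
     (if i = 0 then (\<lambda>f. complex_of_real (\<xi> p f))
      else if i \<le> n then
        (\<lambda>f. (complex_of_real (e i f) - \<i> * complex_of_real (Phi_at A \<Phi> p (e i) f))
               / complex_of_real (sqrt 2))
      else if i \<le> 2 * n then
        (\<lambda>f. (complex_of_real (e (i - n) f) + \<i> * complex_of_real (Phi_at A \<Phi> p (e (i - n)) f))
               / complex_of_real (sqrt 2))
      else (\<lambda>f. 0))"

definition AG_space ::
  "('a, 'e::euclidean_space) chart set \<Rightarrow> nat \<Rightarrow> ('a vfield \<Rightarrow> 'a vfield) \<Rightarrow> 'a vfield
     \<Rightarrow> 'a metric \<Rightarrow> ('a \<times> 'a cframe) set" where
  "AG_space A n \<Phi> \<xi> g = {(p, a_frame A n \<Phi> \<xi> p e) | p e. adapted A n \<Phi> \<xi> g p e}"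

text \<open>The component \<open>R\<^sup>i\<^sub>j\<^sub>k\<^sub>l\<close>, by \<open>R\<^sub>i\<^sub>j\<^sub>k\<^sub>l = g(R(\<epsilon>\<^sub>k,\<epsilon>\<^sub>l)\<epsilon>\<^sub>j, \<epsilon>\<^sub>i)\<close> with \<open>i\<close> raised to \<open>hat i\<close>.\<close>

definition riem_up ::
  "('a, 'e::euclidean_space) chart set \<Rightarrow> nat \<Rightarrow> 'a metric \<Rightarrow> 'a connection
     \<Rightarrow> 'a \<times> 'a cframe \<Rightarrow> nat \<Rightarrow> nat \<Rightarrow> nat \<Rightarrow> nat \<Rightarrow> complex" where
  "riem_up A n g nab x i j k l =
     (let (p, \<epsilon>) = x in cextend4 (riem A g nab p) (\<epsilon> (hat n i)) (\<epsilon> j) (\<epsilon> k) (\<epsilon> l))"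

section \<open>Structure functions\<close>

definition coframe ::
  "nat \<Rightarrow> 'a metric \<Rightarrow> 'a \<Rightarrow> 'a cframe \<Rightarrow> nat \<Rightarrow> 'a tvec \<Rightarrow> complex" where
  "coframe n g p \<epsilon> i u = cextend2 (g p) (\<lambda>f. complex_of_real (u f)) (\<epsilon> (hat n i))"

definition wedge ::
  "('a tvec \<Rightarrow> complex) \<Rightarrow> ('a tvec \<Rightarrow> complex) \<Rightarrow> 'a tvec \<Rightarrow> 'a tvec \<Rightarrow> complex" where
  "wedge \<alpha> \<beta> u v = \<alpha> u * \<beta> v - \<alpha> v * \<beta> u"

definition cderiv :: "'a tvec \<Rightarrow> ('a \<Rightarrow> complex) \<Rightarrow> complex" where
  "cderiv v h = complex_of_real (v (\<lambda>q. Re (h q))) + \<i> * complex_of_real (v (\<lambda>q. Im (h q)))"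

definition ext_deriv ::
  "('a \<Rightarrow> 'a tvec \<Rightarrow> complex) \<Rightarrow> 'a vfield \<Rightarrow> 'a vfield \<Rightarrow> 'a \<Rightarrow> complex" where
  "ext_deriv \<alpha> X Y p =
     cderiv (X p) (\<lambda>q. \<alpha> q (Y q)) - cderiv (Y p) (\<lambda>q. \<alpha> q (X q)) - \<alpha> p (lie_bracket X Y p)"

text \<open>
  \<open>B x a b c\<close> stands for \<open>B\<^sup>a\<^sup>b\<^sub>c\<close> at the point \<open>x\<close> of the AG-structure space, and its complex
  conjugate for \<open>B\<^sub>a\<^sub>b\<^sup>c\<close>; \<open>W a b\<close> is the form \<open>\<omega>\<^sup>a\<^sub>b\<close>. The structure equations are required
  along every local section of the AG-structure space over an open set \<open>U\<close>. Local sections come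
  from global vector fields \<open>e\<^sub>1, \<dots>, e\<^sub>n\<close> that are adapted on \<open>U\<close>; by cutting off, every
  section is locally of this form. Given the section, the two equations and the antisymmetry
  determine \<open>B\<close> and all \<open>\<omega>\<^sup>a\<^sub>b\<close>, which are then smooth.
\<close>

definition first_kirichenko_tensor ::
  "('a::topological_space, 'e::euclidean_space) chart set \<Rightarrow> nat \<Rightarrow> ('a vfield \<Rightarrow> 'a vfield)
     \<Rightarrow> 'a vfield \<Rightarrow> 'a metric
     \<Rightarrow> ('a \<times> 'a cframe \<Rightarrow> nat \<Rightarrow> nat \<Rightarrow> nat \<Rightarrow> complex) \<Rightarrow> bool" where
  "first_kirichenko_tensor A n \<Phi> \<xi> g B \<longleftrightarrow>
     (\<forall>x\<in>AG_space A n \<Phi> \<xi> g. \<forall>a\<in>{1..n}. \<forall>b\<in>{1..n}. \<forall>c\<in>{1..n}. B x a b c = - B x b a c) \<and>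
     (\<forall>U e. open U \<longrightarrow> (\<forall>a\<in>{1..n}. e a \<in> vfields A) \<longrightarrow>
        (\<forall>q\<in>U. adapted A n \<Phi> \<xi> g q (\<lambda>a. e a q)) \<longrightarrow>
        (let \<epsilon> = (\<lambda>q. a_frame A n \<Phi> \<xi> q (\<lambda>a. e a q));
             \<omega> = (\<lambda>i q. coframe n g q (\<epsilon> q) i)
         in \<exists>W :: nat \<Rightarrow> nat \<Rightarrow> 'a \<Rightarrow> 'a tvec \<Rightarrow> complex.
           \<forall>q\<in>U.
             (\<forall>a\<in>{1..n}. \<forall>b\<in>{1..n}. \<forall>u\<in>tangent_space A q. \<forall>v\<in>tangent_space A q. \<forall>c.
                W a b q (u + v) = W a b q u + W a b q v \<and>
                W a b q (tsmult c u) = complex_of_real c * W a b q u) \<and>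
             (\<forall>X\<in>vfields A. \<forall>Y\<in>vfields A.
                (\<forall>a\<in>{1..n}.
                   ext_deriv (\<omega> a) X Y q =
                     (\<Sum>b=1..n. wedge (W a b q) (\<omega> b q) (X q) (Y q))
                     + (\<Sum>b=1..n. \<Sum>c=1..n.
                          B (q, \<epsilon> q) a b c * wedge (\<omega> c q) (\<omega> (hat n b) q) (X q) (Y q))
                     - wedge (\<omega> a q) (\<omega> 0 q) (X q) (Y q)) \<and>
                (\<forall>a\<in>{1..n}.
                   ext_deriv (\<omega> (hat n a)) X Y q =
                     - (\<Sum>b=1..n. wedge (W b a q) (\<omega> (hat n b) q) (X q) (Y q))
                     + (\<Sum>b=1..n. \<Sum>c=1..n.
                          cnj (B (q, \<epsilon> q) a b c)
                            * wedge (\<omega> (hat n c) q) (\<omega> b q) (X q) (Y q))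
                     - wedge (\<omega> (hat n a) q) (\<omega> 0 q) (X q) (Y q)) \<and>
                ext_deriv (\<omega> 0) X Y q = 0)))"

definition delta :: "nat \<Rightarrow> nat \<Rightarrow> complex" where
  "delta a b = (if a = b then 1 else 0)"

definition alt :: "(nat \<Rightarrow> nat \<Rightarrow> complex) \<Rightarrow> nat \<Rightarrow> nat \<Rightarrow> complex" where
  "alt t c d = (t c d - t d c) / 2"

text \<open>
  The remaining structure functions, specified through their relation to the curvature:
  \<open>A1 x a b c d\<close> is \<open>A\<^sup>a\<^sub>b\<^sub>c\<^sub>d\<close>, \<open>A2 x a d b c\<close> is \<open>A\<^sup>a\<^sup>d\<^sub>b\<^sub>c\<close>, \<open>B1 x a b c d\<close> is
  \<open>B\<^sup>a\<^sup>b\<^sub>c\<^sub>d\<close>, and \<open>B2 x a b d c\<close> is \<open>B\<^sup>a\<^sup>b\<^sup>d\<^sub>c\<close> (upper indices first).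
\<close>

definition structure_functions ::
  "('a::topological_space, 'e::euclidean_space) chart set \<Rightarrow> nat \<Rightarrow> ('a vfield \<Rightarrow> 'a vfield)
     \<Rightarrow> 'a vfield \<Rightarrow> 'a metric \<Rightarrow> 'a connection
     \<Rightarrow> ('a \<times> 'a cframe \<Rightarrow> nat \<Rightarrow> nat \<Rightarrow> nat \<Rightarrow> complex)
     \<Rightarrow> ('a \<times> 'a cframe \<Rightarrow> nat \<Rightarrow> nat \<Rightarrow> nat \<Rightarrow> nat \<Rightarrow> complex)
     \<Rightarrow> ('a \<times> 'a cframe \<Rightarrow> nat \<Rightarrow> nat \<Rightarrow> nat \<Rightarrow> nat \<Rightarrow> complex)
     \<Rightarrow> ('a \<times> 'a cframe \<Rightarrow> nat \<Rightarrow> nat \<Rightarrow> nat \<Rightarrow> nat \<Rightarrow> complex)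
     \<Rightarrow> ('a \<times> 'a cframe \<Rightarrow> nat \<Rightarrow> nat \<Rightarrow> nat \<Rightarrow> nat \<Rightarrow> complex) \<Rightarrow> bool" where
  "structure_functions A n \<Phi> \<xi> g nab B A1 A2 B1 B2 \<longleftrightarrow>
     first_kirichenko_tensor A n \<Phi> \<xi> g B \<and>
     (\<forall>x\<in>AG_space A n \<Phi> \<xi> g. \<forall>a\<in>{1..n}. \<forall>b\<in>{1..n}. \<forall>c\<in>{1..n}. \<forall>d\<in>{1..n}.
        A1 x a b c d = - A1 x a b d c \<and>
        riem_up A n g nab x a (hat n b) c d
          = 2 * (alt (B1 x a b) c d - alt (\<lambda>c d. delta a c * delta b d) c d) \<and>
        riem_up A n g nab x a (hat n b) c (hat n d)
          = B2 x a b d c - (\<Sum>h=1..n. B x a b h * B x h d c) \<and>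
        riem_up A n g nab x a b c d = 2 * A1 x a b c d \<and>
        riem_up A n g nab x a b c (hat n d)
          = A2 x a d b c - (\<Sum>h=1..n. B x a h c * cnj (B x b h d)) - delta a c * delta d b)"

end

theory Submission
  imports Defs
begin

text \<open>
  Everything is linear algebra at a point once three facts about curvature are known. Putting
  \<open>Y = \<xi>\<close> in the Kenmotsu condition gives \<open>\<nabla>\<^sub>X \<xi> = X - \<eta>(X) \<xi>\<close>, hence
  \<open>R(X,Y)\<xi> = \<eta>(X) Y - \<eta>(Y) X\<close> and \<open>r(\<xi>,\<sqdot>) = -2n \<eta>\<close>. For horizontal fields the condition says
  that \<open>\<nabla>\<close> preserves the (isotropic) eigendistribution of \<open>\<Phi>\<close> for \<open>\<i>\<close> along itself, so
  \<open>R\<^sub>a\<^sub>b\<^sub>c\<^sub>d = 0\<close>. If the generalized curvature tensor \<open>G\<close> vanishes, then \<open>G(\<xi>,u,\<xi>,v) = 0\<close> is the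
  \<open>\<eta>\<close>-Einstein condition with the stated \<open>\<lambda>\<close> and \<open>\<mu>\<close>. Given that condition, \<open>G(\<xi>,\<sqdot>,\<sqdot>,\<sqdot>) = 0\<close>
  and on horizontal vectors \<open>G\<close> is \<open>a\<^sub>0\<close> times
  \<open>R\<^sub>i\<^sub>j\<^sub>k\<^sub>l - (a\<^sub>1 \<mu> / a\<^sub>0 - 1) (g\<^sub>i\<^sub>k g\<^sub>j\<^sub>l - g\<^sub>i\<^sub>l g\<^sub>j\<^sub>k)\<close>; by the curvature symmetries and conjugation
  its components in an A-frame vanish iff the three listed types do, the type without hats being
  zero anyway.

  The pointwise tensors are defined by extending tangent vectors, which are derivations, to global
  fields. Hadamard's lemma and bump functions provide cut-off coordinate frames, hence such
  extensions, tensoriality, and the dimension of the tangent spaces.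
\<close>

section \<open>Calculus of smooth functions on open sets\<close>

text \<open>The constants are forced. Since r(\<xi>,\<xi>) = -2n, the \<eta>-Einstein condition
  requires \<lambda> + \<mu> = -2n. Planes containing \<xi> have sectional curvature -1, so for
  horizontal u, v the equation G(\<xi>,u,\<xi>,v) = 0 reads a1 r(u,v) = (a0 + 2n a1 - 2 a2 s)
  g(u,v), which is \<lambda>. On horizontal vectors the metric term of G then has the factor 2 a1
  \<lambda> + 2 a2 s, and eliminating s turns it into a0 - a1 \<mu>. The resulting coefficient a1
  \<mu> / a0 - 1 loses its -1 against the \<delta>\<delta> terms in the curvature formulas for
  \<open>A2\<close> and \<open>B1\<close>, so the theorem shows a1 \<mu> / a0 alone.

  \<open>B2\<close> gets no condition of its own: with the index lowered its component has three
  hats, hence is conjugate, up to the curvature symmetries, to one of the type of \<open>A1\<close>.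

  Throughout, the scalar curvature is carried as a number at the point, and the Ricci tensor is
  evaluated in the orthonormal frame that its definition chooses.\<close>

lemma Ck_on_cong:
  assumes "open S" "\<And>x. x \<in> S \<Longrightarrow> f x = g x" "Ck_on k S f"
  shows "Ck_on k S g"
  using assms(2,3)
proof (induction k arbitrary: f g)
  case 0
  then show ?case by (simp cong: continuous_on_cong)
next
  case (Suc k)
  have D: "(g has_derivative frechet_derivative f (at x)) (at x)" if "x \<in> S" for x
  proof (rule has_derivative_transform_within_open[OF _ \<open>open S\<close> that])
    show "(f has_derivative frechet_derivative f (at x)) (at x)"
      using Suc.prems(2) that by (simp add: frechet_derivative_works)
  qed (use Suc.prems(1) in auto)
  have "Ck_on k S (\<lambda>x. frechet_derivative g (at x) v)" for v
  proof (rule Suc.IH)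
    show "frechet_derivative f (at x) v = frechet_derivative g (at x) v" if "x \<in> S" for x
      using frechet_derivative_at[OF D[OF that]] by simp
  qed (use Suc.prems(2) in simp)
  with D show ?case unfolding Ck_on.simps by (blast intro: differentiableI)
qed

text \<open>Lets the closure rules below work with an explicit derivative \<open>D\<close> in place
  of \<open>frechet_derivative\<close>, whose values are fixed by uniqueness of derivatives.\<close>

lemma Ck_on_SucI:
  assumes "open S" "\<And>x. x \<in> S \<Longrightarrow> (f has_derivative D x) (at x)"
    and "\<And>v. Ck_on k S (\<lambda>x. D x v)"
  shows "Ck_on (Suc k) S f"
proof -
  have "Ck_on k S (\<lambda>x. frechet_derivative f (at x) v)" for v
  proof (rule Ck_on_cong[OF assms(1) _ assms(3)])
    show "D x v = frechet_derivative f (at x) v" if "x \<in> S" for x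
      using frechet_derivative_at[OF assms(2)[OF that]] by simp
  qed
  with assms(2) show ?thesis unfolding Ck_on.simps by (blast intro: differentiableI)
qed

lemma Ck_on_Suc_has_derivative:
  assumes "Ck_on (Suc k) S f" "x \<in> S"
  shows "(f has_derivative frechet_derivative f (at x)) (at x)"
  using assms by (auto simp: frechet_derivative_works)

lemma Ck_on_SucD: "Ck_on (Suc k) S f \<Longrightarrow> Ck_on k S f"
proof (induction k arbitrary: f)
  case 0
  then show ?case
    by (auto intro!: continuous_at_imp_continuous_on differentiable_imp_continuous_within)
next
  case (Suc k)
  then show ?case by (metis Ck_on.simps(2))
qed

lemma Ck_on_mono: "j \<le> k \<Longrightarrow> Ck_on k S f \<Longrightarrow> Ck_on j S f"
  by (induction rule: inc_induct) (auto dest: Ck_on_SucD simp del: Ck_on.simps)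

lemma Ck_on_subset: "Ck_on k S f \<Longrightarrow> T \<subseteq> S \<Longrightarrow> Ck_on k T f"
  by (induction k arbitrary: f) (auto intro: continuous_on_subset)

lemma Ck_on_local:
  assumes "\<And>x. x \<in> S \<Longrightarrow> \<exists>T. open T \<and> x \<in> T \<and> Ck_on k T f"
  shows "Ck_on k S f"
  using assms
proof (induction k arbitrary: f)
  case 0
  then show ?case
    by (metis Ck_on.simps(1) continuous_at_imp_continuous_on continuous_on_eq_continuous_at)
next
  case (Suc k)
  have "Ck_on k S (\<lambda>x. frechet_derivative f (at x) v)" for v
    by (rule Suc.IH) (metis Suc.prems Ck_on.simps(2))
  then show ?case
    using Suc.prems by (metis Ck_on.simps(2))
qed

lemma Ck_on_const: "open S \<Longrightarrow> Ck_on k S (\<lambda>x. c)"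
proof (induction k arbitrary: c)
  case (Suc k)
  show ?case by (rule Ck_on_SucI[where D = "\<lambda>x v. 0"]) (use Suc in auto)
qed auto

lemma Ck_on_bounded_linear:
  assumes "open S" "bounded_linear L" shows "Ck_on k S L"
proof (cases k)
  case 0
  then show ?thesis using assms by (simp add: linear_continuous_on)
next
  case (Suc m)
  show ?thesis unfolding Suc
    by (rule Ck_on_SucI[where D = "\<lambda>x. L"])
      (use assms in \<open>auto intro: bounded_linear_imp_has_derivative Ck_on_const\<close>)
qed

lemma Ck_on_compose_linear:
  assumes "open S" "bounded_linear L" "Ck_on k S f"
  shows "Ck_on k S (\<lambda>x. L (f x))"
  using assms(3)
proof (induction k arbitrary: f)
  case 0
  then show ?case using assms(2) by (auto intro: bounded_linear.continuous_on)
next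
  case (Suc k)
  show ?case
    by (rule Ck_on_SucI[where D = "\<lambda>x v. L (frechet_derivative f (at x) v)"])
      (use assms Suc in \<open>auto intro!: bounded_linear.has_derivative[OF assms(2)]
        simp: frechet_derivative_works\<close>)
qed

lemma Ck_on_add:
  assumes "open S" "Ck_on k S f" "Ck_on k S g"
  shows "Ck_on k S (\<lambda>x. f x + g x)"
  using assms(2,3)
proof (induction k arbitrary: f g)
  case 0
  then show ?case by (auto intro: continuous_on_add)
next
  case (Suc k)
  show ?case
    by (rule Ck_on_SucI[where
          D = "\<lambda>x v. frechet_derivative f (at x) v + frechet_derivative g (at x) v"])
      (use assms Suc in \<open>auto intro!: has_derivative_add simp: frechet_derivative_works\<close>)
qed

lemma Ck_on_mult:
  fixes f g :: "'e::euclidean_space \<Rightarrow> real"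
  assumes "open S" "Ck_on k S f" "Ck_on k S g"
  shows "Ck_on k S (\<lambda>x. f x * g x)"
  using assms(2,3)
proof (induction k arbitrary: f g)
  case 0
  then show ?case by (auto intro: continuous_on_mult)
next
  case (Suc k)
  show ?case
  proof (rule Ck_on_SucI[where
          D = "\<lambda>x v. f x * frechet_derivative g (at x) v + frechet_derivative f (at x) v * g x"])
    show "((\<lambda>x. f x * g x) has_derivative
        (\<lambda>v. f x * frechet_derivative g (at x) v + frechet_derivative f (at x) v * g x)) (at x)"
      if "x \<in> S" for x
      using Suc.prems that by (auto intro!: has_derivative_mult simp: frechet_derivative_works)
    show "Ck_on k S (\<lambda>x. f x * frechet_derivative g (at x) v + frechet_derivative f (at x) v * g x)"
      for v
      using Suc.prems Ck_on_SucD[OF Suc.prems(1)] Ck_on_SucD[OF Suc.prems(2)]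
      by (auto intro!: Ck_on_add[OF assms(1)] Suc.IH)
  qed (fact assms(1))
qed

lemma Ck_on_sum:
  assumes "open S" "\<And>i. i \<in> I \<Longrightarrow> Ck_on k S (f i)"
  shows "Ck_on k S (\<lambda>x. \<Sum>i\<in>I. f i x)"
  using assms(2)
  by (induction I rule: infinite_finite_induct) (auto intro: Ck_on_const Ck_on_add assms(1))

text \<open>In the chain rule an operator depending on the point is applied to a vector depending on
  the point. Expanding that vector in the basis leaves a finite sum of products of scalar functions;
  one factor is a component of a derivative of \<open>f\<close>, the other a partial derivative of
  \<open>h\<close> composed with \<open>f\<close>, to which the induction hypothesis
  applies.\<close>

lemma Ck_on_compose:
  fixes h :: "'f::euclidean_space \<Rightarrow> real" and f :: "'e::euclidean_space \<Rightarrow> 'f"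
  assumes "open S" "open T" "f ` S \<subseteq> T" "Ck_on k T h" "Ck_on k S f"
  shows "Ck_on k S (\<lambda>x. h (f x))"
  using assms(4,5)
proof (induction k arbitrary: h)
  case 0
  then have "continuous_on T h" "continuous_on S f" by simp_all
  then have "continuous_on S (\<lambda>x. h (f x))" using assms(3) by (rule continuous_on_compose2)
  then show ?case by simp
next
  case (Suc k)
  let ?D = "\<lambda>x v. \<Sum>b\<in>Basis. (frechet_derivative f (at x) v \<bullet> b) * frechet_derivative h (at (f x)) b"
  show ?case
  proof (rule Ck_on_SucI[where D = ?D])
    fix x assume x: "x \<in> S"
    have lin: "linear (frechet_derivative h (at (f x)))"
      using Suc.prems(1) x assms(3) by (intro linear_frechet_derivative) auto
    have "((\<lambda>x. h (f x)) has_derivative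
        (\<lambda>v. frechet_derivative h (at (f x)) (frechet_derivative f (at x) v))) (at x)"
      by (rule has_derivative_compose[OF Ck_on_Suc_has_derivative[OF Suc.prems(2) x]
            Ck_on_Suc_has_derivative[OF Suc.prems(1)]])
        (use x assms(3) in auto)
    also have "(\<lambda>v. frechet_derivative h (at (f x)) (frechet_derivative f (at x) v)) = ?D x"
    proof
      fix v
      let ?w = "frechet_derivative f (at x) v"
      have "frechet_derivative h (at (f x)) ?w
          = frechet_derivative h (at (f x)) (\<Sum>b\<in>Basis. (?w \<bullet> b) *\<^sub>R b)"
        by (simp add: euclidean_representation)
      also have "\<dots> = ?D x v"
        by (simp only: linear_sum[OF lin] linear_cmul[OF lin] real_scaleR_def)
      finally show "frechet_derivative h (at (f x)) ?w = ?D x v" .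
    qed
    finally show "((\<lambda>x. h (f x)) has_derivative ?D x) (at x)" .
  next
    fix v
    have "Ck_on k S (\<lambda>x. frechet_derivative f (at x) v \<bullet> b)" for b
      using Suc.prems(2)
      by (intro Ck_on_compose_linear[OF assms(1) bounded_linear_inner_left]) auto
    moreover have "Ck_on k S (\<lambda>x. frechet_derivative h (at (f x)) b)" for b
      using Suc.prems Ck_on_SucD[OF Suc.prems(2)]
      by (intro Suc.IH[of "\<lambda>y. frechet_derivative h (at y) b"]) auto
    ultimately show "Ck_on k S (\<lambda>x. ?D x v)"
      by (intro Ck_on_sum Ck_on_mult assms(1))
  qed (fact assms(1))
qed

lemma smooth_on_cong:
  "open S \<Longrightarrow> (\<And>x. x \<in> S \<Longrightarrow> f x = g x) \<Longrightarrow> smooth_on S f \<Longrightarrow> smooth_on S g"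
  unfolding smooth_on_def by (intro allI, rule Ck_on_cong[of S f g]) auto

lemma smooth_on_subset: "smooth_on S f \<Longrightarrow> T \<subseteq> S \<Longrightarrow> smooth_on T f"
  unfolding smooth_on_def by (simp add: Ck_on_subset[of _ S])

lemma smooth_on_local:
  "(\<And>x. x \<in> S \<Longrightarrow> \<exists>T. open T \<and> x \<in> T \<and> smooth_on T f) \<Longrightarrow> smooth_on S f"
  unfolding smooth_on_def by (intro allI Ck_on_local) blast

lemma smooth_on_const: "open S \<Longrightarrow> smooth_on S (\<lambda>x. c)"
  unfolding smooth_on_def by (simp add: Ck_on_const)

lemma smooth_on_linear: "open S \<Longrightarrow> bounded_linear L \<Longrightarrow> smooth_on S L"
  unfolding smooth_on_def by (simp add: Ck_on_bounded_linear)

lemma smooth_on_add: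
  "open S \<Longrightarrow> smooth_on S f \<Longrightarrow> smooth_on S g \<Longrightarrow> smooth_on S (\<lambda>x. f x + g x)"
  unfolding smooth_on_def by (simp add: Ck_on_add)

lemma smooth_on_mult:
  fixes f g :: "'e::euclidean_space \<Rightarrow> real"
  shows "open S \<Longrightarrow> smooth_on S f \<Longrightarrow> smooth_on S g \<Longrightarrow> smooth_on S (\<lambda>x. f x * g x)"
  unfolding smooth_on_def by (simp add: Ck_on_mult)

lemma smooth_on_sum:
  "open S \<Longrightarrow> (\<And>i. i \<in> I \<Longrightarrow> smooth_on S (f i)) \<Longrightarrow> smooth_on S (\<lambda>x. \<Sum>i\<in>I. f i x)"
  unfolding smooth_on_def by (simp add: Ck_on_sum)

lemma smooth_on_compose:
  fixes h :: "'f::euclidean_space \<Rightarrow> real" and f :: "'e::euclidean_space \<Rightarrow> 'f"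
  shows "open S \<Longrightarrow> open T \<Longrightarrow> f ` S \<subseteq> T \<Longrightarrow> smooth_on T h \<Longrightarrow> smooth_on S f
    \<Longrightarrow> smooth_on S (\<lambda>x. h (f x))"
  unfolding smooth_on_def by (simp add: Ck_on_compose[of S T])

lemma smooth_on_has_derivative:
  assumes "smooth_on S f" "x \<in> S"
  shows "(f has_derivative frechet_derivative f (at x)) (at x)"
  using Ck_on_Suc_has_derivative[of 0] assms unfolding smooth_on_def by blast

lemma smooth_on_frechet_derivative:
  assumes "smooth_on S f" shows "smooth_on S (\<lambda>x. frechet_derivative f (at x) v)"
  unfolding smooth_on_def
proof
  fix k
  have "Ck_on (Suc k) S f" using assms by (simp only: smooth_on_def)
  then show "Ck_on k S (\<lambda>x. frechet_derivative f (at x) v)" by simp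
qed

lemma smooth_on_imp_continuous_on:
  assumes "smooth_on S f" shows "continuous_on S f"
proof -
  have "Ck_on 0 S f" using assms by (simp only: smooth_on_def)
  then show ?thesis by simp
qed

section \<open>Bump functions\<close>

definition flat :: "nat \<Rightarrow> real \<Rightarrow> real" where
  "flat m t = (if t > 0 then inverse t ^ m * exp (- inverse t) else 0)"

text \<open>The substitution of 1/t for t turns the right-hand limit into the decay of a power
  against the exponential.\<close>

lemma flat_tendsto_0: "(flat m \<longlongrightarrow> 0) (at 0)"
proof -
  have "((\<lambda>t::real. inverse t ^ m / exp (inverse t)) \<longlongrightarrow> 0) (at_right 0)"
    by (rule filterlim_compose[OF tendsto_power_div_exp_0 filterlim_inverse_at_top_right])
  moreover have "\<forall>\<^sub>F t in at_right 0. inverse t ^ m / exp (inverse t) = flat m t"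
    unfolding eventually_at_right_field flat_def
    by (intro exI[of _ 1]) (auto simp: exp_minus field_simps)
  ultimately have "(flat m \<longlongrightarrow> 0) (at_right 0)"
    by (rule Lim_transform_eventually)
  moreover have "\<forall>\<^sub>F t in at_left 0. 0 = flat m t"
    unfolding eventually_at_left_field flat_def by (intro exI[of _ "-1"]) auto
  then have "(flat m \<longlongrightarrow> 0) (at_left 0)"
    by (rule Lim_transform_eventually[OF tendsto_const])
  ultimately show ?thesis by (simp add: filterlim_split_at)
qed

text \<open>The powers of 1/t are part of \<open>flat\<close> for this reason: they make the family
  closed under differentiation, so smoothness of all members follows by one induction with
  \<open>m\<close> arbitrary.\<close>

lemma flat_has_derivative:
  "(flat m has_real_derivative (flat (m + 2) t - real m * flat (m + 1) t)) (at t)"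
proof -
  consider "t > 0" | "t < 0" | "t = 0" by linarith
  then show ?thesis
  proof cases
    case 1
    have p: "((\<lambda>t. inverse t ^ m) has_real_derivative - real m * inverse t ^ (m + 1)) (at t)"
    proof (rule DERIV_cong)
      show "((\<lambda>t. inverse t ^ m) has_real_derivative
          real m * (- (inverse t * inverse t) * inverse t ^ (m - Suc 0))) (at t)"
        using 1 by (intro DERIV_power DERIV_inverse_fun[of "\<lambda>t. t" 1, simplified]) auto
      show "real m * (- (inverse t * inverse t) * inverse t ^ (m - Suc 0))
          = - real m * inverse t ^ (m + 1)"
        by (cases m) (auto simp: algebra_simps)
    qed
    have e: "((\<lambda>t. exp (- inverse t)) has_real_derivative
        exp (- inverse t) * (inverse t * inverse t)) (at t)"
      using 1 by (auto intro!: derivative_eq_intros)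
    have "((\<lambda>t. inverse t ^ m * exp (- inverse t)) has_real_derivative
        (flat (m + 2) t - real m * flat (m + 1) t)) (at t)"
      by (rule DERIV_cong[OF DERIV_mult[OF p e]])
        (use 1 in \<open>simp add: flat_def algebra_simps\<close>)
    then show ?thesis
      by (rule has_field_derivative_transform_within_open[of _ _ _ "{0<..}"])
        (use 1 in \<open>auto simp: flat_def\<close>)
  next
    case 2
    have "((\<lambda>t. 0) has_real_derivative (flat (m + 2) t - real m * flat (m + 1) t)) (at t)"
      using 2 by (simp add: flat_def)
    then show ?thesis
      by (rule has_field_derivative_transform_within_open[of _ _ _ "{..<0}"])
        (use 2 in \<open>auto simp: flat_def\<close>)
  next
    \<comment> \<open>At 0 the difference quotient of one member of the family is the next member,
      whose limit is already known.\<close>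
    case 3
    have "\<forall>\<^sub>F h in at 0. flat (m + 1) h = (flat m (0 + h) - flat m 0) / h"
      unfolding eventually_at by (intro exI[of _ 1]) (auto simp: flat_def divide_inverse)
    then have "(\<lambda>h. (flat m (0 + h) - flat m 0) / h) \<midarrow>0\<rightarrow> 0"
      by (rule Lim_transform_eventually[OF flat_tendsto_0])
    then show ?thesis using 3 by (simp add: DERIV_def flat_def)
  qed
qed

lemma smooth_on_flat: "smooth_on UNIV (flat m)"
proof -
  have "Ck_on k UNIV (flat m)" for k
  proof (induction k arbitrary: m)
    case 0
    then show ?case using flat_has_derivative
      by (auto intro!: continuous_at_imp_continuous_on DERIV_isCont)
  next
    case (Suc k)
    show ?case
    proof (rule Ck_on_SucI)
      show "(flat m has_derivative (\<lambda>v. (flat (m + 2) x + (- real m) * flat (m + 1) x) * v)) (at x)"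
        for x
        using flat_has_derivative[of m x] by (simp add: has_field_derivative_def)
      show "Ck_on k UNIV (\<lambda>x. (flat (m + 2) x + (- real m) * flat (m + 1) x) * v)" for v
        by (intro Ck_on_add Ck_on_mult Ck_on_const Suc open_UNIV)
    qed auto
  qed
  then show ?thesis by (simp add: smooth_on_def)
qed

text \<open>
  The inner function is at least \<open>exp (-1)\<close> once its argument is at least \<open>1\<close>, and vanishes for
  nonpositive arguments; this gives a plateau without any division by a nonconstant function.
\<close>

definition bump :: "'e::euclidean_space \<Rightarrow> real \<Rightarrow> 'e \<Rightarrow> real" where
  "bump c r x = inverse (flat 0 (exp (-1)))
     * flat 0 (exp (-1) - flat 0 (((x - c) \<bullet> (x - c)) / r\<^sup>2 - 1))"

lemma bump_eq_1:
  assumes "r > 0" "dist x c \<le> r" shows "bump c r x = 1"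
proof -
  have "(x - c) \<bullet> (x - c) \<le> r\<^sup>2"
    using assms power_mono[of "norm (x - c)" r 2] by (simp add: dist_norm power2_norm_eq_inner)
  then have "((x - c) \<bullet> (x - c)) / r\<^sup>2 \<le> 1" using assms by simp
  then show ?thesis by (simp add: bump_def flat_def)
qed

lemma bump_eq_0:
  assumes "r > 0" "dist x c \<ge> 2 * r" shows "bump c r x = 0"
proof -
  let ?t = "((x - c) \<bullet> (x - c)) / r\<^sup>2 - 1"
  have "(2 * r)\<^sup>2 \<le> (x - c) \<bullet> (x - c)"
    using assms power_mono[of "2 * r" "norm (x - c)" 2] by (simp add: dist_norm power2_norm_eq_inner)
  then have "4 * r\<^sup>2 \<le> (x - c) \<bullet> (x - c)" by (simp add: power2_eq_square)
  \<comment> \<open>Twice the radius gives 4 - 1 = 3. Any value at least 1 would do, since there the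
    inner function has reached exp(-1) and the outer argument is nonpositive.\<close>
  then have t: "?t \<ge> 3" using assms by (simp add: field_simps)
  then have "inverse ?t \<le> 1" by (intro inverse_le_1_iff[THEN iffD2]) linarith
  then have "exp (-1) \<le> flat 0 ?t" using t by (simp add: flat_def)
  then show ?thesis by (simp add: bump_def flat_def)
qed

lemma smooth_on_bump:
  fixes c :: "'e::euclidean_space"
  shows "smooth_on UNIV (bump c r)"
proof -
  have comp: "smooth_on UNIV (\<lambda>x::'e. (x - c) \<bullet> b)" for b
    using smooth_on_add[OF open_UNIV smooth_on_linear[OF open_UNIV bounded_linear_inner_left]
        smooth_on_const[OF open_UNIV], of b "- (c \<bullet> b)"]
    by (simp add: inner_diff_left)
  have "smooth_on UNIV (\<lambda>x::'e. \<Sum>b\<in>Basis. ((x - c) \<bullet> b) * ((x - c) \<bullet> b))"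
    by (intro smooth_on_sum smooth_on_mult comp open_UNIV)
  then have sq: "smooth_on UNIV (\<lambda>x::'e. (x - c) \<bullet> (x - c))"
    by (subst euclidean_inner) simp
  have "smooth_on UNIV (\<lambda>x::'e. inverse (r\<^sup>2) * ((x - c) \<bullet> (x - c)) + (- 1))"
    by (intro smooth_on_mult smooth_on_add smooth_on_const sq open_UNIV)
  then have "smooth_on UNIV (\<lambda>x::'e. flat 0 (inverse (r\<^sup>2) * ((x - c) \<bullet> (x - c)) + (- 1)))"
    by (intro smooth_on_compose[OF open_UNIV open_UNIV _ smooth_on_flat]) auto
  then have "smooth_on UNIV
      (\<lambda>x::'e. exp (-1) + (-1) * flat 0 (inverse (r\<^sup>2) * ((x - c) \<bullet> (x - c)) + (- 1)))"
    by (intro smooth_on_mult smooth_on_add smooth_on_const open_UNIV)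
  then have "smooth_on UNIV (\<lambda>x::'e. flat 0
      (exp (-1) + (-1) * flat 0 (inverse (r\<^sup>2) * ((x - c) \<bullet> (x - c)) + (- 1))))"
    by (intro smooth_on_compose[OF open_UNIV open_UNIV _ smooth_on_flat]) auto
  from smooth_on_mult[OF open_UNIV smooth_on_const[OF open_UNIV] this] show ?thesis
    by (simp add: bump_def[abs_def] divide_inverse mult.commute)
qed

section \<open>Integrals along segments and Hadamard's lemma\<close>

lemma segment_in_ball:
  fixes y :: "'e::euclidean_space"
  assumes "x \<in> ball y d" "t \<in> {0..1::real}" shows "y + t *\<^sub>R (x - y) \<in> ball y d"
proof -
  have "\<bar>t\<bar> * norm (x - y) \<le> 1 * norm (x - y)"
    using assms by (intro mult_right_mono) auto
  then show ?thesis using assms by (simp add: dist_norm norm_minus_commute)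
qed

lemma continuous_on_segment_param:
  fixes G :: "'e::euclidean_space \<Rightarrow> real"
  assumes "continuous_on (ball y d) G"
  shows "continuous_on (ball y d \<times> cbox 0 1) (\<lambda>(x, t). t ^ m * G (y + t *\<^sub>R (x - y)))"
proof -
  have "continuous_on (ball y d \<times> cbox 0 1) (\<lambda>z. G (y + snd z *\<^sub>R (fst z - y)))"
    using segment_in_ball[of _ y d]
    by (intro continuous_on_compose2[OF assms]) (auto intro!: continuous_intros)
  then show ?thesis by (auto simp: split_beta intro!: continuous_intros)
qed

lemma segment_integrable:
  fixes G :: "'e::euclidean_space \<Rightarrow> real"
  assumes "continuous_on (ball y d) G" "x \<in> ball y d"
  shows "(\<lambda>t. t ^ m * G (y + t *\<^sub>R (x - y))) integrable_on cbox 0 (1::real)"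
proof (rule integrable_continuous)
  have "continuous_on (cbox 0 1) (\<lambda>t. (\<lambda>(x, t). t ^ m * G (y + t *\<^sub>R (x - y))) (x, t))"
    by (rule continuous_on_compose2[OF continuous_on_segment_param[OF assms(1)]])
      (use assms(2) in \<open>auto intro!: continuous_intros\<close>)
  then show "continuous_on (cbox 0 1) (\<lambda>t. t ^ m * G (y + t *\<^sub>R (x - y)))" by simp
qed

text \<open>The weight \<open>t ^ m\<close> makes the class of these integrals closed under differentiation.\<close>

lemma Ck_on_segment_integral:
  fixes G :: "'e::euclidean_space \<Rightarrow> real"
  assumes "Ck_on k (ball y d) G"
  shows "Ck_on k (ball y d) (\<lambda>x. integral (cbox 0 1) (\<lambda>t. t ^ m * G (y + t *\<^sub>R (x - y))))"
  using assms
proof (induction k arbitrary: m G)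
  case 0
  then show ?case
    using integral_continuous_on_param[OF continuous_on_segment_param] by simp
next
  case (Suc k)
  let ?B = "ball y d"
  let ?D = "\<lambda>x v. frechet_derivative G (at x) v"
  \<comment> \<open>The Leibniz rule wants the derivative as a jointly continuous family of bounded
    operators; its continuity is checked vector by vector. The additional factor t is the inner
    derivative of the segment in \<open>x\<close>.\<close>
  let ?E = "\<lambda>x t. Blinfun (\<lambda>v. t ^ Suc m * ?D (y + t *\<^sub>R (x - y)) v)"
  have bl: "bounded_linear (\<lambda>v. t ^ Suc m * ?D (y + t *\<^sub>R (x - y)) v)"
    if "x \<in> ?B" "t \<in> cbox 0 1" for x t
    using Ck_on_Suc_has_derivative[OF Suc.prems segment_in_ball[of x y d t]] that
    by (intro bounded_linear_intros) (auto dest: has_derivative_bounded_linear)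
  have E: "blinfun_apply (?E x t) v = t ^ Suc m * ?D (y + t *\<^sub>R (x - y)) v"
    if "x \<in> ?B" "t \<in> cbox 0 1" for x t v
    using bounded_linear_Blinfun_apply[OF bl[OF that]] by simp
  have cD: "continuous_on ?B (\<lambda>x. ?D x v)" for v
    using Ck_on_mono[OF _ Suc.prems, of "Suc 0"] by simp
  have cG: "continuous_on ?B G"
    using Ck_on_mono[OF _ Suc.prems, of 0] by simp
  have cE: "continuous_on (?B \<times> cbox 0 1) (\<lambda>(x, t). ?E x t)"
  proof (rule continuous_on_blinfun_componentwise)
    fix i :: 'e
    have "continuous_on (?B \<times> cbox 0 1) (\<lambda>(x, t). t ^ Suc m * ?D (y + t *\<^sub>R (x - y)) i)"
      by (rule continuous_on_segment_param[OF cD])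
    then show "continuous_on (?B \<times> cbox 0 1) (\<lambda>z. blinfun_apply (case z of (x, t) \<Rightarrow> ?E x t) i)"
      by (rule continuous_on_eq) (auto simp: E simp del: power_Suc)
  qed
  show ?case
  proof (rule Ck_on_SucI)
    fix x assume x: "x \<in> ?B"
    have "((\<lambda>x. integral (cbox 0 1) (\<lambda>t. t ^ m * G (y + t *\<^sub>R (x - y)))) has_derivative
        integral (cbox 0 1) (?E x)) (at x within ?B)"
    proof (rule leibniz_rule[OF _ _ cE x])
      fix x and t :: real assume xt: "x \<in> ?B" "t \<in> cbox 0 1"
      have s: "((\<lambda>x. y + t *\<^sub>R (x - y)) has_derivative (\<lambda>v. t *\<^sub>R v)) (at x within ?B)"
        by (auto intro!: derivative_eq_intros)
      have Dy: "(G has_derivative ?D (y + t *\<^sub>R (x - y))) (at (y + t *\<^sub>R (x - y)))"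
        using Ck_on_Suc_has_derivative[OF Suc.prems segment_in_ball] xt by auto
      have "((\<lambda>x. t ^ m * G (y + t *\<^sub>R (x - y))) has_derivative
          (\<lambda>v. t ^ m * ?D (y + t *\<^sub>R (x - y)) (t *\<^sub>R v))) (at x within ?B)"
        by (intro has_derivative_mult_right has_derivative_compose[OF s Dy])
      moreover have "(\<lambda>v. t ^ m * ?D (y + t *\<^sub>R (x - y)) (t *\<^sub>R v)) = blinfun_apply (?E x t)"
        by (rule ext, unfold E[OF xt]) (simp add: linear_cmul[OF has_derivative_linear[OF Dy]])
      ultimately show "((\<lambda>x. t ^ m * G (y + t *\<^sub>R (x - y))) has_derivative
          blinfun_apply (?E x t)) (at x within ?B)" by simp
    next
      show "(\<lambda>t. t ^ m * G (y + t *\<^sub>R (x - y))) integrable_on cbox 0 1" if "x \<in> ?B" for x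
        by (rule segment_integrable[OF cG that])
    qed auto
    then have "((\<lambda>x. integral (cbox 0 1) (\<lambda>t. t ^ m * G (y + t *\<^sub>R (x - y)))) has_derivative
        integral (cbox 0 1) (?E x)) (at x)"
      using x at_within_open[of x ?B] by simp
    moreover have "blinfun_apply (integral (cbox 0 1) (?E x)) v
        = integral (cbox 0 1) (\<lambda>t. t ^ Suc m * ?D (y + t *\<^sub>R (x - y)) v)" for v
    proof -
      have "continuous_on (cbox 0 1) (\<lambda>t. (\<lambda>(x, t). ?E x t) (x, t))"
        by (rule continuous_on_compose2[OF cE]) (use x in \<open>auto intro!: continuous_intros\<close>)
      then have int: "?E x integrable_on cbox 0 1"
        by (intro integrable_continuous) simp
      have "blinfun_apply (integral (cbox 0 1) (?E x)) v
          = integral (cbox 0 1) (\<lambda>t. blinfun_apply (?E x t) v)"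
        using integral_linear[OF int blinfun.bounded_linear_left, of v]
        by (simp add: o_def)
      also have "\<dots> = integral (cbox 0 1) (\<lambda>t. t ^ Suc m * ?D (y + t *\<^sub>R (x - y)) v)"
        by (rule integral_cong) (rule E[OF x])
      finally show ?thesis .
    qed
    ultimately show "((\<lambda>x. integral (cbox 0 1) (\<lambda>t. t ^ m * G (y + t *\<^sub>R (x - y)))) has_derivative
        (\<lambda>v. integral (cbox 0 1) (\<lambda>t. t ^ Suc m * ?D (y + t *\<^sub>R (x - y)) v))) (at x)"
      by (metis (no_types, lifting) ext)
  next
    show "Ck_on k ?B (\<lambda>x. integral (cbox 0 1) (\<lambda>t. t ^ Suc m * ?D (y + t *\<^sub>R (x - y)) v))" for v
      using Suc.prems by (intro Suc.IH) auto
  qed auto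
qed

text \<open>Integrate the derivative of G along the segment from \<open>y\<close> to
  \<open>x\<close>: \<open>H i\<close> is the mean of the i-th partial derivative over the segment,
  and its smoothness is differentiation under the integral.\<close>

lemma hadamard:
  fixes G :: "'e::euclidean_space \<Rightarrow> real"
  assumes G: "smooth_on (ball y d) G" and d: "d > 0"
  obtains H where "\<And>i. smooth_on (ball y d) (H i)"
    and "\<And>i. H i y = frechet_derivative G (at y) i"
    and "\<And>x. x \<in> ball y d \<Longrightarrow> G x = G y + (\<Sum>i\<in>Basis. H i x * ((x - y) \<bullet> i))"
proof
  let ?D = "\<lambda>x v. frechet_derivative G (at x) v"
  let ?H = "\<lambda>i x. integral (cbox 0 1) (\<lambda>t. t ^ 0 * ?D (y + t *\<^sub>R (x - y)) i)"
  show "smooth_on (ball y d) (?H i)" for i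
    using smooth_on_frechet_derivative[OF G] Ck_on_segment_integral
    unfolding smooth_on_def by blast
  show "?H i y = ?D y i" for i by simp
  fix x assume x: "x \<in> ball y d"
  have Dt: "(G has_derivative ?D (y + t *\<^sub>R (x - y))) (at (y + t *\<^sub>R (x - y)))"
    if "t \<in> {0..1}" for t
    using smooth_on_has_derivative[OF G segment_in_ball[OF x that]] .
  have "((\<lambda>t. ?D (y + t *\<^sub>R (x - y)) (x - y)) has_integral
      (G (y + 1 *\<^sub>R (x - y)) - G (y + 0 *\<^sub>R (x - y)))) {0..1}"
  proof (rule fundamental_theorem_of_calculus)
    fix t :: real assume t: "t \<in> {0..1}"
    have "((\<lambda>t. y + t *\<^sub>R (x - y)) has_derivative (\<lambda>s. s *\<^sub>R (x - y))) (at t within {0..1})"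
      by (auto intro!: derivative_eq_intros)
    from has_derivative_compose[OF this Dt[OF t]]
    show "((\<lambda>t. G (y + t *\<^sub>R (x - y))) has_vector_derivative ?D (y + t *\<^sub>R (x - y)) (x - y))
        (at t within {0..1})"
      using linear_cmul[OF has_derivative_linear[OF Dt[OF t]]]
      by (simp add: has_vector_derivative_def)
  qed simp
  then have "G x - G y = integral {0..1} (\<lambda>t. ?D (y + t *\<^sub>R (x - y)) (x - y))"
    by (simp add: integral_unique)
  also have "\<dots> = integral {0..1} (\<lambda>t. \<Sum>i\<in>Basis. ?D (y + t *\<^sub>R (x - y)) i * ((x - y) \<bullet> i))"
  proof (rule integral_cong)
    fix t :: real assume t: "t \<in> {0..1}"
    note lin = has_derivative_linear[OF Dt[OF t]]
    have "?D (y + t *\<^sub>R (x - y)) (x - y)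
        = ?D (y + t *\<^sub>R (x - y)) (\<Sum>i\<in>Basis. ((x - y) \<bullet> i) *\<^sub>R i)"
      by (simp add: euclidean_representation)
    then show "?D (y + t *\<^sub>R (x - y)) (x - y)
        = (\<Sum>i\<in>Basis. ?D (y + t *\<^sub>R (x - y)) i * ((x - y) \<bullet> i))"
      by (simp add: linear_sum[OF lin] linear_cmul[OF lin] mult.commute)
  qed
  also have "\<dots> = (\<Sum>i\<in>Basis. integral {0..1} (\<lambda>t. ?D (y + t *\<^sub>R (x - y)) i * ((x - y) \<bullet> i)))"
  proof (rule integral_sum)
    fix i :: 'e
    have "(\<lambda>t. t ^ 0 * ?D (y + t *\<^sub>R (x - y)) i) integrable_on cbox 0 1"
      by (intro segment_integrable[OF smooth_on_imp_continuous_on[OF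
              smooth_on_frechet_derivative[OF G]] x])
    then show "(\<lambda>t. ?D (y + t *\<^sub>R (x - y)) i * ((x - y) \<bullet> i)) integrable_on {0..1}"
      by (intro integrable_on_mult_left) simp
  qed simp
  finally show "G x = G y + (\<Sum>i\<in>Basis. ?H i x * ((x - y) \<bullet> i))"
    by simp
qed

section \<open>Smooth functions, tangent vectors and local frames\<close>

lemma sum_fun_apply: "(\<Sum>i\<in>I. f i) x = (\<Sum>i\<in>I. f i x)"
  by (induction I rule: infinite_finite_induct) auto

lemma frechet_derivative_eqI: "(f has_derivative D) (at x) \<Longrightarrow> frechet_derivative f (at x) = D"
  using frechet_derivative_at by metis

locale manifold =
  fixes A :: "('a::{t2_space, second_countable_topology}, 'e::euclidean_space) chart set"
  assumes mfd: "smooth_manifold A"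
begin

lemma chart:
  assumes "(U, \<phi>) \<in> A"
  shows "open U" "open (\<phi> ` U)" "homeomorphism U (\<phi> ` U) \<phi> (inv_into U \<phi>)"
  using mfd assms unfolding smooth_manifold_def by auto

lemma chart_inv: "(U, \<phi>) \<in> A \<Longrightarrow> q \<in> U \<Longrightarrow> inv_into U \<phi> (\<phi> q) = q"
  using chart(3) unfolding homeomorphism_def by blast

lemma chart_inv_in: "y \<in> \<phi> ` U \<Longrightarrow> inv_into U \<phi> y \<in> U" "y \<in> \<phi> ` U \<Longrightarrow> \<phi> (inv_into U \<phi> y) = y"
  by (auto simp: inv_into_into f_inv_into_f)

lemma chart_at: obtains U \<phi> where "(U, \<phi>) \<in> A" "p \<in> U"
proof -
  have "(\<Union>(U, \<phi>)\<in>A. U) = UNIV" using mfd by (simp only: smooth_manifold_def)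
  then have "p \<in> (\<Union>(U, \<phi>)\<in>A. U)" by simp
  then show ?thesis using that by auto
qed

lemma open_chart_image:
  assumes "(U, \<phi>) \<in> A" "open W" "W \<subseteq> U" shows "open (\<phi> ` W)"
proof -
  have "openin (top_of_set (\<phi> ` U)) (\<phi> ` W)"
    using homeomorphism_imp_open_map[OF chart(3)[OF assms(1)], of W] assms(2,3)
    by (simp add: open_subset)
  then show ?thesis using chart(2)[OF assms(1)] openin_open_eq by blast
qed

lemma open_chart_vimage:
  assumes "(U, \<phi>) \<in> A" "open S" shows "open {q \<in> U. \<phi> q \<in> S}"
proof -
  have "continuous_on U \<phi>" using chart(3)[OF assms(1)] by (simp add: homeomorphism_def)
  from continuous_open_preimage[OF this chart(1)[OF assms(1)] assms(2)]
  show ?thesis by (simp add: vimage_def Int_def)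
qed

lemma smooth_fun_chart: "smooth_fun A f \<Longrightarrow> (U, \<phi>) \<in> A \<Longrightarrow> smooth_on (\<phi> ` U) (\<lambda>y. f (inv_into U \<phi> y))"
  unfolding smooth_fun_def by (auto simp: o_def)

lemma smooth_funI:
  "(\<And>U \<phi>. (U, \<phi>) \<in> A \<Longrightarrow> smooth_on (\<phi> ` U) (\<lambda>y. f (inv_into U \<phi> y))) \<Longrightarrow> smooth_fun A f"
  unfolding smooth_fun_def by (auto simp: o_def)

lemma smooth_fun_const [simp]: "smooth_fun A (\<lambda>q. c)"
  by (intro smooth_funI smooth_on_const chart(2))

lemma smooth_fun_add [simp]:
  "smooth_fun A f \<Longrightarrow> smooth_fun A h \<Longrightarrow> smooth_fun A (\<lambda>q. f q + h q)"
  by (rule smooth_funI) (intro smooth_on_add smooth_fun_chart chart(2))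

lemma smooth_fun_mult [simp]:
  "smooth_fun A f \<Longrightarrow> smooth_fun A h \<Longrightarrow> smooth_fun A (\<lambda>q. f q * h q)"
  by (rule smooth_funI) (intro smooth_on_mult smooth_fun_chart chart(2))

lemma smooth_fun_uminus [simp]: "smooth_fun A f \<Longrightarrow> smooth_fun A (\<lambda>q. - f q)"
  using smooth_fun_mult[OF smooth_fun_const, of f "-1"] by simp

lemma smooth_fun_diff [simp]:
  "smooth_fun A f \<Longrightarrow> smooth_fun A h \<Longrightarrow> smooth_fun A (\<lambda>q. f q - h q)"
  using smooth_fun_add[of f "\<lambda>q. - h q"] by simp

lemma smooth_fun_sum [simp]:
  "(\<And>i. i \<in> I \<Longrightarrow> smooth_fun A (f i)) \<Longrightarrow> smooth_fun A (\<lambda>q. \<Sum>i\<in>I. f i q)"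
  by (induction I rule: infinite_finite_induct) auto

text \<open>Closedness of the image of \<open>K\<close>, hence smoothness outside it, is where \<open>T\<^sub>2\<close> is used.\<close>

lemma smooth_fun_extend:
  assumes U: "(U, \<phi>) \<in> A" and S: "open S" "S \<subseteq> \<phi> ` U" "smooth_on S h"
    and K: "compact K" "K \<subseteq> S" "\<And>x. x \<in> S - K \<Longrightarrow> h x = 0"
  shows "smooth_fun A (\<lambda>q. if q \<in> U \<and> \<phi> q \<in> S then h (\<phi> q) else 0)" (is "smooth_fun A ?F")
proof (intro smooth_funI smooth_on_local)
  fix V \<psi> y assume V: "(V, \<psi>) \<in> A" and y: "y \<in> \<psi> ` V"
  let ?q = "inv_into V \<psi> y"
  let ?W = "{q \<in> U. \<phi> q \<in> S}"
  have q: "?q \<in> V" "\<psi> ?q = y" using chart_inv_in[OF y] by auto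
  show "\<exists>T. open T \<and> y \<in> T \<and> smooth_on T (\<lambda>y. ?F (inv_into V \<psi> y))"
  proof (cases "?q \<in> ?W")
    case True
    let ?T = "\<psi> ` (V \<inter> ?W)"
    have oT: "open ?T"
      using open_chart_image[OF V] open_chart_vimage[OF U S(1)] chart(1)[OF V] by blast
    have "smooth_on (\<psi> ` (V \<inter> U)) (\<phi> \<circ> inv_into V \<psi>)"
      using mfd U V unfolding smooth_manifold_def by fast
    then have "smooth_on (\<psi> ` (V \<inter> U)) (\<lambda>y. \<phi> (inv_into V \<psi> y))" by (simp only: o_def)
    then have "smooth_on ?T (\<lambda>y. \<phi> (inv_into V \<psi> y))"
      by (rule smooth_on_subset) auto
    then have "smooth_on ?T (\<lambda>y. h (\<phi> (inv_into V \<psi> y)))"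
      by (intro smooth_on_compose[OF oT S(1) _ S(3)]) (auto simp: chart_inv[OF V])
    then have "smooth_on ?T (\<lambda>y. ?F (inv_into V \<psi> y))"
      by (rule smooth_on_cong[OF oT, rotated]) (auto simp: chart_inv[OF V])
    moreover have "y \<in> ?T" using True q by (intro image_eqI[of _ _ ?q]) auto
    ultimately show ?thesis using oT by blast
  next
    case False
    let ?K = "inv_into U \<phi> ` K"
    let ?T = "\<psi> ` (V - ?K)"
    have "continuous_on K (inv_into U \<phi>)"
      using chart(3)[OF U] S(2) K(2) unfolding homeomorphism_def
      by (meson continuous_on_subset order_trans)
    then have "closed ?K" using K(1) compact_continuous_image compact_imp_closed by blast
    then have oT: "open ?T"
      using open_chart_image[OF V, of "V - ?K"] chart(1)[OF V] by (simp add: open_Diff)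
    have zero: "?F q' = 0" if "q' \<notin> ?K" for q'
      using that K(3)[of "\<phi> q'"] chart_inv[OF U, of q'] by (auto simp: image_iff) metis
    then have "0 = ?F (inv_into V \<psi> z)" if "z \<in> ?T" for z
    proof -
      from that obtain q' where "q' \<in> V" "q' \<notin> ?K" "z = \<psi> q'" by blast
      then show ?thesis using zero[of q'] by (auto simp: chart_inv[OF V] split: if_splits)
    qed
    then have "smooth_on ?T (\<lambda>y. ?F (inv_into V \<psi> y))"
      by (rule smooth_on_cong[OF oT _ smooth_on_const[OF oT]])
    moreover have "?q \<notin> ?K"
    proof
      assume "?q \<in> ?K"
      then obtain k where k: "k \<in> K" "?q = inv_into U \<phi> k" by blast
      then have "k \<in> \<phi> ` U" using S(2) K(2) by auto
      then have "?q \<in> U" "\<phi> ?q = k" unfolding k(2) by (rule chart_inv_in)+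
      with False k(1) K(2) show False by auto
    qed
    then have "y \<in> ?T" using q by (intro image_eqI[of _ _ ?q]) auto
    ultimately show ?thesis using oT by blast
  qed
qed

section \<open>Tangent vectors and vector fields as derivations\<close>

abbreviation "T \<equiv> tangent_space A"
abbreviation "smooth \<equiv> smooth_fun A"

lemma T_add_fun:
  assumes "v \<in> T p" "smooth f" "smooth h" shows "v (\<lambda>q. f q + h q) = v f + v h"
  using assms(1)[unfolded tangent_space_def mem_Collect_eq, THEN conjunct1, rule_format, OF assms(2,3)] .

lemma T_cmult_fun:
  assumes "v \<in> T p" "smooth f" shows "v (\<lambda>q. c * f q) = c * v f"
  using assms(1)[unfolded tangent_space_def mem_Collect_eq, THEN conjunct2, THEN conjunct1,
      rule_format, OF assms(2)] .

lemma T_mult_fun: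
  assumes "v \<in> T p" "smooth f" "smooth h"
  shows "v (\<lambda>q. f q * h q) = f p * v h + h p * v f"
  using assms(1)[unfolded tangent_space_def mem_Collect_eq, THEN conjunct2, THEN conjunct2,
      THEN conjunct1, rule_format, OF assms(2,3)] .

lemma T_nonsmooth:
  assumes "v \<in> T p" "\<not> smooth f" shows "v f = 0"
  using assms(1)[unfolded tangent_space_def mem_Collect_eq, THEN conjunct2, THEN conjunct2,
      THEN conjunct2, rule_format, OF assms(2)] .

lemma T_I:
  assumes "\<And>f h. smooth f \<Longrightarrow> smooth h \<Longrightarrow> v (\<lambda>q. f q + h q) = v f + v h"
    and "\<And>c f. smooth f \<Longrightarrow> v (\<lambda>q. c * f q) = c * v f"
    and "\<And>f h. smooth f \<Longrightarrow> smooth h \<Longrightarrow> v (\<lambda>q. f q * h q) = f p * v h + h p * v f"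
    and "\<And>f. \<not> smooth f \<Longrightarrow> v f = 0"
  shows "v \<in> T p"
  unfolding tangent_space_def mem_Collect_eq by (intro conjI allI impI; rule assms; assumption)

lemma T_const_fun:
  assumes "v \<in> T p" shows "v (\<lambda>q. c) = 0"
proof -
  have "v (\<lambda>q. 1) = 0" using T_mult_fun[OF assms smooth_fun_const smooth_fun_const, of 1 1] by simp
  then show ?thesis using T_cmult_fun[OF assms smooth_fun_const, of c 1] by simp
qed

lemma T_uminus_fun: "v \<in> T p \<Longrightarrow> smooth f \<Longrightarrow> v (\<lambda>q. - f q) = - v f"
  using T_cmult_fun[of v p f "-1"] by simp

lemma T_diff_fun: "v \<in> T p \<Longrightarrow> smooth f \<Longrightarrow> smooth h \<Longrightarrow> v (\<lambda>q. f q - h q) = v f - v h"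
  using T_add_fun[of v p f "\<lambda>q. - h q"] by (simp add: T_uminus_fun)

lemma T_sum_fun:
  assumes v: "v \<in> T p" and "\<And>i. i \<in> I \<Longrightarrow> smooth (f i)"
  shows "v (\<lambda>q. \<Sum>i\<in>I. f i q) = (\<Sum>i\<in>I. v (f i))"
  using assms(2)
  by (induction I rule: infinite_finite_induct) (simp_all add: T_const_fun[OF v] T_add_fun[OF v])

lemma T_zero [simp]: "0 \<in> T p"
  by (rule T_I) simp_all

lemma T_add [simp]: "u \<in> T p \<Longrightarrow> v \<in> T p \<Longrightarrow> u + v \<in> T p"
  by (rule T_I)
    (simp_all add: T_add_fun[where p = p] T_cmult_fun[where p = p] T_mult_fun[where p = p]
      T_nonsmooth[where p = p] distrib_left)

lemma T_tsmult [simp]: "v \<in> T p \<Longrightarrow> tsmult c v \<in> T p"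
  by (rule T_I)
    (simp_all add: T_add_fun[where p = p] T_cmult_fun[where p = p] T_mult_fun[where p = p]
      T_nonsmooth[where p = p] tsmult_def distrib_left)

lemma T_uminus [simp]: "v \<in> T p \<Longrightarrow> - v \<in> T p"
  using T_tsmult[of v p "-1"] by (simp add: tsmult_def fun_Compl_def)

lemma T_diff [simp]: "u \<in> T p \<Longrightarrow> v \<in> T p \<Longrightarrow> u - v \<in> T p"
  using T_add[of u p "- v"] by simp

lemma T_sum [simp]: "(\<And>i. i \<in> I \<Longrightarrow> f i \<in> T p) \<Longrightarrow> (\<Sum>i\<in>I. f i) \<in> T p"
  by (induction I rule: infinite_finite_induct) auto

abbreviation "VF \<equiv> vfields A"

lemma VF_T: "X \<in> VF \<Longrightarrow> X p \<in> T p"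
  unfolding vfields_def by simp

lemma VF_smooth: "X \<in> VF \<Longrightarrow> smooth f \<Longrightarrow> smooth (\<lambda>p. X p f)"
  unfolding vfields_def by simp

lemma VF_zero [simp]: "0 \<in> VF"
  unfolding vfields_def by auto

lemma VF_add [simp]: "X \<in> VF \<Longrightarrow> Y \<in> VF \<Longrightarrow> X + Y \<in> VF"
  unfolding vfields_def by auto

lemma VF_uminus [simp]: "X \<in> VF \<Longrightarrow> - X \<in> VF"
  unfolding vfields_def by auto

lemma VF_diff [simp]: "X \<in> VF \<Longrightarrow> Y \<in> VF \<Longrightarrow> X - Y \<in> VF"
  using VF_add[of X "- Y"] by simp

lemma VF_vsmult [simp]: "smooth f \<Longrightarrow> X \<in> VF \<Longrightarrow> vsmult f X \<in> VF"
  unfolding vfields_def by (auto simp: vsmult_def) (auto simp: tsmult_def)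

lemma VF_sum [simp]: "(\<And>i. i \<in> I \<Longrightarrow> f i \<in> VF) \<Longrightarrow> (\<Sum>i\<in>I. f i) \<in> VF"
  by (induction I rule: infinite_finite_induct) auto

section \<open>Coordinate frames, tensoriality and dimension\<close>

lemma chart_derivative_props:
  assumes U: "(U, \<phi>) \<in> A" and y: "y \<in> \<phi> ` U" and f: "smooth f" and h: "smooth h"
  defines "d \<equiv> \<lambda>f::'a \<Rightarrow> real. frechet_derivative (\<lambda>y. f (inv_into U \<phi> y)) (at y)"
  shows "d (\<lambda>q. f q + h q) i = d f i + d h i"
    and "d (\<lambda>q. c * f q) i = c * d f i"
    and "d (\<lambda>q. f q * h q) i = f (inv_into U \<phi> y) * d h i + h (inv_into U \<phi> y) * d f i"
proof -
  have df: "((\<lambda>y. f (inv_into U \<phi> y)) has_derivative d f) (at y)"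
    and dh: "((\<lambda>y. h (inv_into U \<phi> y)) has_derivative d h) (at y)"
    unfolding d_def
    by (rule smooth_on_has_derivative[OF smooth_fun_chart[OF f U] y]
        smooth_on_has_derivative[OF smooth_fun_chart[OF h U] y])+
  show "d (\<lambda>q. f q + h q) i = d f i + d h i"
    using frechet_derivative_eqI[OF has_derivative_add[OF df dh]] by (simp add: d_def)
  show "d (\<lambda>q. c * f q) i = c * d f i"
    using frechet_derivative_eqI[OF has_derivative_mult_right[OF df]] by (simp add: d_def)
  show "d (\<lambda>q. f q * h q) i = f (inv_into U \<phi> y) * d h i + h (inv_into U \<phi> y) * d f i"
    using frechet_derivative_eqI[OF has_derivative_mult[OF df dh]] by (simp add: d_def)
qed

text \<open>
  The bump \<open>\<kappa>\<close> cuts the coordinate fields off, and \<open>x i\<close> are the coordinates, cut off outside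
  the support of \<open>\<kappa>\<close>. Hadamard's lemma shows that they control all derivations.
\<close>

lemma local_frame:
  obtains \<kappa> x E where "smooth \<kappa>" "\<kappa> p = 1" "\<And>i. smooth (x i)" "\<And>i. E i \<in> VF"
    and "\<And>q v. v \<in> T q \<Longrightarrow> tsmult (\<kappa> q) v = (\<Sum>i\<in>(Basis :: 'e set). tsmult (v (x i)) (E i q))"
    and "\<And>i j. i \<in> Basis \<Longrightarrow> j \<in> Basis \<Longrightarrow> E i p (x j) = (if i = j then 1 else 0)"
proof -
  obtain U \<phi> where U: "(U, \<phi>) \<in> A" and p: "p \<in> U" by (rule chart_at)
  define S where "S = \<phi> ` U"
  have S: "open S" unfolding S_def by (rule chart(2)[OF U])
  have inS: "q \<in> U \<Longrightarrow> \<phi> q \<in> S" for q by (simp add: S_def)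
  define x0 where "x0 = \<phi> p"
  obtain \<rho> where \<rho>: "\<rho> > 0" "cball x0 \<rho> \<subseteq> S"
    using open_contains_cball[of S] S p inS unfolding x0_def by blast
  \<comment> \<open>\<open>b1\<close> is 1 up to distance \<rho>/2 and \<open>c\<close> vanishes
    from \<rho>/2 on, so wherever \<open>c\<close> is nonzero the cut-off coordinates agree with the
    true ones.\<close>
  define b1 where "b1 = bump x0 (\<rho> / 2)"
  define c where "c = bump x0 (\<rho> / 4)"
  have b1: "b1 y = 1" if "y \<in> cball x0 (\<rho> / 2)" for y
    using that \<rho>(1) by (auto simp: b1_def dist_commute intro!: bump_eq_1)
  have b1_0: "b1 y = 0" if "y \<notin> cball x0 \<rho>" for y
    using that \<rho>(1) by (auto simp: b1_def dist_commute intro!: bump_eq_0)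
  have c_0: "c y = 0" if "y \<notin> ball x0 (\<rho> / 2)" for y
    using that \<rho>(1) by (auto simp: c_def dist_commute intro!: bump_eq_0)
  have c_x0: "c x0 = 1" using \<rho>(1) by (auto simp: c_def intro!: bump_eq_1)
  have sub: "ball x0 (\<rho> / 2) \<subseteq> cball x0 \<rho>" "cball x0 (\<rho> / 2) \<subseteq> cball x0 \<rho>"
    using \<rho>(1) by auto
  have smb: "smooth_on S b1" "smooth_on S c"
    unfolding b1_def c_def using smooth_on_subset[OF smooth_on_bump] by blast+
  define d where "d = (\<lambda>(f :: 'a \<Rightarrow> real) y. frechet_derivative (\<lambda>y. f (inv_into U \<phi> y)) (at y))"
  define x where "x = (\<lambda>(i::'e) q. if q \<in> U \<and> \<phi> q \<in> S then b1 (\<phi> q) * (\<phi> q \<bullet> i) else 0)"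
  define \<kappa> where "\<kappa> = (\<lambda>q. if q \<in> U \<and> \<phi> q \<in> S then c (\<phi> q) else 0)"
  \<comment> \<open>The value 0 at non-smooth functions matches the convention in
    \<open>tangent_space\<close>.\<close>
  define E where "E = (\<lambda>(i::'e) q f. if smooth f then if q \<in> U \<and> \<phi> q \<in> S
    then c (\<phi> q) * d f (\<phi> q) i else 0 else 0)"
  have x_smooth: "smooth (x i)" for i
    unfolding x_def
  proof (rule smooth_fun_extend[OF U S _ _ _ \<rho>(2)])
    show "smooth_on S (\<lambda>y. b1 y * (y \<bullet> i))"
      by (intro smooth_on_mult S smb smooth_on_linear bounded_linear_inner_left)
  qed (auto simp: S_def b1_0 intro!: b1_0)
  have chi_smooth: "smooth \<kappa>"
    unfolding \<kappa>_def
  proof (rule smooth_fun_extend[OF U S _ smb(2) _ \<rho>(2)])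
    show "c y = 0" if "y \<in> S - cball x0 \<rho>" for y using that c_0 sub by blast
  qed (auto simp: S_def)
  have E_smooth: "smooth (\<lambda>q. E i q f)" if f: "smooth f" for i f
  proof -
    have "smooth (\<lambda>q. if q \<in> U \<and> \<phi> q \<in> S then c (\<phi> q) * d f (\<phi> q) i else 0)"
    proof (rule smooth_fun_extend[OF U S _ _ _ \<rho>(2)])
      show "smooth_on S (\<lambda>y. c y * d f y i)"
        unfolding d_def
        by (intro smooth_on_mult S smb smooth_on_frechet_derivative)
          (use smooth_fun_chart[OF f U] in \<open>simp add: S_def\<close>)
      show "c y * d f y i = 0" if "y \<in> S - cball x0 \<rho>" for y
        using that c_0[of y] \<rho>(1) by auto
    qed (auto simp: S_def)
    then show ?thesis using f by (simp add: E_def)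
  qed
  have E_T: "E i q \<in> T q" for i q
  proof (cases "q \<in> U")
    case True
    note P = chart_derivative_props[OF U imageI[OF True], unfolded chart_inv[OF U True]]
    have "d (\<lambda>q. f q + h q) (\<phi> q) i = d f (\<phi> q) i + d h (\<phi> q) i"
      "d (\<lambda>q. f q * h q) (\<phi> q) i = f q * d h (\<phi> q) i + h q * d f (\<phi> q) i"
      "d (\<lambda>q. r * f q) (\<phi> q) i = r * d f (\<phi> q) i"
      if "smooth f" "smooth h" for f h r
      unfolding d_def by (rule P[OF that])+
    then show ?thesis
      by (intro T_I) (auto simp: E_def True inS[OF True] distrib_left)
  next
    case False
    then have "E i q = 0" by (auto simp: E_def fun_eq_iff)
    then show ?thesis by simp
  qed
  have main: "v f * \<kappa> q = (\<Sum>i\<in>Basis. v (x i) * E i q f)" if v: "v \<in> T q" and f: "smooth f" for v q f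
  proof (cases "q \<in> U \<and> \<phi> q \<in> ball x0 (\<rho> / 2)")
    case False
    then have "\<kappa> q = 0" "\<And>i. E i q f = 0" using c_0 by (auto simp: \<kappa>_def E_def)
    then show ?thesis by simp
  next
    case True
    then have q: "q \<in> U" "\<phi> q \<in> ball x0 (\<rho> / 2)" by auto
    define y where "y = \<phi> q"
    obtain \<delta> where \<delta>: "\<delta> > 0" "ball y \<delta> \<subseteq> ball x0 (\<rho> / 2)"
      using openE[OF open_ball q(2)] unfolding y_def by blast
    have \<delta>S: "ball y \<delta> \<subseteq> S" using \<delta>(2) sub \<rho>(2) by blast
    have "smooth_on (ball y \<delta>) (\<lambda>y. f (inv_into U \<phi> y))"
      using smooth_on_subset[OF smooth_fun_chart[OF f U]] \<delta>S by (simp add: S_def)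
    then obtain H where H: "\<And>i. smooth_on (ball y \<delta>) (H i)" "\<And>i. H i y = d f y i"
      "\<And>z. z \<in> ball y \<delta> \<Longrightarrow> f (inv_into U \<phi> z) = f (inv_into U \<phi> y)
        + (\<Sum>i\<in>Basis. H i z * ((z - y) \<bullet> i))"
      unfolding d_def using hadamard[OF _ \<delta>(1), of y "\<lambda>y. f (inv_into U \<phi> y)"] by blast
    \<comment> \<open>Derivations act on global functions, so Hadamard's expansion near
      \<open>q\<close> is multiplied by a second bump around \<open>y\<close> and extended by zero.
      At \<open>q\<close> this bump is 1 and \<open>x i q' - y \<bullet> i\<close> vanishes, so
      applying \<open>v\<close> to the identity \<open>eq\<close> produces \<open>f q * v B\<close>
      on both sides and otherwise only the derivatives of \<open>f\<close> times
      \<open>v (x i)\<close>.\<close>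
    define b2 where "b2 = bump y (\<delta> / 4)"
    have b2_y: "b2 y = 1" using \<delta>(1) by (auto simp: b2_def intro!: bump_eq_1)
    have b2_0: "b2 z = 0" if "z \<notin> cball y (\<delta> / 2)" for z
      using that \<delta>(1) by (auto simp: b2_def dist_commute intro!: bump_eq_0)
    have b2_smooth: "smooth_on (ball y \<delta>) b2"
      unfolding b2_def using smooth_on_subset[OF smooth_on_bump] by blast
    define B where "B = (\<lambda>q. if q \<in> U \<and> \<phi> q \<in> ball y \<delta> then b2 (\<phi> q) else 0)"
    define K where "K = (\<lambda>i q. if q \<in> U \<and> \<phi> q \<in> ball y \<delta> then b2 (\<phi> q) * H i (\<phi> q) else 0)"
    have K2: "cball y (\<delta> / 2) \<subseteq> ball y \<delta>" using \<delta>(1) by auto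
    have B_smooth: "smooth B"
      unfolding B_def
      by (rule smooth_fun_extend[OF U open_ball _ b2_smooth compact_cball K2])
        (use \<delta>S b2_0 in \<open>auto simp: S_def\<close>)
    have K_smooth: "smooth (K i)" for i
      unfolding K_def
      by (rule smooth_fun_extend[OF U open_ball _ _ compact_cball K2])
        (use \<delta>S b2_0 in \<open>auto simp: S_def intro!: smooth_on_mult b2_smooth H(1)\<close>)
    have eq: "B q' * f q' = f q * B q' + (\<Sum>i\<in>Basis. K i q' * (x i q' - y \<bullet> i))" for q'
    proof (cases "q' \<in> U \<and> \<phi> q' \<in> ball y \<delta>")
      case True
      then have q': "q' \<in> U" "\<phi> q' \<in> ball y \<delta>" by auto
      have "x i q' = \<phi> q' \<bullet> i" for i
        using q' inS b1[of "\<phi> q'"] \<delta>(2) by (auto simp: x_def)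
      moreover have "f q' = f q + (\<Sum>i\<in>Basis. H i (\<phi> q') * ((\<phi> q' - y) \<bullet> i))"
        using H(3)[OF q'(2)] chart_inv[OF U q'(1)] chart_inv[OF U q(1)] by (simp add: y_def)
      ultimately show ?thesis
        using True by (simp add: B_def K_def algebra_simps sum_distrib_left)
    qed (auto simp: B_def K_def)
    have Bq: "B q = 1" and Kq: "K i q = d f y i" and xq: "x i q = y \<bullet> i" for i
      using q inS b1[of "\<phi> q"] \<delta>(1) b2_y H(2)
      by (auto simp: B_def K_def x_def y_def)
    have "v (\<lambda>q'. B q' * f q') = v f + f q * v B"
      by (simp add: T_mult_fun[OF v B_smooth f] Bq)
    moreover have "v (\<lambda>q'. f q * B q' + (\<Sum>i\<in>Basis. K i q' * (x i q' - y \<bullet> i)))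
        = f q * v B + (\<Sum>i\<in>Basis. d f y i * v (x i))"
      using B_smooth K_smooth x_smooth
      by (simp add: T_add_fun[OF v] T_cmult_fun[OF v] T_sum_fun[OF v] T_mult_fun[OF v]
          T_diff_fun[OF v] T_const_fun[OF v] Kq xq)
    ultimately have "v f = (\<Sum>i\<in>Basis. d f y i * v (x i))" using eq by simp
    then show ?thesis
      using q(1) inS[OF q(1)] f
      by (simp add: E_def \<kappa>_def y_def sum_distrib_left sum_distrib_right mult.commute
          mult.left_commute)
  qed
  have E_VF: "E i \<in> VF" for i by (simp add: vfields_def E_T E_smooth)
  have frame: "tsmult (\<kappa> q) v = (\<Sum>i\<in>Basis. tsmult (v (x i)) (E i q))" if "v \<in> T q" for q v
  proof
    fix f
    show "tsmult (\<kappa> q) v f = (\<Sum>i\<in>Basis. tsmult (v (x i)) (E i q)) f"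
    proof (cases "smooth f")
      case True
      then show ?thesis using main[OF that True] by (simp add: sum_fun_apply tsmult_def mult.commute)
    next
      case False
      then show ?thesis
        using T_nonsmooth[OF that] by (simp add: sum_fun_apply tsmult_def E_def)
    qed
  qed
  have delta: "E i p (x j) = (if i = j then 1 else 0)" if "i \<in> Basis" "j \<in> Basis" for i j
  proof -
    have "((\<lambda>y. x j (inv_into U \<phi> y)) has_derivative (\<lambda>v. v \<bullet> j)) (at x0)"
    proof (rule has_derivative_transform_within_open[OF _ open_ball[of x0 "\<rho> / 2"]])
      show "((\<lambda>y. y \<bullet> j) has_derivative (\<lambda>v. v \<bullet> j)) (at x0)"
        by (rule bounded_linear_imp_has_derivative[OF bounded_linear_inner_left])
      show "y \<bullet> j = x j (inv_into U \<phi> y)" if y: "y \<in> ball x0 (\<rho> / 2)" for y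
      proof -
        have "y \<in> \<phi> ` U" using y sub \<rho>(2) unfolding S_def by blast
        from chart_inv_in[OF this] show ?thesis
          using b1[of y] y inS[of "inv_into U \<phi> y"] by (simp add: x_def)
      qed
    qed (use \<rho>(1) in simp)
    then have "d (x j) x0 i = i \<bullet> j" unfolding d_def by (simp add: frechet_derivative_eqI)
    then show ?thesis
      using x_smooth p inS[OF p] that c_x0 by (simp add: E_def x0_def inner_Basis)
  qed
  have kp: "\<kappa> p = 1" using p inS[OF p] c_x0 by (simp add: \<kappa>_def x0_def)
  show ?thesis by (rule that[OF chi_smooth kp x_smooth E_VF frame delta])
qed

text \<open>Multiplying by the cut-off \<kappa> with \<kappa>(p) = 1 does not change the value of
  \<open>F\<close>, and \<kappa> Z is globally a combination of the fields \<open>E i\<close>. Hence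
  \<open>F Z\<close> is computed from the numbers \<open>Z p (x i)\<close> alone.\<close>

lemma tensorial:
  fixes F :: "'a vfield \<Rightarrow> real"
  assumes add: "\<And>X Y. X \<in> VF \<Longrightarrow> Y \<in> VF \<Longrightarrow> F (X + Y) = F X + F Y"
    and mult: "\<And>f X. smooth f \<Longrightarrow> X \<in> VF \<Longrightarrow> F (vsmult f X) = f p * F X"
    and XY: "X \<in> VF" "Y \<in> VF" "X p = Y p"
  shows "F X = F Y"
proof -
  obtain \<kappa> x E where fr: "smooth \<kappa>" "\<kappa> p = 1" "\<And>i. smooth (x i)" "\<And>i. E i \<in> VF"
    "\<And>q v. v \<in> T q \<Longrightarrow> tsmult (\<kappa> q) v = (\<Sum>i\<in>(Basis :: 'e set). tsmult (v (x i)) (E i q))"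
    by (rule local_frame[of p]) blast
  have zero: "F 0 = 0" using add[of 0 0] by simp
  have "F Z = (\<Sum>i\<in>Basis. Z p (x i) * F (E i))" if Z: "Z \<in> VF" for Z
  proof -
    have "vsmult \<kappa> Z = (\<Sum>i\<in>Basis. vsmult (\<lambda>q. Z q (x i)) (E i))"
      using fr(5)[OF VF_T[OF Z]] by (auto simp: vsmult_def sum_fun_apply fun_eq_iff)
    moreover have "F (\<Sum>i\<in>I. vsmult (\<lambda>q. Z q (x i)) (E i)) = (\<Sum>i\<in>I. Z p (x i) * F (E i))"
      if "finite I" for I :: "'e set"
      using that
    proof (induction I rule: finite_induct)
      case (insert i I)
      have "F (\<Sum>i\<in>insert i I. vsmult (\<lambda>q. Z q (x i)) (E i))
          = F (vsmult (\<lambda>q. Z q (x i)) (E i)) + F (\<Sum>i\<in>I. vsmult (\<lambda>q. Z q (x i)) (E i))"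
        unfolding sum.insert[OF insert(1,2)] by (rule add; intro VF_sum VF_vsmult VF_smooth[OF Z fr(3)] fr(4))
      also have "F (vsmult (\<lambda>q. Z q (x i)) (E i)) = Z p (x i) * F (E i)"
        by (rule mult[OF VF_smooth[OF Z fr(3)] fr(4)])
      finally show ?case using insert by simp
    qed (simp only: sum.empty zero)
    ultimately have "F (vsmult \<kappa> Z) = (\<Sum>i\<in>Basis. Z p (x i) * F (E i))" by simp
    then show ?thesis using mult[OF fr(1) Z] fr(2) by simp
  qed
  then show ?thesis using XY by simp
qed

text \<open>Identifies \<open>T p\<close> linearly with the model space by testing on the cut-off
  coordinates. \<open>C (D y) = y\<close> expresses the independence of the frame at
  \<open>p\<close> and carries the dimension; that every \<open>D y\<close> is the value of a global
  field carries the extension of tangent vectors.\<close>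

lemma tangent_coordinates:
  obtains C :: "'a tvec \<Rightarrow> 'e" and D :: "'e \<Rightarrow> 'a tvec" where
    "\<And>u v. C (u + v) = C u + C v" "\<And>c u. C (tsmult c u) = c *\<^sub>R C u"
    "\<And>y. \<exists>X\<in>VF. X p = D y" "\<And>v. v \<in> T p \<Longrightarrow> D (C v) = v" "\<And>y. C (D y) = y"
proof -
  obtain \<kappa> x E where fr: "smooth \<kappa>" "\<kappa> p = 1" "\<And>i. smooth (x i)" "\<And>i. E i \<in> VF"
    "\<And>q v. v \<in> T q \<Longrightarrow> tsmult (\<kappa> q) v = (\<Sum>i\<in>(Basis :: 'e set). tsmult (v (x i)) (E i q))"
    "\<And>i j. i \<in> Basis \<Longrightarrow> j \<in> Basis \<Longrightarrow> E i p (x j) = (if i = j then 1 else 0)"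
    by (rule local_frame[of p]) blast
  define C where "C = (\<lambda>v::'a tvec. \<Sum>i\<in>Basis. v (x i) *\<^sub>R i)"
  define D where "D = (\<lambda>y. \<Sum>i\<in>Basis. tsmult (y \<bullet> i) (E i p))"
  have Ci: "C v \<bullet> i = v (x i)" if "i \<in> Basis" for v i
    using that by (simp add: C_def inner_sum_left inner_Basis if_distrib[of "(*) _"] cong: if_cong)
  show ?thesis
  proof
    show "C (u + v) = C u + C v" for u v
      by (simp add: C_def scaleR_left_distrib sum.distrib)
    show "C (tsmult c u) = c *\<^sub>R C u" for c u
      by (simp add: C_def tsmult_def scaleR_sum_right)
    show "\<exists>X\<in>VF. X p = D y" for y
      by (rule bexI[of _ "\<Sum>i\<in>Basis. vsmult (\<lambda>_. y \<bullet> i) (E i)"])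
        (auto simp: D_def sum_fun_apply vsmult_def intro!: VF_sum VF_vsmult[unfolded vsmult_def] fr(4))
    show "D (C v) = v" if "v \<in> T p" for v
    proof -
      have "D (C v) = (\<Sum>i\<in>Basis. tsmult (v (x i)) (E i p))" by (simp add: D_def Ci)
      also have "\<dots> = tsmult 1 v" using fr(5)[OF that] fr(2) by simp
      finally show ?thesis by (simp add: tsmult_def)
    qed
    show "C (D y) = y" for y
    proof (rule euclidean_eqI)
      fix j :: 'e assume j: "j \<in> Basis"
      then have "C (D y) \<bullet> j = (\<Sum>i\<in>Basis. (y \<bullet> i) * (if i = j then 1 else 0))"
        by (simp add: Ci D_def sum_fun_apply tsmult_def fr(6))
      also have "\<dots> = y \<bullet> j" using j by (simp add: if_distrib[of "(*) _"] cong: if_cong)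
      finally show "C (D y) \<bullet> j = y \<bullet> j" .
    qed
  qed
qed

text \<open>Supplies the existence behind the choice in the definition of
  \<open>extend\<close>.\<close>

lemma extend:
  assumes "v \<in> T p" shows "extend A p v \<in> VF" "extend A p v p = v"
proof -
  obtain C :: "'a tvec \<Rightarrow> 'e" and D :: "'e \<Rightarrow> 'a tvec" where
    "\<And>y. \<exists>X\<in>VF. X p = D y" "\<And>v. v \<in> T p \<Longrightarrow> D (C v) = v"
    by (rule tangent_coordinates[of p]) blast
  then have "\<exists>X. X \<in> VF \<and> X p = v" using assms by metis
  then have "extend A p v \<in> VF \<and> extend A p v p = v" unfolding extend_def by (rule someI_ex)
  then show "extend A p v \<in> VF" "extend A p v p = v" by auto
qed

end

section \<open>Curvature of a Riemannian manifold\<close>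

lemma tsmult_simps [simp]: "tsmult 1 v = v" "tsmult 0 v = 0" "tsmult c 0 = 0"
  by (simp_all add: tsmult_def fun_eq_iff)

lemma tsmult_apply: "tsmult c v h = c * v h"
  by (simp only: tsmult_def)

lemma vsmult_apply: "vsmult f X p = tsmult (f p) (X p)"
  by (simp only: vsmult_def)

locale riemannian = manifold A
  for A :: "('a::{t2_space, second_countable_topology}, 'e::euclidean_space) chart set" +
  fixes g :: "'a metric" and nab :: "'a connection"
  assumes metric: "riemannian_metric A g" and lc: "levi_civita A g nab"
begin

lemma g_sym: "u \<in> T p \<Longrightarrow> v \<in> T p \<Longrightarrow> g p u v = g p v u"
  using metric unfolding riemannian_metric_def by blast

lemma g_tsmult_left: "u \<in> T p \<Longrightarrow> v \<in> T p \<Longrightarrow> g p (tsmult c u) v = c * g p u v"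
  using metric unfolding riemannian_metric_def by blast

lemma g_add_left: "u \<in> T p \<Longrightarrow> v \<in> T p \<Longrightarrow> w \<in> T p \<Longrightarrow> g p (u + w) v = g p u v + g p w v"
  using metric unfolding riemannian_metric_def by blast

lemma g_pos: "u \<in> T p \<Longrightarrow> u \<noteq> 0 \<Longrightarrow> g p u u > 0"
  using metric unfolding riemannian_metric_def by blast

lemma g_smooth: "X \<in> VF \<Longrightarrow> Y \<in> VF \<Longrightarrow> smooth (\<lambda>p. g p (X p) (Y p))"
  using metric unfolding riemannian_metric_def by blast

lemma g_tsmult_right: "u \<in> T p \<Longrightarrow> v \<in> T p \<Longrightarrow> g p u (tsmult c v) = c * g p u v"
  using g_tsmult_left[of v p u c] by (simp add: g_sym)

lemma g_add_right: "u \<in> T p \<Longrightarrow> v \<in> T p \<Longrightarrow> w \<in> T p \<Longrightarrow> g p u (v + w) = g p u v + g p u w"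
  using g_add_left[of v p u w] by (simp add: g_sym)

lemma g_zero_left [simp]: "v \<in> T p \<Longrightarrow> g p 0 v = 0"
  using g_tsmult_left[of 0 p v 0] by simp

lemma g_zero_right [simp]: "v \<in> T p \<Longrightarrow> g p v 0 = 0"
  using g_tsmult_right[of v p 0 0] by simp

lemma g_uminus_left: "u \<in> T p \<Longrightarrow> v \<in> T p \<Longrightarrow> g p (- u) v = - g p u v"
  using g_add_left[of "- u" p v u] by simp

lemma g_uminus_right: "u \<in> T p \<Longrightarrow> v \<in> T p \<Longrightarrow> g p u (- v) = - g p u v"
  using g_add_right[of u p "- v" v] by simp

lemma g_diff_left: "u \<in> T p \<Longrightarrow> v \<in> T p \<Longrightarrow> w \<in> T p \<Longrightarrow> g p (u - w) v = g p u v - g p w v"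
  using g_add_left[of "u - w" p v w] by simp

lemma g_diff_right: "u \<in> T p \<Longrightarrow> v \<in> T p \<Longrightarrow> w \<in> T p \<Longrightarrow> g p u (v - w) = g p u v - g p u w"
  using g_add_right[of u p "v - w" w] by simp

lemmas g_linear = g_add_left g_add_right g_tsmult_left g_tsmult_right g_uminus_left g_uminus_right
  g_diff_left g_diff_right

lemma g_sum_left:
  "v \<in> T p \<Longrightarrow> (\<And>i. i \<in> I \<Longrightarrow> f i \<in> T p) \<Longrightarrow> g p (\<Sum>i\<in>I. f i) v = (\<Sum>i\<in>I. g p (f i) v)"
  by (induction I rule: infinite_finite_induct) (simp_all add: g_add_left)

lemma g_eq_0: "u \<in> T p \<Longrightarrow> g p u u = 0 \<Longrightarrow> u = 0"
  using g_pos by fastforce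

section \<open>The connection and the Lie bracket\<close>

lemma connection:
  assumes "X \<in> VF" "Y \<in> VF" "Z \<in> VF" "smooth f"
  shows "nab X Y \<in> VF" "nab (X + Y) Z = nab X Z + nab Y Z"
    "nab (vsmult f X) Y = vsmult f (nab X Y)" "nab X (Y + Z) = nab X Y + nab X Z"
    "nab X (vsmult f Y) = vsmult (\<lambda>p. X p f) Y + vsmult f (nab X Y)"
proof -
  have "affine_connection A nab" using lc by (simp only: levi_civita_def)
  note this[unfolded affine_connection_def, rule_format, OF assms]
  then show "nab X Y \<in> VF" "nab (X + Y) Z = nab X Z + nab Y Z"
    "nab (vsmult f X) Y = vsmult f (nab X Y)" "nab X (Y + Z) = nab X Y + nab X Z"
    "nab X (vsmult f Y) = vsmult (\<lambda>p. X p f) Y + vsmult f (nab X Y)"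
    by blast+
qed

lemma nab_VF [simp]: "X \<in> VF \<Longrightarrow> Y \<in> VF \<Longrightarrow> nab X Y \<in> VF"
  by (rule connection(1)[OF _ _ VF_zero smooth_fun_const])

lemma nab_add_left: "X \<in> VF \<Longrightarrow> Y \<in> VF \<Longrightarrow> Z \<in> VF \<Longrightarrow> nab (X + Y) Z = nab X Z + nab Y Z"
  by (rule connection(2)[OF _ _ _ smooth_fun_const])

lemma nab_add_right: "X \<in> VF \<Longrightarrow> Y \<in> VF \<Longrightarrow> Z \<in> VF \<Longrightarrow> nab X (Y + Z) = nab X Y + nab X Z"
  by (rule connection(4)[OF _ _ _ smooth_fun_const])

lemma nab_vsmult_left:
  "smooth f \<Longrightarrow> X \<in> VF \<Longrightarrow> Y \<in> VF \<Longrightarrow> nab (vsmult f X) Y = vsmult f (nab X Y)"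
  by (rule connection(3)[OF _ _ VF_zero])

lemma nab_vsmult_right:
  "smooth f \<Longrightarrow> X \<in> VF \<Longrightarrow> Y \<in> VF
    \<Longrightarrow> nab X (vsmult f Y) = vsmult (\<lambda>p. X p f) Y + vsmult f (nab X Y)"
  by (rule connection(5)[OF _ _ VF_zero])

lemma nab_diff_left:
  assumes "X \<in> VF" "Y \<in> VF" "Z \<in> VF" shows "nab (X - Y) Z = nab X Z - nab Y Z"
  using nab_add_left[of "X - Y" Y Z] assms by (simp only: VF_diff diff_add_cancel eq_diff_eq)

lemma nab_diff_right:
  assumes "X \<in> VF" "Y \<in> VF" "Z \<in> VF" shows "nab X (Y - Z) = nab X Y - nab X Z"
  using nab_add_right[of X "Y - Z" Z] assms by (simp only: VF_diff diff_add_cancel eq_diff_eq)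

lemma nab_zero_right: "X \<in> VF \<Longrightarrow> nab X 0 = 0"
  using nab_diff_right[of X 0 0] by (simp only: VF_zero diff_self)

lemma nab_uminus_left:
  assumes X: "X \<in> VF" and Z: "Z \<in> VF" shows "nab (- X) Z = - nab X Z"
proof -
  have "nab X Z + nab (- X) Z = nab 0 Z"
    using nab_add_left[OF X VF_uminus[OF X] Z] by (simp only: add.right_inverse)
  also have "\<dots> = 0" using nab_diff_left[OF VF_zero VF_zero Z] by (simp only: diff_self)
  finally show ?thesis by (rule minus_unique[symmetric])
qed

lemma torsion_free: "X \<in> VF \<Longrightarrow> Y \<in> VF \<Longrightarrow> lie_bracket X Y = nab X Y - nab Y X"
  using lc unfolding levi_civita_def by metis

lemma metric_compatible:
  "X \<in> VF \<Longrightarrow> Y \<in> VF \<Longrightarrow> Z \<in> VF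
    \<Longrightarrow> X p (\<lambda>q. g q (Y q) (Z q)) = g p (nab X Y p) (Z p) + g p (Y p) (nab X Z p)"
  using lc unfolding levi_civita_def by blast

text \<open>Torsion-freeness writes the bracket through covariant derivatives, which are already
  known to be vector fields. The linearity rules for the bracket come from the connection in the
  same way.\<close>

lemma lie_VF [simp]: "X \<in> VF \<Longrightarrow> Y \<in> VF \<Longrightarrow> lie_bracket X Y \<in> VF"
  by (simp only: torsion_free VF_diff nab_VF)

lemma lie_apply: "lie_bracket X Y p f = X p (\<lambda>q. Y q f) - Y p (\<lambda>q. X q f)"
  by (simp only: lie_bracket_def)

lemma lie_add_left:
  assumes "X \<in> VF" "X' \<in> VF" "Y \<in> VF"
  shows "lie_bracket (X + X') Y = lie_bracket X Y + lie_bracket X' Y"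
  using assms by (simp only: torsion_free VF_add nab_add_left nab_add_right) (simp only: add_diff_add)

lemma lie_vsmult_left:
  assumes "smooth f" "X \<in> VF" "Y \<in> VF"
  shows "lie_bracket (vsmult f X) Y = vsmult f (lie_bracket X Y) - vsmult (\<lambda>p. Y p f) X"
  using assms
  by (simp only: torsion_free VF_vsmult nab_vsmult_left nab_vsmult_right)
    (simp add: fun_eq_iff vsmult_apply tsmult_apply algebra_simps)

lemma jacobi:
  assumes X: "X \<in> VF" and Y: "Y \<in> VF" and Z: "Z \<in> VF"
  shows "lie_bracket X (lie_bracket Y Z) + lie_bracket Y (lie_bracket Z X)
    + lie_bracket Z (lie_bracket X Y) = 0" (is "?L = 0")
proof (intro ext)
  fix p f
  show "?L p f = 0 p f"
  proof (cases "smooth f")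
    case True
    have s: "smooth (\<lambda>q. V q (\<lambda>q. W q f))" if "V \<in> VF" "W \<in> VF" for V W
      using VF_smooth[OF that(1) VF_smooth[OF that(2) True]] .
    show ?thesis
      by (simp add: lie_apply T_diff_fun[OF VF_T[OF X]] T_diff_fun[OF VF_T[OF Y]]
          T_diff_fun[OF VF_T[OF Z]] s X Y Z)
  next
    \<comment> \<open>The left side is a vector field, and tangent vectors vanish at non-smooth
      functions by convention.\<close>
    case False
    have "?L p \<in> T p" by (intro VF_T VF_add lie_VF X Y Z)
    then have "?L p f = 0" by (rule T_nonsmooth[OF _ False])
    then show ?thesis by (simp only: zero_fun_apply)
  qed
qed

section \<open>The curvature tensor and its symmetries\<close>

abbreviation "R \<equiv> curvature nab"

lemma R_VF [simp]: "X \<in> VF \<Longrightarrow> Y \<in> VF \<Longrightarrow> Z \<in> VF \<Longrightarrow> R X Y Z \<in> VF"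
  by (simp only: curvature_def VF_diff nab_VF lie_VF)

lemma R_antisym:
  assumes "X \<in> VF" "Y \<in> VF" "Z \<in> VF" shows "R X Y Z = - R Y X Z"
proof -
  have "lie_bracket X Y = - lie_bracket Y X" by (auto simp: lie_apply fun_eq_iff)
  then have "nab (lie_bracket X Y) Z = - nab (lie_bracket Y X) Z"
    using assms by (simp only: nab_uminus_left lie_VF)
  moreover have "a - b - c = - (b - a - d)" if "c = - d" for a b c d :: "'a vfield"
    using that by simp
  ultimately show ?thesis unfolding curvature_def by blast
qed

lemma R_add_left:
  assumes "X \<in> VF" "X' \<in> VF" "Y \<in> VF" "Z \<in> VF" shows "R (X + X') Y Z = R X Y Z + R X' Y Z"
  using assms
  by (simp only: curvature_def lie_add_left nab_add_left nab_add_right nab_VF lie_VF)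
    (simp only: algebra_simps)

lemma R_vsmult_left:
  assumes f: "smooth f" and X: "X \<in> VF" and Y: "Y \<in> VF" and Z: "Z \<in> VF"
  shows "R (vsmult f X) Y Z = vsmult f (R X Y Z)"
  by (simp only: curvature_def lie_vsmult_left nab_vsmult_left nab_vsmult_right nab_diff_left nab_VF
      lie_VF VF_vsmult f X Y Z VF_smooth[OF Y f])
    (simp add: fun_eq_iff vsmult_apply tsmult_apply algebra_simps)

lemma R_add_middle:
  assumes "X \<in> VF" "Y \<in> VF" "Y' \<in> VF" "Z \<in> VF" shows "R X (Y + Y') Z = R X Y Z + R X Y' Z"
  using R_add_left[of Y Y' X Z] R_antisym[of X "Y + Y'" Z] R_antisym[of X Y Z] R_antisym[of X Y' Z] assms
  by (simp add: fun_eq_iff)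

lemma R_vsmult_middle:
  assumes "smooth f" "X \<in> VF" "Y \<in> VF" "Z \<in> VF"
  shows "R X (vsmult f Y) Z = vsmult f (R X Y Z)"
  using R_vsmult_left[of f Y X Z] R_antisym[of X "vsmult f Y" Z] R_antisym[of X Y Z] assms
  by (simp add: fun_eq_iff vsmult_apply tsmult_apply)

lemma R_add_right:
  assumes "X \<in> VF" "Y \<in> VF" "Z \<in> VF" "Z' \<in> VF" shows "R X Y (Z + Z') = R X Y Z + R X Y Z'"
  using assms by (simp only: curvature_def nab_add_right nab_VF lie_VF) (simp only: algebra_simps)

text \<open>The second derivatives X(Y f) - Y(X f) left over from the product rule cancel against
  the derivative of \<open>f\<close> along the bracket.\<close>

lemma R_vsmult_right:
  assumes f: "smooth f" and X: "X \<in> VF" and Y: "Y \<in> VF" and Z: "Z \<in> VF"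
  shows "R X Y (vsmult f Z) = vsmult f (R X Y Z)"
  by (simp only: curvature_def nab_vsmult_right nab_add_right nab_VF lie_VF VF_vsmult f X Y Z
      VF_smooth[OF X f] VF_smooth[OF Y f])
    (simp add: fun_eq_iff vsmult_apply tsmult_apply lie_apply algebra_simps)

text \<open>\<open>tensorial\<close> concerns real-valued maps of a single field, so the value is
  tested on a function and the three arguments are exchanged one at a time.\<close>

lemma R_tensorial:
  assumes X: "X \<in> VF" "X' \<in> VF" "X p = X' p" and Y: "Y \<in> VF" "Y' \<in> VF" "Y p = Y' p"
    and Z: "Z \<in> VF" "Z' \<in> VF" "Z p = Z' p"
  shows "R X Y Z p = R X' Y' Z' p"
proof
  fix f
  have "R X Y Z p f = R X' Y Z p f"
    by (rule tensorial[where F = "\<lambda>X. R X Y Z p f" and p = p])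
      (simp_all add: R_add_left R_vsmult_left X Y Z vsmult_apply tsmult_apply)
  also have "\<dots> = R X' Y' Z p f"
    by (rule tensorial[where F = "\<lambda>Y. R X' Y Z p f" and p = p])
      (simp_all add: R_add_middle R_vsmult_middle X Y Z vsmult_apply tsmult_apply)
  also have "\<dots> = R X' Y' Z' p f"
    by (rule tensorial[where F = "\<lambda>Z. R X' Y' Z p f" and p = p])
      (simp_all add: R_add_right R_vsmult_right X Y Z vsmult_apply tsmult_apply)
  finally show "R X Y Z p f = R X' Y' Z' p f" .
qed

text \<open>Without torsion the cyclic sum regroups into the iterated brackets of the Jacobi
  identity.\<close>

lemma bianchi:
  assumes X: "X \<in> VF" and Y: "Y \<in> VF" and Z: "Z \<in> VF"
  shows "R X Y Z + R Y Z X + R Z X Y = 0"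
proof -
  have "R X Y Z + R Y Z X + R Z X Y
      = (nab X (lie_bracket Y Z) - nab (lie_bracket Y Z) X)
      + (nab Y (lie_bracket Z X) - nab (lie_bracket Z X) Y)
      + (nab Z (lie_bracket X Y) - nab (lie_bracket X Y) Z)"
    by (simp only: curvature_def torsion_free X Y Z nab_diff_right nab_VF) (simp only: algebra_simps)
  also have "\<dots> = 0"
    using jacobi[OF X Y Z]
    unfolding torsion_free[OF X lie_VF[OF Y Z]] torsion_free[OF Y lie_VF[OF Z X]]
      torsion_free[OF Z lie_VF[OF X Y]] .
  finally show ?thesis .
qed

text \<open>The operator ZW - WZ - [Z,W] annihilates the function g(Y,X). Expanding it by metric
  compatibility, the terms with one derivative on each factor cancel and the two curvature terms
  remain.\<close>

lemma R_skew:
  assumes X: "X \<in> VF" and Y: "Y \<in> VF" and Z: "Z \<in> VF" and W: "W \<in> VF"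
  shows "g p (R Z W Y p) (X p) = - g p (Y p) (R Z W X p)"
proof -
  let ?G = "\<lambda>q. g q (Y q) (X q)"
  note T = VF_T[OF X] VF_T[OF Y] VF_T[OF nab_VF] X Y Z W
  have 2: "V p (\<lambda>q. U q ?G) = g p (nab V (nab U Y) p) (X p) + g p (nab U Y p) (nab V X p)
      + g p (nab V Y p) (nab U X p) + g p (Y p) (nab V (nab U X) p)"
    if UV: "U \<in> VF" "V \<in> VF" for U V
  proof -
    have "V p (\<lambda>q. U q ?G)
        = V p (\<lambda>q. g q (nab U Y q) (X q) + g q (Y q) (nab U X q))"
      by (simp only: metric_compatible UV X Y)
    also have "\<dots> = V p (\<lambda>q. g q (nab U Y q) (X q)) + V p (\<lambda>q. g q (Y q) (nab U X q))"
      by (rule T_add_fun[OF VF_T[OF UV(2)]]) (simp_all only: g_smooth nab_VF UV X Y)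
    finally show ?thesis by (simp only: metric_compatible UV X Y nab_VF add.assoc)
  qed
  have "lie_bracket Z W p ?G
      = g p (nab (lie_bracket Z W) Y p) (X p) + g p (Y p) (nab (lie_bracket Z W) X p)"
    by (simp only: metric_compatible X Y Z W lie_VF)
  moreover have "lie_bracket Z W p ?G = Z p (\<lambda>q. W q ?G) - W p (\<lambda>q. Z q ?G)"
    by (simp only: lie_apply)
  moreover have "g p (R Z W Y p) (X p) = g p (nab Z (nab W Y) p) (X p)
      - g p (nab W (nab Z Y) p) (X p) - g p (nab (lie_bracket Z W) Y p) (X p)"
    by (simp add: curvature_def g_diff_left T)
  moreover have "g p (Y p) (R Z W X p) = g p (Y p) (nab Z (nab W X) p)
      - g p (Y p) (nab W (nab Z X) p) - g p (Y p) (nab (lie_bracket Z W) X p)"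
    by (simp add: curvature_def g_diff_right T)
  ultimately show ?thesis using 2[OF W Z] 2[OF Z W] by linarith
qed

abbreviation "Rm \<equiv> riem A g nab"

text \<open>Frees \<open>Rm\<close> from the fields chosen by \<open>extend\<close>: it may be
  computed with any fields that have the right values at \<open>p\<close>.\<close>

lemma Rm_eq:
  assumes "Y \<in> VF" "Z \<in> VF" "W \<in> VF"
  shows "Rm p x (Y p) (Z p) (W p) = g p (R Z W Y p) x"
proof -
  have "R (extend A p (Z p)) (extend A p (W p)) (extend A p (Y p)) p = R Z W Y p"
    by (rule R_tensorial) (simp_all add: extend VF_T assms)
  then show ?thesis by (simp only: riem_def)
qed

lemma field_at: "v \<in> T p \<Longrightarrow> \<exists>X. X \<in> VF \<and> X p = v"
  using extend by blast

lemma Rm_add1: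
  assumes "x \<in> T p" "x' \<in> T p" "y \<in> T p" "z \<in> T p" "w \<in> T p"
  shows "Rm p (x + x') y z w = Rm p x y z w + Rm p x' y z w"
  using assms by (simp add: riem_def g_add_right VF_T extend)

lemma Rm_tsmult1:
  assumes "x \<in> T p" "y \<in> T p" "z \<in> T p" "w \<in> T p"
  shows "Rm p (tsmult c x) y z w = c * Rm p x y z w"
  using assms by (simp add: riem_def g_tsmult_right VF_T extend)

lemma Rm_antisym12:
  assumes "x \<in> T p" "y \<in> T p" "z \<in> T p" "w \<in> T p"
  shows "Rm p x y z w = - Rm p y x z w"
proof -
  obtain X Y Z W where V: "X \<in> VF" "Y \<in> VF" "Z \<in> VF" "W \<in> VF" "X p = x" "Y p = y" "Z p = z" "W p = w"
    using field_at assms by metis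
  have "g p (R Z W Y p) (X p) = - g p (Y p) (R Z W X p)" using V by (intro R_skew)
  then show ?thesis
    using Rm_eq[OF V(2-4), of p x] Rm_eq[OF V(1,3,4), of p y] V assms
      g_sym[OF assms(2) VF_T[OF R_VF[OF V(3,4,1)]]] by simp
qed

lemma Rm_antisym34:
  assumes "x \<in> T p" "y \<in> T p" "z \<in> T p" "w \<in> T p"
  shows "Rm p x y z w = - Rm p x y w z"
proof -
  obtain X Y Z W where V: "X \<in> VF" "Y \<in> VF" "Z \<in> VF" "W \<in> VF" "X p = x" "Y p = y" "Z p = z" "W p = w"
    using field_at assms by metis
  then show ?thesis
    using Rm_eq[OF V(2-4), of p x] Rm_eq[OF V(2,4,3), of p x] R_antisym[OF V(3,4,2)]
      VF_T[OF R_VF[OF V(4,3,2)], of p] VF_T[OF V(1), of p]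
    by (simp add: g_uminus_right g_uminus_left)
qed

lemma Rm_bianchi:
  assumes "x \<in> T p" "y \<in> T p" "z \<in> T p" "w \<in> T p"
  shows "Rm p x y z w + Rm p x z w y + Rm p x w y z = 0"
proof -
  obtain X Y Z W where V: "X \<in> VF" "Y \<in> VF" "Z \<in> VF" "W \<in> VF" "X p = x" "Y p = y" "Z p = z" "W p = w"
    using field_at assms by metis
  have "g p ((R Z W Y + R W Y Z + R Y Z W) p) x = 0"
    using assms by (simp only: bianchi V zero_fun_apply g_zero_left)
  then show ?thesis
    using Rm_eq[OF V(2-4), of p x] Rm_eq[OF V(3,4,2), of p x] Rm_eq[OF V(4,2,3), of p x]
    by (simp add: V assms g_add_left VF_T[OF R_VF])
qed

text \<open>The classical argument: add the first Bianchi identity for the four cyclic arrangements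
  of the arguments and cancel by the two antisymmetries.\<close>

lemma Rm_pair:
  assumes "x \<in> T p" "y \<in> T p" "z \<in> T p" "w \<in> T p"
  shows "Rm p x y z w = Rm p z w x y"
  using Rm_bianchi[OF assms] Rm_bianchi[OF assms(2,3,4,1)] Rm_bianchi[OF assms(3,4,1,2)]
    Rm_bianchi[OF assms(4,1,2,3)] Rm_antisym34[OF assms(1,3,4,2)] Rm_antisym34[OF assms(2,3,4,1)]
    Rm_antisym12[OF assms(2,1,3,4)] Rm_antisym12[OF assms(3,1,2,4)] Rm_antisym12[OF assms(3,2,4,1)]
    Rm_antisym12[OF assms(4,1,2,3)] Rm_antisym12[OF assms(4,2,3,1)] Rm_antisym34[OF assms(2,4,3,1)]
    Rm_antisym12[OF assms(4,3,1,2)]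
  by linarith

section \<open>Orthonormal bases and the Ricci tensor\<close>

lemma exists_orthogonal:
  assumes F: "finite F" "F \<subseteq> T p" "card F < DIM('e)"
  shows "\<exists>u\<in>T p. g p u u = 1 \<and> (\<forall>v\<in>F. g p u v = 0)"
proof -
  obtain C :: "'a tvec \<Rightarrow> 'e" and D :: "'e \<Rightarrow> 'a tvec" where
    C: "\<And>u v. C (u + v) = C u + C v" "\<And>c u. C (tsmult c u) = c *\<^sub>R C u"
    and D: "\<And>y. \<exists>X\<in>VF. X p = D y" "\<And>v. v \<in> T p \<Longrightarrow> D (C v) = v" "\<And>y. C (D y) = y"
    by (rule tangent_coordinates[of p]) blast
  have DT: "D y \<in> T p" for y using D(1)[of y] VF_T by metis
  have D_add: "D (y + z) = D y + D z" for y z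
    using D(2)[of "D y + D z"] DT by (simp add: C D(3))
  have D_scale: "D (c *\<^sub>R y) = tsmult c (D y)" for c y
    using D(2)[of "tsmult c (D y)"] DT by (simp add: C D(3))
  \<comment> \<open>\<open>F\<close> is embedded into the basis so that the map y to (g(y,v)) for v
    in F becomes an endomorphism \<open>h\<close> of the model space. It misses a basis direction,
    so it is not surjective, hence not injective, and a kernel vector is orthogonal to
    \<open>F\<close>.\<close>
  obtain j where j: "inj_on j F" "j ` F \<subseteq> (Basis :: 'e set)"
    using card_le_inj[of F "Basis :: 'e set"] F by auto
  have "card (j ` F) < card (Basis :: 'e set)" using F j by (simp add: card_image)
  then obtain b where b: "b \<in> Basis" "b \<notin> j ` F"
    using j(2) by (metis less_irrefl subset_antisym subsetI)
  define h where "h = (\<lambda>y. \<Sum>v\<in>F. g p (D y) v *\<^sub>R j v)"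
  have lin: "linear h"
  proof (rule linearI)
    show "h (y + z) = h y + h z" for y z
      unfolding h_def sum.distrib[symmetric]
      by (rule sum.cong) (use F DT in \<open>auto simp: D_add g_add_left scaleR_left_distrib subset_iff\<close>)
    show "h (c *\<^sub>R y) = c *\<^sub>R h y" for c y
      unfolding h_def scaleR_sum_right
      by (rule sum.cong) (use F DT in \<open>auto simp: D_scale g_tsmult_left subset_iff\<close>)
  qed
  have hb: "h y \<bullet> b = 0" for y
    unfolding h_def inner_sum_left
  proof (intro sum.neutral ballI)
    fix v assume "v \<in> F"
    then have "j v \<in> Basis" "j v \<noteq> b" using j b by auto
    then show "g p (D y) v *\<^sub>R j v \<bullet> b = 0" using b by (simp add: inner_Basis)
  qed
  have "b \<noteq> h y" for y using hb[of y] inner_same_Basis[OF b(1)] by auto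
  then have "\<not> surj h" by blast
  then have "\<not> inj h" using lin linear_injective_imp_surjective by blast
  then obtain y where y: "y \<noteq> 0" "h y = 0"
    using linear_injective_0[OF lin] by blast
  have orth: "g p (D y) v = 0" if "v \<in> F" for v
  proof -
    have "0 = h y \<bullet> j v" using y by simp
    also have "\<dots> = (\<Sum>v'\<in>F. g p (D y) v' * (if v' = v then 1 else 0))"
      unfolding h_def inner_sum_left
    proof (rule sum.cong)
      fix v' assume v': "v' \<in> F"
      then have "j v' \<in> Basis" "j v \<in> Basis" "j v' = j v \<longleftrightarrow> v' = v"
        using j that by (auto simp: inj_on_eq_iff)
      then show "g p (D y) v' *\<^sub>R j v' \<bullet> j v = g p (D y) v' * (if v' = v then 1 else 0)"
        by (simp add: inner_Basis)
    qed simp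
    also have "\<dots> = g p (D y) v" using that F(1) by (simp add: if_distrib[of "(*) _"] cong: if_cong)
    finally show ?thesis by simp
  qed
  have "D y \<noteq> 0"
  proof
    assume "D y = 0"
    then have "y = C 0" using D(3)[of y] by simp
    also have "\<dots> = 0" using C(2)[of 0 0] by simp
    finally show False using y by simp
  qed
  then have pos: "g p (D y) (D y) > 0" by (rule g_pos[OF DT])
  let ?u = "tsmult (1 / sqrt (g p (D y) (D y))) (D y)"
  have "g p ?u ?u = 1" using pos DT by (simp add: g_linear field_simps flip: power2_eq_square)
  moreover have "g p ?u v = 0" if "v \<in> F" for v
    using orth[OF that] that F DT by (simp add: g_linear subset_iff)
  ultimately show ?thesis using DT by (intro bexI[of _ ?u]) auto
qed

abbreviation "orthonormal \<equiv> orthonormal_basis A g"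

lemma orthonormal_basis_exists: "\<exists>E. orthonormal p E"
proof -
  have "\<exists>E. (\<forall>i<k. E i \<in> T p) \<and> (\<forall>i<k. \<forall>j<k. g p (E i) (E j) = (if i = j then 1 else 0))"
    if "k \<le> DIM('e)" for k
    using that
  proof (induction k)
    case (Suc k)
    then obtain E where E: "\<And>i. i < k \<Longrightarrow> E i \<in> T p"
      "\<And>i j. i < k \<Longrightarrow> j < k \<Longrightarrow> g p (E i) (E j) = (if i = j then 1 else 0)"
      by auto
    have "card (E ` {..<k}) < DIM('e)"
      using card_image_le[of "{..<k}" E] Suc.prems by simp
    then obtain u where u: "u \<in> T p" "g p u u = 1" "\<And>i. i < k \<Longrightarrow> g p u (E i) = 0"
      using exists_orthogonal[of "E ` {..<k}" p] E(1) by auto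
    then have "g p (E i) u = 0" if "i < k" for i using that E(1) by (simp add: g_sym)
    then show ?case using E u by (intro exI[of _ "E(k := u)"]) (auto simp: less_Suc_eq)
  qed auto
  from this[of "DIM('e)"] show ?thesis unfolding orthonormal_basis_def by auto
qed

text \<open>Orthonormality makes the synthesis map \<open>S\<close> injective. In coordinates it is
  an endomorphism of the model space, hence surjective, so the orthonormal family spans.\<close>

lemma orthonormal_expansion:
  assumes E: "orthonormal p E" and u: "u \<in> T p"
  shows "u = (\<Sum>i<DIM('e). tsmult (g p u (E i)) (E i))"
proof -
  have E_T: "i < DIM('e) \<Longrightarrow> E i \<in> T p"
    and E_orth: "i < DIM('e) \<Longrightarrow> j < DIM('e) \<Longrightarrow> g p (E i) (E j) = (if i = j then 1 else 0)" for i j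
    using E unfolding orthonormal_basis_def by blast+
  let ?I = "{..<DIM('e)}"
  obtain C :: "'a tvec \<Rightarrow> 'e" and D :: "'e \<Rightarrow> 'a tvec" where
    C: "\<And>u v. C (u + v) = C u + C v" "\<And>c u. C (tsmult c u) = c *\<^sub>R C u"
    and D: "\<And>v. v \<in> T p \<Longrightarrow> D (C v) = v"
    by (rule tangent_coordinates[of p]) blast
  obtain b where b: "bij_betw b ?I (Basis :: 'e set)"
    using ex_bij_betw_nat_finite[of "Basis :: 'e set"] by (auto simp: atLeast0LessThan)
  define S where "S = (\<lambda>y. \<Sum>i\<in>?I. tsmult (y \<bullet> b i) (E i))"
  have ST: "S y \<in> T p" for y unfolding S_def by (intro T_sum T_tsmult) (simp add: E_T)
  have coef0: "g p (S y) (E j) = y \<bullet> b j" if "j < DIM('e)" for y j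
  proof -
    have "g p (S y) (E j) = (\<Sum>i\<in>?I. (y \<bullet> b i) * (if i = j then 1 else 0))"
      unfolding S_def using that by (subst g_sum_left) (auto simp: g_linear E_orth E_T)
    then show ?thesis using that by (simp add: if_distrib[of "(*) _"] cong: if_cong)
  qed
  have lin: "linear (\<lambda>y. C (S y))"
  proof (rule linearI)
    have "S (y + z) = S y + S z" for y z
      by (auto simp: S_def sum_fun_apply tsmult_apply fun_eq_iff inner_add_left distrib_right
          sum.distrib)
    then show "C (S (y + z)) = C (S y) + C (S z)" for y z by (simp add: C)
    have "S (c *\<^sub>R y) = tsmult c (S y)" for c y
      by (auto simp: S_def sum_fun_apply tsmult_apply fun_eq_iff sum_distrib_left mult.assoc)
    then show "C (S (c *\<^sub>R y)) = c *\<^sub>R C (S y)" for c y by (simp add: C)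
  qed
  have "y = 0" if "C (S y) = 0" for y
  proof -
    have "C 0 = 0" using C(2)[of 0 0] by simp
    then have "S y = 0" using D[OF ST[of y]] D[of 0] that by simp
    then have yb: "y \<bullet> b i = 0" if "i < DIM('e)" for i using coef0[OF that, of y] E_T[OF that] by simp
    show "y = 0"
    proof (rule euclidean_eqI)
      fix c :: 'e assume "c \<in> Basis"
      then obtain i where "i < DIM('e)" "c = b i" using b unfolding bij_betw_def by fastforce
      then show "y \<bullet> c = 0 \<bullet> c" using yb by simp
    qed
  qed
  then have "inj (\<lambda>y. C (S y))" using linear_injective_0[OF lin] by blast
  then have "surj (\<lambda>y. C (S y))" using lin linear_injective_imp_surjective by blast
  then have "\<exists>y. C u = C (S y)" by (rule surjD)
  then obtain y where "C u = C (S y)" ..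
  then have "D (C u) = D (C (S y))" by (rule arg_cong)
  then have uS: "u = S y" by (simp only: D[OF u] D[OF ST])
  then have "u = (\<Sum>i\<in>?I. tsmult (y \<bullet> b i) (E i))" by (simp only: S_def)
  also have "\<dots> = (\<Sum>i\<in>?I. tsmult (g p u (E i)) (E i))"
    by (rule sum.cong) (simp_all add: coef0[of _ y, folded uS])
  finally show ?thesis .
qed

text \<open>The same choice term as in the definition of \<open>ricci\<close>, so that
  \<open>ric_eq\<close> holds by unfolding.\<close>

definition frame :: "'a \<Rightarrow> nat \<Rightarrow> 'a tvec" where
  "frame p = (SOME E. orthonormal p E)"

lemma orthonormal_frame: "orthonormal p (frame p)"
  unfolding frame_def using orthonormal_basis_exists by (rule someI_ex)

lemma frame_T [simp]: "i < DIM('e) \<Longrightarrow> frame p i \<in> T p"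
  using orthonormal_frame unfolding orthonormal_basis_def by blast

lemma frame_orthonormal:
  "i < DIM('e) \<Longrightarrow> j < DIM('e) \<Longrightarrow> g p (frame p i) (frame p j) = (if i = j then 1 else 0)"
  using orthonormal_frame unfolding orthonormal_basis_def by blast

lemma parseval:
  assumes u: "u \<in> T p" and v: "v \<in> T p"
  shows "(\<Sum>i<DIM('e). g p u (frame p i) * g p v (frame p i)) = g p u v"
proof -
  have "g p u v = g p (\<Sum>i<DIM('e). tsmult (g p u (frame p i)) (frame p i)) v"
    using orthonormal_expansion[OF orthonormal_frame u] by metis
  also have "\<dots> = (\<Sum>i<DIM('e). g p u (frame p i) * g p v (frame p i))"
    using v by (subst g_sum_left) (auto simp: g_linear g_sym intro!: sum.cong)
  finally show ?thesis by simp
qed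

abbreviation "ric \<equiv> ricci A g nab"

lemma ric_eq: "ric p y w = (\<Sum>i<DIM('e). Rm p (frame p i) y (frame p i) w)"
  by (simp only: ricci_def frame_def Let_def)

lemma ric_sym:
  assumes "y \<in> T p" "w \<in> T p" shows "ric p y w = ric p w y"
  unfolding ric_eq by (rule sum.cong) (use assms in \<open>auto intro!: Rm_pair\<close>)

lemma Rm_add2:
  assumes "x \<in> T p" "y \<in> T p" "y' \<in> T p" "z \<in> T p" "w \<in> T p"
  shows "Rm p x (y + y') z w = Rm p x y z w + Rm p x y' z w"
  using assms Rm_antisym12[of x p "y + y'" z w] Rm_antisym12[of x p y z w]
    Rm_antisym12[of x p y' z w] by (simp add: Rm_add1)

lemma Rm_tsmult2:
  assumes "x \<in> T p" "y \<in> T p" "z \<in> T p" "w \<in> T p"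
  shows "Rm p x (tsmult c y) z w = c * Rm p x y z w"
  using assms Rm_antisym12[of x p "tsmult c y" z w] Rm_antisym12[of x p y z w]
  by (simp add: Rm_tsmult1)

lemma ric_add_left:
  assumes "y \<in> T p" "y' \<in> T p" "w \<in> T p" shows "ric p (y + y') w = ric p y w + ric p y' w"
  unfolding ric_eq sum.distrib[symmetric] by (rule sum.cong) (use assms in \<open>auto simp: Rm_add2\<close>)

lemma ric_tsmult_left:
  assumes "y \<in> T p" "w \<in> T p" shows "ric p (tsmult c y) w = c * ric p y w"
  unfolding ric_eq sum_distrib_left by (rule sum.cong) (use assms in \<open>auto simp: Rm_tsmult2\<close>)

end

section \<open>Geometry of the class of Kenmotsu type\<close>

locale kenmotsu = riemannian A g nab
  for A :: "('a::{t2_space, second_countable_topology}, 'e::euclidean_space) chart set"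
    and g :: "'a metric" and nab :: "'a connection" +
  fixes n :: nat and \<Phi> :: "'a vfield \<Rightarrow> 'a vfield" and \<xi> :: "'a vfield"
  assumes acr: "acr_manifold A n \<Phi> \<xi> g" and ken: "kenmotsu_type A \<Phi> \<xi> g nab"
begin

abbreviation "\<eta> \<equiv> eta g \<xi>"

lemma DIM_eq: "DIM('e) = 2 * n + 1"
  using acr unfolding acr_manifold_def by blast

lemma xi_VF [simp]: "\<xi> \<in> VF"
  using acr unfolding acr_manifold_def by blast

lemma Phi_VF [simp]: "X \<in> VF \<Longrightarrow> \<Phi> X \<in> VF"
  using acr unfolding acr_manifold_def by blast

lemma Phi_add: "X \<in> VF \<Longrightarrow> Y \<in> VF \<Longrightarrow> \<Phi> (X + Y) = \<Phi> X + \<Phi> Y"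
  using acr unfolding acr_manifold_def by blast

lemma Phi_vsmult: "smooth f \<Longrightarrow> X \<in> VF \<Longrightarrow> \<Phi> (vsmult f X) = vsmult f (\<Phi> X)"
  using acr unfolding acr_manifold_def by blast

lemma Phi_xi: "\<Phi> \<xi> = 0"
  using acr unfolding acr_manifold_def by blast

lemma xi_T [simp]: "\<xi> p \<in> T p"
  by (rule VF_T[OF xi_VF])

lemma g_xi_xi [simp]: "g p (\<xi> p) (\<xi> p) = 1"
  using acr unfolding acr_manifold_def eta_def by blast

lemma eta_Phi: "X \<in> VF \<Longrightarrow> \<eta> p (\<Phi> X p) = 0"
  using acr unfolding acr_manifold_def by blast

lemma Phi_Phi: "X \<in> VF \<Longrightarrow> \<Phi> (\<Phi> X) = - X + vsmult (\<lambda>p. \<eta> p (X p)) \<xi>"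
  using acr unfolding acr_manifold_def by blast

lemma g_Phi_Phi:
  "X \<in> VF \<Longrightarrow> Y \<in> VF
    \<Longrightarrow> g p (\<Phi> X p) (\<Phi> Y p) = g p (X p) (Y p) - \<eta> p (X p) * \<eta> p (Y p)"
  using acr unfolding acr_manifold_def by blast

lemma kenmotsu_eq:
  "X \<in> VF \<Longrightarrow> Y \<in> VF \<Longrightarrow>
    (nab X (\<Phi> Y) - \<Phi> (nab X Y)) - (nab (\<Phi> X) (\<Phi> (\<Phi> Y)) - \<Phi> (nab (\<Phi> X) (\<Phi> Y)))
      = - vsmult (\<lambda>p. \<eta> p (Y p)) (\<Phi> X)"
  using ken unfolding kenmotsu_type_def cov_deriv_endo_def by blast

lemma eta_tsmult: "u \<in> T p \<Longrightarrow> \<eta> p (tsmult c u) = c * \<eta> p u"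
  by (simp add: eta_def g_linear)

lemma eta_uminus: "u \<in> T p \<Longrightarrow> \<eta> p (- u) = - \<eta> p u"
  by (simp add: eta_def g_linear)

lemma eta_diff: "u \<in> T p \<Longrightarrow> v \<in> T p \<Longrightarrow> \<eta> p (u - v) = \<eta> p u - \<eta> p v"
  by (simp add: eta_def g_linear)

lemma eta_xi [simp]: "\<eta> p (\<xi> p) = 1"
  by (simp add: eta_def)

section \<open>The endomorphism on a single tangent space\<close>

abbreviation "J \<equiv> Phi_at A \<Phi>"

text \<open>By tensoriality of \<Phi> the choice in \<open>Phi_at\<close> does not matter, so the
  identities for \<Phi> on fields pass to \<open>J\<close> on vectors.\<close>

lemma J_field:
  assumes "X \<in> VF" shows "J p (X p) = \<Phi> X p"
proof
  fix f
  have "\<Phi> (extend A p (X p)) p f = \<Phi> X p f"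
    by (rule tensorial[where F = "\<lambda>X. \<Phi> X p f" and p = p])
      (simp_all add: Phi_add Phi_vsmult vsmult_apply tsmult_apply extend VF_T assms)
  then show "J p (X p) f = \<Phi> X p f" by (simp only: Phi_at_def)
qed

lemma J_T [simp]: "u \<in> T p \<Longrightarrow> J p u \<in> T p"
  by (simp add: Phi_at_def VF_T extend)

lemma J_add:
  assumes "u \<in> T p" "v \<in> T p" shows "J p (u + v) = J p u + J p v"
proof -
  obtain U V where UV: "U \<in> VF" "V \<in> VF" "U p = u" "V p = v" using field_at assms by metis
  then show ?thesis
    using J_field[of "U + V" p] J_field[of U p] J_field[of V p] by (simp add: Phi_add)
qed

lemma J_tsmult:
  assumes "u \<in> T p" shows "J p (tsmult c u) = tsmult c (J p u)"
proof -
  obtain U where U: "U \<in> VF" "U p = u" using field_at assms by metis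
  have "J p (vsmult (\<lambda>_. c) U p) = \<Phi> (vsmult (\<lambda>_. c) U) p"
    by (rule J_field) (simp add: U)
  then show ?thesis using U J_field[of U p] by (simp add: Phi_vsmult vsmult_apply)
qed

lemma J_xi [simp]: "J p (\<xi> p) = 0"
  using J_field[OF xi_VF, of p] by (simp add: Phi_xi)

lemma J_J:
  assumes "u \<in> T p" shows "J p (J p u) = - u + tsmult (\<eta> p u) (\<xi> p)"
proof -
  obtain U where U: "U \<in> VF" "U p = u" using field_at assms by metis
  have "J p (J p (U p)) = \<Phi> (\<Phi> U) p" by (simp only: J_field[OF U(1)] J_field[OF Phi_VF[OF U(1)]])
  then show ?thesis using U by (simp add: Phi_Phi vsmult_apply)
qed

lemma eta_J [simp]: "u \<in> T p \<Longrightarrow> \<eta> p (J p u) = 0"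
  by (simp add: Phi_at_def eta_Phi extend)

lemma g_J_J:
  assumes "u \<in> T p" "v \<in> T p" shows "g p (J p u) (J p v) = g p u v - \<eta> p u * \<eta> p v"
proof -
  obtain U V where UV: "U \<in> VF" "V \<in> VF" "U p = u" "V p = v" using field_at assms by metis
  then show ?thesis
    using g_Phi_Phi[of U V p] J_field[of U p] J_field[of V p] by simp
qed

text \<open>Replace u by Ju in \<open>g_J_J\<close>: the \<eta> term drops because Ju is horizontal,
  and J(Ju) is then expanded.\<close>

lemma g_J_skew:
  assumes "u \<in> T p" "v \<in> T p" shows "g p (J p u) v = - g p u (J p v)"
proof -
  have "g p (J p u) v = g p (J p (J p u)) (J p v)" using assms by (simp add: g_J_J)
  also have "\<dots> = - g p u (J p v) + \<eta> p u * g p (\<xi> p) (J p v)"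
    using assms by (simp add: J_J g_linear)
  also have "g p (\<xi> p) (J p v) = 0"
    using assms eta_J[of v p] by (simp add: eta_def g_sym)
  finally show ?thesis by simp
qed

lemma eta_smooth: "X \<in> VF \<Longrightarrow> smooth (\<lambda>q. \<eta> q (X q))"
  by (simp only: eta_def g_smooth xi_VF)

section \<open>Covariant derivative of the Reeb field and curvature in its direction\<close>

lemma g_nab_xi_xi:
  assumes "X \<in> VF" shows "g p (nab X \<xi> p) (\<xi> p) = 0"
proof -
  have "0 = X p (\<lambda>q. g q (\<xi> q) (\<xi> q))"
    by (simp add: T_const_fun[OF VF_T[OF assms]])
  then show ?thesis
    using metric_compatible[OF assms xi_VF xi_VF, of p]
      g_sym[OF VF_T[OF nab_VF[OF assms xi_VF]] xi_T] by simp
qed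

lemma Phi_zero: "\<Phi> 0 = 0"
proof -
  have "\<Phi> (0 + 0) = \<Phi> 0 + \<Phi> 0" by (rule Phi_add) simp_all
  then show ?thesis by (simp only: add_0_left add_cancel_right_left)
qed

text \<open>The Kenmotsu condition at Y = \<xi> yields only that \<Phi> takes the same value on
  \<nabla>\<xi> along X and on X. This determines the horizontal part; the \<xi> component is zero
  because \<xi> has constant length.\<close>

lemma nab_xi:
  assumes X: "X \<in> VF" shows "nab X \<xi> = X - vsmult (\<lambda>q. \<eta> q (X q)) \<xi>"
proof
  fix p
  note N = VF_T[OF nab_VF[OF X xi_VF], of p]
  have "- \<Phi> (nab X \<xi>) = - vsmult (\<lambda>p. 1) (\<Phi> X)"
    using kenmotsu_eq[OF X xi_VF] X
    by (simp only: Phi_xi Phi_zero nab_zero_right Phi_VF eta_xi diff_0 diff_self diff_0_right)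
  then have "\<Phi> (nab X \<xi>) p = \<Phi> X p" by (simp add: fun_eq_iff vsmult_apply)
  then have "J p (J p (nab X \<xi> p)) = J p (J p (X p))"
    using J_field[OF nab_VF[OF X xi_VF], of p] J_field[OF X, of p] by simp
  then have "- nab X \<xi> p = - X p + tsmult (\<eta> p (X p)) (\<xi> p)"
    using N VF_T[OF X, of p] by (simp add: J_J eta_def g_nab_xi_xi[OF X])
  then show "nab X \<xi> p = (X - vsmult (\<lambda>q. \<eta> q (X q)) \<xi>) p"
    by (simp add: vsmult_apply fun_eq_iff) (simp add: algebra_simps)
qed

lemma R_xi:
  assumes X: "X \<in> VF" and Y: "Y \<in> VF"
  shows "R X Y \<xi> p = tsmult (\<eta> p (X p)) (Y p) - tsmult (\<eta> p (Y p)) (X p)"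
proof
  fix h
  have XT: "X p \<in> T p" "Y p \<in> T p" by (rule VF_T X Y)+
  \<comment> \<open>In the second derivative of \<xi>, the terms g(W,V) and \<eta>(W) \<eta>(V) are
    symmetric in V and W and drop out of the commutator.\<close>
  have d: "nab V (nab W \<xi>) p h = nab V W p h
      - (\<eta> p (nab V W p) + g p (W p) (V p) - \<eta> p (W p) * \<eta> p (V p)) * \<xi> p h
      - \<eta> p (W p) * (V p h - \<eta> p (V p) * \<xi> p h)" if V: "V \<in> VF" and W: "W \<in> VF" for V W
  proof -
    have VT: "V p \<in> T p" "W p \<in> T p" by (rule VF_T V W)+
    have "nab V (nab W \<xi>) = nab V W - (vsmult (\<lambda>q. V q (\<lambda>q. \<eta> q (W q))) \<xi>
        + vsmult (\<lambda>q. \<eta> q (W q)) (V - vsmult (\<lambda>q. \<eta> q (V q)) \<xi>))"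
      by (simp only: nab_xi[OF W] nab_diff_right VF_vsmult eta_smooth V W xi_VF nab_vsmult_right
          nab_xi[OF V])
    then have "nab V (nab W \<xi>) p h = nab V W p h - (V p (\<lambda>q. \<eta> q (W q)) * \<xi> p h
        + \<eta> p (W p) * (V p h - \<eta> p (V p) * \<xi> p h))"
      by (simp add: vsmult_apply tsmult_apply)
    moreover have "V p (\<lambda>q. \<eta> q (W q)) = \<eta> p (nab V W p) + g p (W p) (nab V \<xi> p)"
      by (simp only: eta_def metric_compatible V W xi_VF)
    moreover have "g p (W p) (nab V \<xi> p) = g p (W p) (V p) - \<eta> p (W p) * \<eta> p (V p)"
      by (simp add: nab_xi[OF V] vsmult_apply g_linear VT eta_def)
    ultimately show ?thesis by (simp only: distrib_right left_diff_distrib)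
  qed
  have "nab (lie_bracket X Y) \<xi> p h = lie_bracket X Y p h - \<eta> p (lie_bracket X Y p) * \<xi> p h"
    by (simp add: nab_xi[OF lie_VF[OF X Y]] vsmult_apply tsmult_apply)
  also have "\<dots> = nab X Y p h - nab Y X p h - (\<eta> p (nab X Y p) - \<eta> p (nab Y X p)) * \<xi> p h"
    by (simp add: torsion_free[OF X Y] eta_diff VF_T X Y)
  finally show "R X Y \<xi> p h = (tsmult (\<eta> p (X p)) (Y p) - tsmult (\<eta> p (Y p)) (X p)) h"
    using g_sym[OF XT]
    by (simp add: curvature_def d[OF X Y] d[OF Y X] tsmult_apply) (simp add: algebra_simps)
qed

lemma Rm_xi:
  assumes "y \<in> T p" "z \<in> T p" "w \<in> T p"
  shows "Rm p (\<xi> p) y z w = \<eta> p w * g p z y - \<eta> p z * g p w y"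
proof -
  obtain Z W where V: "Z \<in> VF" "W \<in> VF" "Z p = z" "W p = w" using field_at assms by metis
  have "Rm p (\<xi> p) y z w = - Rm p y (\<xi> p) (Z p) (W p)"
    using Rm_antisym12[of "\<xi> p" p y z w] assms by (simp add: V)
  also have "\<dots> = - g p (R Z W \<xi> p) y" using Rm_eq[OF xi_VF V(1,2), of p y] by simp
  finally show ?thesis using assms by (simp add: R_xi V g_linear)
qed

lemma ric_xi:
  assumes w: "w \<in> T p" shows "ric p (\<xi> p) w = - (2 * real n) * \<eta> p w"
proof -
  let ?E = "frame p"
  have "ric p (\<xi> p) w
      = (\<Sum>i<DIM('e). g p w (?E i) * g p (\<xi> p) (?E i) - \<eta> p w)"
    unfolding ric_eq
  proof (rule sum.cong)
    fix i assume "i \<in> {..<DIM('e)}"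
    then have i: "?E i \<in> T p" "g p (?E i) (?E i) = 1" by (simp_all add: frame_orthonormal)
    have "Rm p (?E i) (\<xi> p) (?E i) w = - Rm p (\<xi> p) (?E i) (?E i) w"
      using i w by (intro Rm_antisym12) simp_all
    then show "Rm p (?E i) (\<xi> p) (?E i) w = g p w (?E i) * g p (\<xi> p) (?E i) - \<eta> p w"
      using i w by (simp add: Rm_xi eta_def g_sym)
  qed simp
  \<comment> \<open>Parseval contributes \<eta>(w) once; the constant summand is subtracted once for
    each of the 2n + 1 frame vectors.\<close>
  also have "\<dots> = \<eta> p w - (2 * real n + 1) * \<eta> p w"
    using parseval[OF w xi_T] by (simp add: sum_subtractf eta_def DIM_eq)
  finally show ?thesis by (simp add: algebra_simps)
qed

section \<open>The eigendistribution of \<Phi> and its curvature\<close>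

definition horizontal :: "'a vfield \<Rightarrow> bool" where
  "horizontal X \<longleftrightarrow> X \<in> VF \<and> (\<forall>p. \<eta> p (X p) = 0)"

lemma horizontal_Phi: "X \<in> VF \<Longrightarrow> horizontal (\<Phi> X)"
  by (simp add: horizontal_def eta_Phi)

lemma horizontal_Phi_Phi:
  assumes "horizontal X" shows "\<Phi> (\<Phi> X) = - X"
proof -
  have "\<Phi> (\<Phi> X) = - X + vsmult (\<lambda>p. \<eta> p (X p)) \<xi>"
    using assms by (intro Phi_Phi) (simp add: horizontal_def)
  also have "vsmult (\<lambda>p. \<eta> p (X p)) \<xi> = 0"
    using assms by (simp add: fun_eq_iff horizontal_def vsmult_apply)
  finally show ?thesis by (simp only: add_0_right)
qed

text \<open>The extension must be horizontal at every point and not just at \<open>p\<close>,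
  because \<eta>(X) = 0 and \<Phi>(\<Phi> X) = - X are going to be differentiated.\<close>

lemma horizontal_field_at:
  assumes "u \<in> T p" "\<eta> p u = 0" shows "\<exists>X. horizontal X \<and> X p = u"
proof -
  obtain U where U: "U \<in> VF" "U p = u" using field_at assms by metis
  let ?X = "U - vsmult (\<lambda>q. \<eta> q (U q)) \<xi>"
  have "?X \<in> VF" using U by (simp only: VF_diff VF_vsmult eta_smooth xi_VF)
  moreover have "\<eta> q (?X q) = 0" for q
    using VF_T[OF U(1), of q] by (simp add: vsmult_apply eta_diff eta_tsmult)
  moreover have "?X p = u" using U assms(2) by (simp add: vsmult_apply)
  ultimately show ?thesis by (intro exI[of _ ?X]) (simp add: horizontal_def)
qed

lemma nab_uminus_right:
  assumes X: "X \<in> VF" and Z: "Z \<in> VF" shows "nab X (- Z) = - nab X Z"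
proof -
  have "nab X Z + nab X (- Z) = nab X 0"
    using nab_add_right[OF X Z VF_uminus[OF Z]] by (simp only: add.right_inverse)
  also have "\<dots> = 0" by (rule nab_zero_right[OF X])
  finally show ?thesis by (rule minus_unique[symmetric])
qed

lemma Phi_diff:
  assumes "X \<in> VF" "Y \<in> VF" shows "\<Phi> (X - Y) = \<Phi> X - \<Phi> Y"
  using Phi_add[of "X - Y" Y] assms by (simp only: VF_diff diff_add_cancel eq_diff_eq)

text \<open>
  For horizontal \<open>X\<close>, \<open>Y\<close> the real part of \<open>\<nabla>\<close> applied to \<open>X - \<i> \<Phi> X\<close> and \<open>Y - \<i> \<Phi> Y\<close> is
  \<open>P X Y\<close>. The next lemmas say that the result is again of the form \<open>Z - \<i> \<Phi> Z\<close>: the connection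
  preserves the eigendistribution \<open>D\<close> of \<open>\<Phi>\<close> for \<open>\<i>\<close> along itself. Hence the curvature operators of
  pairs from \<open>D\<close> preserve \<open>D\<close>, which is isotropic.
\<close>

definition P :: "'a vfield \<Rightarrow> 'a vfield \<Rightarrow> 'a vfield" where
  "P X Y = nab X Y - nab (\<Phi> X) (\<Phi> Y)"

lemma P_VF: "X \<in> VF \<Longrightarrow> Y \<in> VF \<Longrightarrow> P X Y \<in> VF"
  by (simp only: P_def VF_diff nab_VF Phi_VF)

text \<open>For horizontal Y the right side of the Kenmotsu identity is zero and \<Phi>(\<Phi> Y) is
  -Y. Since the imaginary part of the complex covariant derivative is minus the right side here,
  that derivative is Z - \<i> \<Phi> Z with Z = P X Y.\<close>

lemma Phi_P:
  assumes X: "X \<in> VF" and Y: "horizontal Y"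
  shows "\<Phi> (P X Y) = nab X (\<Phi> Y) + nab (\<Phi> X) Y"
proof -
  have YV: "Y \<in> VF" using Y by (simp add: horizontal_def)
  have "vsmult (\<lambda>p. \<eta> p (Y p)) (\<Phi> X) = 0"
    using Y by (simp add: fun_eq_iff horizontal_def vsmult_apply)
  then have "(nab X (\<Phi> Y) - \<Phi> (nab X Y)) - (- nab (\<Phi> X) Y - \<Phi> (nab (\<Phi> X) (\<Phi> Y))) = 0"
    using kenmotsu_eq[OF X YV]
    by (simp only: horizontal_Phi_Phi[OF Y] nab_uminus_right Phi_VF X YV neg_equal_0_iff_equal)
  then show ?thesis
    by (simp only: P_def Phi_diff nab_VF Phi_VF X YV) (simp add: fun_eq_iff algebra_simps)
qed

text \<open>Differentiate \<eta>(Y) = 0. The horizontal distribution is not parallel, so this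
  component has to be tracked.\<close>

lemma eta_nab:
  assumes X: "X \<in> VF" and Y: "horizontal Y"
  shows "\<eta> p (nab X Y p) = - g p (Y p) (X p)"
proof -
  have YV: "Y \<in> VF" using Y by (simp add: horizontal_def)
  have 0: "(\<lambda>q. g q (Y q) (\<xi> q)) = (\<lambda>q. 0)" using Y by (auto simp: horizontal_def eta_def)
  have "0 = X p (\<lambda>q. g q (Y q) (\<xi> q))"
    unfolding 0 by (rule T_const_fun[OF VF_T[OF X], symmetric])
  also have "\<dots> = \<eta> p (nab X Y p) + g p (Y p) (nab X \<xi> p)"
    by (simp only: metric_compatible[OF X YV xi_VF] eta_def)
  also have "g p (Y p) (nab X \<xi> p) = g p (Y p) (X p)"
    using Y by (simp add: nab_xi[OF X] vsmult_apply g_linear VF_T X YV)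
      (simp add: horizontal_def eta_def)
  finally show ?thesis by simp
qed

text \<open>The two \<xi> components, -g(Y,X) and -g(\<Phi> Y,\<Phi> X), are equal because \<Phi> is
  isometric on horizontal vectors, and \<open>P\<close> subtracts them.\<close>

lemma horizontal_P:
  assumes X: "horizontal X" and Y: "horizontal Y" shows "horizontal (P X Y)"
proof -
  have V: "X \<in> VF" "Y \<in> VF" using X Y by (simp_all add: horizontal_def)
  have "\<eta> p (P X Y p) = 0" for p
  proof -
    have "\<eta> p (P X Y p) = \<eta> p (nab X Y p) - \<eta> p (nab (\<Phi> X) (\<Phi> Y) p)"
      by (simp add: P_def eta_diff VF_T V)
    also have "\<dots> = g p (\<Phi> Y p) (\<Phi> X p) - g p (Y p) (X p)"
      using eta_nab[OF V(1) Y] eta_nab[OF Phi_VF[OF V(1)] horizontal_Phi[OF V(2)]] by simp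
    also have "\<dots> = 0" using X Y V by (simp add: g_Phi_Phi) (simp add: horizontal_def)
    finally show ?thesis .
  qed
  then show ?thesis using V by (simp add: horizontal_def P_VF)
qed

text \<open>\<open>Q\<close> is the real part of the complex curvature applied to X - \<i> \<Phi> X,
  Y - \<i> \<Phi> Y, Z - \<i> \<Phi> Z, and the right side of the second claim is minus its
  imaginary part. Together the claims say that the value is Q - \<i> \<Phi> Q with Q horizontal, so
  it lies in the eigendistribution.\<close>

lemma eigendistribution_curvature:
  assumes X: "horizontal X" and Y: "horizontal Y" and Z: "horizontal Z"
  defines "Q \<equiv> R X Y Z - R (\<Phi> X) (\<Phi> Y) Z - R (\<Phi> X) Y (\<Phi> Z) - R X (\<Phi> Y) (\<Phi> Z)"
  shows "horizontal Q"
    and "\<Phi> Q = R X Y (\<Phi> Z) - R (\<Phi> X) (\<Phi> Y) (\<Phi> Z) + R (\<Phi> X) Y Z + R X (\<Phi> Y) Z"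
proof -
  have V: "X \<in> VF" "Y \<in> VF" "Z \<in> VF" using X Y Z by (simp_all add: horizontal_def)
  note rules = V Phi_VF nab_VF lie_VF VF_diff VF_add
  \<comment> \<open>The real part of the bracket of X - \<i> \<Phi> X and Y - \<i> \<Phi> Y.
    \<open>PhiL\<close> gives minus its imaginary part, so the eigendistribution is
    involutive.\<close>
  define L where "L = P X Y - P Y X"
  have L: "L = lie_bracket X Y - lie_bracket (\<Phi> X) (\<Phi> Y)"
    by (simp add: L_def P_def torsion_free rules)
  have PhiL: "\<Phi> L = lie_bracket X (\<Phi> Y) + lie_bracket (\<Phi> X) Y"
    by (simp add: L_def Phi_diff P_VF Phi_P X Y rules torsion_free)
  have LV: "L \<in> VF" and LH: "horizontal L"
  proof -
    show "L \<in> VF" by (simp only: L rules)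
    have "\<eta> p (L p) = 0" for p
      using horizontal_P[OF X Y] horizontal_P[OF Y X]
      by (simp add: L_def horizontal_def eta_diff VF_T)
    then show "horizontal L" using \<open>L \<in> VF\<close> by (simp add: horizontal_def)
  qed
  have PL: "P L Z = nab (lie_bracket X Y) Z - nab (lie_bracket (\<Phi> X) (\<Phi> Y)) Z
      - (nab (lie_bracket X (\<Phi> Y)) (\<Phi> Z) + nab (lie_bracket (\<Phi> X) Y) (\<Phi> Z))"
    unfolding P_def PhiL by (simp only: L nab_diff_left nab_add_left rules)
  have PhiPL: "\<Phi> (P L Z) = nab (lie_bracket X Y) (\<Phi> Z) - nab (lie_bracket (\<Phi> X) (\<Phi> Y)) (\<Phi> Z)
      + (nab (lie_bracket X (\<Phi> Y)) Z + nab (lie_bracket (\<Phi> X) Y) Z)"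
    unfolding Phi_P[OF LV Z] PhiL by (simp only: L nab_diff_left nab_add_left rules)
  have PP: "P U (P W Z) = nab U (nab W Z) - nab U (nab (\<Phi> W) (\<Phi> Z))
      - (nab (\<Phi> U) (nab W (\<Phi> Z)) + nab (\<Phi> U) (nab (\<Phi> W) Z))"
    and PhiPP: "\<Phi> (P U (P W Z)) = nab U (nab W (\<Phi> Z)) + nab U (nab (\<Phi> W) Z)
      + (nab (\<Phi> U) (nab W Z) - nab (\<Phi> U) (nab (\<Phi> W) (\<Phi> Z)))"
    if U: "horizontal U" and W: "horizontal W" for U W
  proof -
    have UV: "U \<in> VF" "W \<in> VF" using U W by (simp_all add: horizontal_def)
    have "P U (P W Z) = nab U (P W Z) - nab (\<Phi> U) (\<Phi> (P W Z))"
      by (simp only: P_def)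
    also have "\<dots> = nab U (nab W Z - nab (\<Phi> W) (\<Phi> Z)) - nab (\<Phi> U) (nab W (\<Phi> Z) + nab (\<Phi> W) Z)"
      by (simp only: Phi_P[OF UV(2) Z]) (simp only: P_def)
    finally show "P U (P W Z) = nab U (nab W Z) - nab U (nab (\<Phi> W) (\<Phi> Z))
        - (nab (\<Phi> U) (nab W (\<Phi> Z)) + nab (\<Phi> U) (nab (\<Phi> W) Z))"
      by (simp only: nab_diff_right nab_add_right rules UV)
    have "\<Phi> (P U (P W Z)) = nab U (\<Phi> (P W Z)) + nab (\<Phi> U) (P W Z)"
      by (rule Phi_P[OF UV(1) horizontal_P[OF W Z]])
    also have "\<dots> = nab U (nab W (\<Phi> Z) + nab (\<Phi> W) Z) + nab (\<Phi> U) (nab W Z - nab (\<Phi> W) (\<Phi> Z))"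
      by (simp only: Phi_P[OF UV(2) Z]) (simp only: P_def)
    finally show "\<Phi> (P U (P W Z)) = nab U (nab W (\<Phi> Z)) + nab U (nab (\<Phi> W) Z)
      + (nab (\<Phi> U) (nab W Z) - nab (\<Phi> U) (nab (\<Phi> W) (\<Phi> Z)))"
      by (simp only: nab_diff_right nab_add_right rules UV)
  qed
  \<comment> \<open>The real form of the curvature formula: each of the three terms is
    \<open>P\<close> of horizontal fields, hence stays in the eigendistribution.\<close>
  have Q: "Q = P X (P Y Z) - P Y (P X Z) - P L Z"
    unfolding Q_def PP[OF X Y] PP[OF Y X] PL curvature_def by (simp add: algebra_simps)
  have PV: "P X (P Y Z) \<in> VF" "P Y (P X Z) \<in> VF" "P L Z \<in> VF" by (intro P_VF V LV)+
  show "\<Phi> Q = R X Y (\<Phi> Z) - R (\<Phi> X) (\<Phi> Y) (\<Phi> Z) + R (\<Phi> X) Y Z + R X (\<Phi> Y) Z"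
    unfolding Q Phi_diff[OF VF_diff[OF PV(1,2)] PV(3)] Phi_diff[OF PV(1,2)]
      PhiPP[OF X Y] PhiPP[OF Y X] PhiPL curvature_def by (simp add: algebra_simps)
  have "\<eta> p (Q p) = 0" for p
    using horizontal_P[OF X horizontal_P[OF Y Z]] horizontal_P[OF Y horizontal_P[OF X Z]]
      horizontal_P[OF LH Z]
    by (simp add: Q horizontal_def eta_diff VF_T)
  moreover have "Q \<in> VF" unfolding Q by (intro VF_diff PV)
  ultimately show "horizontal Q" by (simp add: horizontal_def)
qed

text \<open>The real and the imaginary part of one complex identity: the complex bilinear metric
  vanishes on Q - \<i> JQ and x - \<i> Jx. The real part is g(Q,x) = g(JQ,Jx), the imaginary part is
  the skewness of \<open>J\<close>.\<close>

lemma Rm_eigenspace: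
  assumes "x \<in> T p" "y \<in> T p" "z \<in> T p" "w \<in> T p" "\<eta> p x = 0" "\<eta> p y = 0" "\<eta> p z = 0" "\<eta> p w = 0"
  shows "Rm p x y z w - Rm p x y (J p z) (J p w) - Rm p x (J p y) (J p z) w - Rm p x (J p y) z (J p w)
     = Rm p (J p x) (J p y) z w - Rm p (J p x) (J p y) (J p z) (J p w)
       + Rm p (J p x) y (J p z) w + Rm p (J p x) y z (J p w)" (is ?A)
   and "Rm p x (J p y) z w - Rm p x (J p y) (J p z) (J p w) + Rm p x y (J p z) w + Rm p x y z (J p w)
     + Rm p (J p x) y z w - Rm p (J p x) y (J p z) (J p w)
     - Rm p (J p x) (J p y) (J p z) w - Rm p (J p x) (J p y) z (J p w) = 0" (is ?B)
proof -
  obtain X Y Z W where H: "horizontal X" "horizontal Y" "horizontal Z" "horizontal W"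
    and at: "X p = x" "Y p = y" "Z p = z" "W p = w"
    using horizontal_field_at assms by metis
  then have V: "X \<in> VF" "Y \<in> VF" "Z \<in> VF" "W \<in> VF" by (simp_all add: horizontal_def)
  define Q where "Q = R Z W Y - R (\<Phi> Z) (\<Phi> W) Y - R (\<Phi> Z) W (\<Phi> Y) - R Z (\<Phi> W) (\<Phi> Y)"
  note Q = eigendistribution_curvature[OF H(3,4,2), folded Q_def]
  have QV: "Q \<in> VF" using Q(1) by (simp add: horizontal_def)
  have PQ: "J p (Q p) = R Z W (\<Phi> Y) p - R (\<Phi> Z) (\<Phi> W) (\<Phi> Y) p + R (\<Phi> Z) W Y p + R Z (\<Phi> W) Y p"
    by (simp add: J_field[OF QV] Q(2))
  have RT: "R a b c p \<in> T p" if "a \<in> VF" "b \<in> VF" "c \<in> VF" for a b c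
    by (rule VF_T[OF R_VF[OF that]])
  note J = J_field[OF V(1), of p] J_field[OF V(2), of p] J_field[OF V(3), of p] J_field[OF V(4), of p]
  have g1: "g p (Q p) u = Rm p u y z w - Rm p u y (J p z) (J p w) - Rm p u (J p y) (J p z) w
      - Rm p u (J p y) z (J p w)" if "u \<in> T p" for u
    unfolding at[symmetric] J
    using that by (simp add: Rm_eq V Q_def g_linear RT)
  have g2: "g p (J p (Q p)) u = Rm p u (J p y) z w - Rm p u (J p y) (J p z) (J p w)
      + Rm p u y (J p z) w + Rm p u y z (J p w)" if "u \<in> T p" for u
    unfolding PQ at[symmetric] J
    using that by (simp add: Rm_eq V g_linear RT)
  have QT: "Q p \<in> T p" by (rule VF_T[OF QV])
  have "g p (Q p) x = g p (J p (Q p)) (J p x)"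
    using assms QT by (simp add: g_J_J)
  then show ?A using assms by (simp add: g1 g2)
  have "g p (J p (Q p)) x = - g p (Q p) (J p x)" by (rule g_J_skew[OF QT assms(1)])
  then show ?B using assms by (simp add: g1 g2)
qed

section \<open>Adapted frames\<close>

lemma adapted_iff:
  "adapted A n \<Phi> \<xi> g p e \<longleftrightarrow> (\<forall>a\<in>{1..n}. e a \<in> T p \<and> \<eta> p (e a) = 0) \<and>
    (\<forall>a\<in>{1..n}. \<forall>b\<in>{1..n}. g p (e a) (e b) = (if a = b then 1 else 0) \<and> g p (e a) (J p (e b)) = 0)"
  (is "?L \<longleftrightarrow> ?R")
proof
  assume L: ?L
  have F: "g p (real_frame A n \<Phi> \<xi> p e i) (real_frame A n \<Phi> \<xi> p e j) = (if i = j then 1 else 0)"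
    if "i \<le> 2 * n" "j \<le> 2 * n" for i j
    using L that unfolding adapted_def by simp
  show ?R
  proof (intro conjI ballI)
    fix a assume a: "a \<in> {1..n}"
    show "e a \<in> T p" using L a by (simp add: adapted_def)
    show "\<eta> p (e a) = 0" using F[of a 0] a by (simp add: real_frame_def eta_def)
    fix b assume b: "b \<in> {1..n}"
    show "g p (e a) (e b) = (if a = b then 1 else 0)"
      using F[of a b] a b by (simp add: real_frame_def)
    show "g p (e a) (J p (e b)) = 0"
      using F[of a "b + n"] a b by (simp add: real_frame_def split: if_splits)
  qed
next
  assume R: ?R
  let ?F = "real_frame A n \<Phi> \<xi> p e"
  have T: "e a \<in> T p" "\<eta> p (e a) = 0" if "a \<in> {1..n}" for a using R that by blast+
  have O: "g p (e a) (e b) = (if a = b then 1 else 0)" "g p (e a) (J p (e b)) = 0"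
    "g p (J p (e a)) (e b) = 0" "g p (J p (e a)) (J p (e b)) = (if a = b then 1 else 0)"
    "g p (\<xi> p) (e a) = 0" "g p (\<xi> p) (J p (e a)) = 0" "g p (e a) (\<xi> p) = 0" "g p (J p (e a)) (\<xi> p) = 0"
    if "a \<in> {1..n}" "b \<in> {1..n}" for a b
  proof -
    note ab = T[OF that(1)] T[OF that(2)]
    show 1: "g p (e a) (e b) = (if a = b then 1 else 0)" and 2: "g p (e a) (J p (e b)) = 0"
      using R that by blast+
    show "g p (J p (e a)) (e b) = 0" using g_J_skew[OF ab(1,3)] 2 by simp
    show "g p (J p (e a)) (J p (e b)) = (if a = b then 1 else 0)"
      using g_J_J[OF ab(1,3)] 1 ab by simp
    show 3: "g p (e a) (\<xi> p) = 0" and 4: "g p (J p (e a)) (\<xi> p) = 0"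
      using ab(2) eta_J[OF ab(1)] by (simp_all add: eta_def)
    show "g p (\<xi> p) (e a) = 0" "g p (\<xi> p) (J p (e a)) = 0"
      using 3 4 g_sym[OF xi_T ab(1)] g_sym[OF xi_T J_T[OF ab(1)]] by simp_all
  qed
  have cases3: "i = 0 \<or> i \<in> {1..n} \<or> (n < i \<and> i - n \<in> {1..n})" if "i \<le> 2 * n" for i
    using that by auto
  have "g p (?F i) (?F j) = (if i = j then 1 else 0)" if i: "i \<le> 2 * n" and j: "j \<le> 2 * n" for i j
    using cases3[OF i] cases3[OF j]
    by (elim disjE) (auto simp: real_frame_def O)
  then show ?L using T by (simp add: adapted_def)
qed

text \<open>Induction on the number of vectors, using the description of adaptedness by
  \<open>e\<close> alone. A unit vector orthogonal to \<xi> and to all earlier e_a and J e_a is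
  automatically compatible with its own image: skewness of \<open>J\<close> gives the relations
  between the e_a and Ju, and also g(u,Ju) = 0.\<close>

lemma adapted_exists: "\<exists>e. adapted A n \<Phi> \<xi> g p e"
proof -
  have "\<exists>e. (\<forall>a\<in>{1..k}. e a \<in> T p \<and> \<eta> p (e a) = 0) \<and>
    (\<forall>a\<in>{1..k}. \<forall>b\<in>{1..k}. g p (e a) (e b) = (if a = b then 1 else 0) \<and> g p (e a) (J p (e b)) = 0)"
    if "k \<le> n" for k
    using that
  proof (induction k)
    case (Suc k)
    then have "\<exists>e. (\<forall>a\<in>{1..k}. e a \<in> T p \<and> \<eta> p (e a) = 0) \<and> (\<forall>a\<in>{1..k}. \<forall>b\<in>{1..k}.
        g p (e a) (e b) = (if a = b then 1 else 0) \<and> g p (e a) (J p (e b)) = 0)"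
      by (intro Suc.IH) simp
    then obtain e where E: "\<forall>a\<in>{1..k}. e a \<in> T p \<and> \<eta> p (e a) = 0"
      "\<forall>a\<in>{1..k}. \<forall>b\<in>{1..k}.
        g p (e a) (e b) = (if a = b then 1 else 0) \<and> g p (e a) (J p (e b)) = 0"
      by (elim exE conjE)
    then have e: "\<And>a. a \<in> {1..k} \<Longrightarrow> e a \<in> T p" "\<And>a. a \<in> {1..k} \<Longrightarrow> \<eta> p (e a) = 0"
      "\<And>a b. a \<in> {1..k} \<Longrightarrow> b \<in> {1..k} \<Longrightarrow> g p (e a) (e b) = (if a = b then 1 else 0)"
      "\<And>a b. a \<in> {1..k} \<Longrightarrow> b \<in> {1..k} \<Longrightarrow> g p (e a) (J p (e b)) = 0"
      by simp_all
    \<comment> \<open>At most 2k + 1 vectors, and k < n keeps this below the dimension 2n +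
      1.\<close>
    let ?F = "insert (\<xi> p) (e ` {1..k} \<union> (\<lambda>a. J p (e a)) ` {1..k})"
    have "card ?F \<le> Suc (card (e ` {1..k} \<union> (\<lambda>a. J p (e a)) ` {1..k}))"
      by (rule card_insert_le_m1) simp_all
    also have "\<dots> \<le> Suc (card (e ` {1..k}) + card ((\<lambda>a. J p (e a)) ` {1..k}))"
      using card_Un_le by blast
    also have "\<dots> \<le> Suc (k + k)"
      using card_image_le[of "{1..k}" e] card_image_le[of "{1..k}" "\<lambda>a. J p (e a)"] by simp
    also have "\<dots> < DIM('e)" using Suc.prems by (simp add: DIM_eq)
    finally have "card ?F < DIM('e)" .
    moreover have "?F \<subseteq> T p" using e(1) by auto
    moreover have "finite ?F" by simp
    ultimately obtain u where u: "u \<in> T p" "g p u u = 1" "\<forall>v\<in>?F. g p u v = 0"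
      using exists_orthogonal by metis
    then have u0: "\<eta> p u = 0" and ue: "\<And>a. a \<in> {1..k} \<Longrightarrow> g p u (e a) = 0"
      and uJ: "\<And>a. a \<in> {1..k} \<Longrightarrow> g p u (J p (e a)) = 0"
      by (auto simp: eta_def)
    have eu: "g p (e a) u = 0" "g p (e a) (J p u) = 0" if "a \<in> {1..k}" for a
      using ue[OF that] uJ[OF that] g_J_skew[OF u(1) e(1)[OF that]] e(1)[OF that] u(1)
      by (simp_all add: g_sym)
    have uu: "g p u (J p u) = 0" using g_J_skew[OF u(1) u(1)] g_sym[OF u(1) J_T[OF u(1)]] by simp
    have cases2: "a \<in> {1..k} \<and> a \<noteq> Suc k \<or> a = Suc k" if "a \<in> {1..Suc k}" for a using that by auto
    show ?case
    proof (intro exI[of _ "e(Suc k := u)"] conjI ballI)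
      fix a assume a: "a \<in> {1..Suc k}"
      show "(e(Suc k := u)) a \<in> T p" using cases2[OF a] e(1) u(1) by auto
      show "\<eta> p ((e(Suc k := u)) a) = 0" using cases2[OF a] e(2) u0 by auto
      fix b assume b: "b \<in> {1..Suc k}"
      show "g p ((e(Suc k := u)) a) ((e(Suc k := u)) b) = (if a = b then 1 else 0)"
        using cases2[OF a] cases2[OF b] by (elim disjE conjE) (simp_all add: e(3) ue eu u(2))
      show "g p ((e(Suc k := u)) a) (J p ((e(Suc k := u)) b)) = 0"
        using cases2[OF a] cases2[OF b] by (elim disjE conjE) (simp_all add: e(4) uJ eu uu)
    qed
  qed auto
  from this[OF order_refl] show ?thesis unfolding adapted_iff .
qed

lemma adapted_orthonormal:
  assumes "adapted A n \<Phi> \<xi> g p e" shows "orthonormal p (real_frame A n \<Phi> \<xi> p e)"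
proof -
  have "real_frame A n \<Phi> \<xi> p e i \<in> T p" if "i < 2 * n + 1" for i
  proof -
    have "i = 0 \<or> i \<in> {1..n} \<or> (i > n \<and> i - n \<in> {1..n})" using that by auto
    then show ?thesis using assms by (elim disjE) (auto simp: adapted_iff real_frame_def)
  qed
  moreover have "g p (real_frame A n \<Phi> \<xi> p e i) (real_frame A n \<Phi> \<xi> p e j) = (if i = j then 1 else 0)"
    if "i < 2 * n + 1" "j < 2 * n + 1" for i j
    using assms that by (simp add: adapted_def)
  ultimately show ?thesis by (simp add: orthonormal_basis_def DIM_eq)
qed

end

section \<open>Complex components of curvature-like tensors\<close>

abbreviation "re w \<equiv> (\<lambda>f. Re (w f))"
abbreviation "im w \<equiv> (\<lambda>f. Im (w f))"

lemma uminus_im: "(\<lambda>f. - Im (v f)) = - im v"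
  by (simp add: fun_eq_iff)

lemma hat_hat: "a \<in> {1..n} \<Longrightarrow> hat n (hat n a) = a"
  by (simp add: hat_def)

lemma hat_le: "a \<in> {1..n} \<Longrightarrow> hat n a \<le> 2 * n" "a \<in> {1..n} \<Longrightarrow> hat n a \<noteq> 0"
  by (auto simp: hat_def)

lemma index_cases:
  assumes "i \<le> 2 * n"
  obtains "i = 0" | "i \<in> {1..n}" | a where "a \<in> {1..n}" "i = hat n a"
proof -
  have "i = 0 \<or> i \<in> {1..n} \<or> (i - n \<in> {1..n} \<and> i = hat n (i - n))"
    using assms by (auto simp: hat_def)
  then show thesis using that by blast
qed

context manifold
begin

definition complex_tangent :: "'a \<Rightarrow> 'a ctvec set" where
  "complex_tangent p = {w. re w \<in> T p \<and> im w \<in> T p}"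

lemma complex_tangentD: "w \<in> complex_tangent p \<Longrightarrow> re w \<in> T p" "w \<in> complex_tangent p \<Longrightarrow> im w \<in> T p"
  by (simp_all add: complex_tangent_def)

text \<open>The properties shared by \<open>Rm\<close> and the generalized curvature tensor.
  Linearity is listed for the first argument only, since the symmetries carry it to the
  others.\<close>

definition curvature_like :: "'a \<Rightarrow> ('a tvec \<Rightarrow> 'a tvec \<Rightarrow> 'a tvec \<Rightarrow> 'a tvec \<Rightarrow> real) \<Rightarrow> bool" where
  "curvature_like p D \<longleftrightarrow> (\<forall>x\<in>T p. \<forall>y\<in>T p. \<forall>z\<in>T p. \<forall>w\<in>T p.
     (\<forall>x'\<in>T p. D (x + x') y z w = D x y z w + D x' y z w) \<and>
     (\<forall>c. D (tsmult c x) y z w = c * D x y z w) \<and>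
     D x y z w = - D y x z w \<and> D x y z w = - D x y w z \<and> D x y z w = D z w x y)"

context
  fixes p D assumes D: "curvature_like p D"
begin

lemma curvature_likeD:
  assumes "x \<in> T p" "y \<in> T p" "z \<in> T p" "w \<in> T p"
  shows "x' \<in> T p \<Longrightarrow> D (x + x') y z w = D x y z w + D x' y z w"
    "D (tsmult c x) y z w = c * D x y z w"
    "D x y z w = - D y x z w" "D x y z w = - D x y w z" "D x y z w = D z w x y"
  using D[unfolded curvature_like_def, rule_format, OF assms] by blast+

lemma curvature_like_linear:
  assumes x: "x \<in> T p" and y: "y \<in> T p" and z: "z \<in> T p" and w: "w \<in> T p" and u: "u \<in> T p"
  shows "D (x + u) y z w = D x y z w + D u y z w" "D (tsmult c x) y z w = c * D x y z w"
    "D x (y + u) z w = D x y z w + D x u z w" "D x (tsmult c y) z w = c * D x y z w"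
    "D x y (z + u) w = D x y z w + D x y u w" "D x y (tsmult c z) w = c * D x y z w"
    "D x y z (w + u) = D x y z w + D x y z u" "D x y z (tsmult c w) = c * D x y z w"
proof -
  have 1: "D (a + a') b c d = D a b c d + D a' b c d" "D (tsmult r a) b c d = r * D a b c d"
    if "a \<in> T p" "a' \<in> T p" "b \<in> T p" "c \<in> T p" "d \<in> T p" for a a' b c d r
    using curvature_likeD(1,2)[OF that(1,3-5)] that(2) by blast+
  have 2: "D b (a + a') c d = D b a c d + D b a' c d" "D b (tsmult r a) c d = r * D b a c d"
    if "a \<in> T p" "a' \<in> T p" "b \<in> T p" "c \<in> T p" "d \<in> T p" for a a' b c d r
    using 1[OF that] that curvature_likeD(3)[of b "a + a'" c d] curvature_likeD(3)[of b "tsmult r a" c d]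
      curvature_likeD(3)[of b a c d] curvature_likeD(3)[of b a' c d] by simp_all
  have 3: "D a b c d = D c d a b" if "a \<in> T p" "b \<in> T p" "c \<in> T p" "d \<in> T p" for a b c d
    by (rule curvature_likeD(5)[OF that])
  show "D (x + u) y z w = D x y z w + D u y z w" "D (tsmult c x) y z w = c * D x y z w"
    by (rule 1[OF x u y z w])+
  show "D x (y + u) z w = D x y z w + D x u z w" "D x (tsmult c y) z w = c * D x y z w"
    by (rule 2[OF y u x z w])+
  show "D x y (z + u) w = D x y z w + D x y u w" "D x y (tsmult c z) w = c * D x y z w"
    using 1[OF z u w x y] 3[OF x y T_add[OF z u] w] 3[OF x y z w] 3[OF x y u w]
      3[OF x y T_tsmult[OF z] w] by simp_all
  show "D x y z (w + u) = D x y z w + D x y z u" "D x y z (tsmult c w) = c * D x y z w"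
    using 2[OF w u z x y] 3[OF x y z T_add[OF w u]] 3[OF x y z w] 3[OF x y z u]
      3[OF x y z T_tsmult[OF w]] by simp_all
qed

lemma curvature_like_zero:
  assumes "x \<in> T p" "y \<in> T p" "z \<in> T p"
  shows "D 0 x y z = 0" "D x 0 y z = 0" "D x y 0 z = 0" "D x y z 0 = 0"
  using curvature_like_linear(2,4,6,8)[of 0 x y z 0 0] curvature_like_linear(2,4,6,8)[of x 0 y z 0 0]
    curvature_like_linear(2,4,6,8)[of x y 0 z 0 0] curvature_like_linear(2,4,6,8)[of x y z 0 0 0] assms
  by simp_all

lemma curvature_like_uminus:
  assumes x: "x \<in> T p" and y: "y \<in> T p" and z: "z \<in> T p" and w: "w \<in> T p"
  shows "D (- x) y z w = - D x y z w" "D x (- y) z w = - D x y z w"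
    "D x y (- z) w = - D x y z w" "D x y z (- w) = - D x y z w"
proof -
  have m: "- v = tsmult (-1) v" for v :: "'a tvec" by (simp add: fun_eq_iff tsmult_apply)
  show "D (- x) y z w = - D x y z w" "D x (- y) z w = - D x y z w"
    "D x y (- z) w = - D x y z w" "D x y z (- w) = - D x y z w"
    unfolding m by (simp_all add: curvature_like_linear(2,4,6,8)[OF x y z w x])
qed

lemma cextend4_symmetries:
  assumes x: "x \<in> complex_tangent p" and y: "y \<in> complex_tangent p"
    and z: "z \<in> complex_tangent p" and w: "w \<in> complex_tangent p"
  shows "cextend4 D x y z w = - cextend4 D y x z w"
    and "cextend4 D x y z w = - cextend4 D x y w z"
    and "cextend4 D x y z w = cextend4 D z w x y"
    and "cextend4 D (\<lambda>f. cnj (x f)) (\<lambda>f. cnj (y f)) (\<lambda>f. cnj (z f)) (\<lambda>f. cnj (w f))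
      = cnj (cextend4 D x y z w)"
proof -
  note r = complex_tangentD[OF x] complex_tangentD[OF y] complex_tangentD[OF z] complex_tangentD[OF w]
  have s: "D a b c d = - D b a c d" "D a b c d = - D a b d c" "D a b c d = D c d a b"
    if "a \<in> {re x, im x}" "b \<in> {re y, im y}" "c \<in> {re z, im z}" "d \<in> {re w, im w}" for a b c d
  proof -
    have t: "a \<in> T p" "b \<in> T p" "c \<in> T p" "d \<in> T p" using that r by blast+
    show "D a b c d = - D b a c d" "D a b c d = - D a b d c" "D a b c d = D c d a b"
      by (rule curvature_likeD(3-5)[OF t])+
  qed
  show "cextend4 D x y z w = - cextend4 D y x z w"
    unfolding cextend4_def cextend_def by (simp add: s(1) algebra_simps)
  show "cextend4 D x y z w = - cextend4 D x y w z"
    unfolding cextend4_def cextend_def by (simp add: s(2) algebra_simps)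
  \<comment> \<open>A new name for the tensor with exchanged pairs: both sides are rewritten to
    \<open>E\<close>, whereas the exchange rule itself would loop as a rewrite rule.\<close>
  define E where "E = (\<lambda>a b c d. D c d a b)"
  have E: "D a b c d = E a b c d" "D c d a b = E a b c d"
    if "a \<in> {re x, im x}" "b \<in> {re y, im y}" "c \<in> {re z, im z}" "d \<in> {re w, im w}" for a b c d
    using s(3)[OF that] by (simp_all only: E_def)
  show "cextend4 D x y z w = cextend4 D z w x y"
    unfolding cextend4_def cextend_def by (simp add: E algebra_simps)
  show "cextend4 D (\<lambda>f. cnj (x f)) (\<lambda>f. cnj (y f)) (\<lambda>f. cnj (z f)) (\<lambda>f. cnj (w f))
      = cnj (cextend4 D x y z w)"
    unfolding cextend4_def cextend_def
    by (simp add: uminus_im curvature_like_uminus r algebra_simps)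
qed

end

end

text \<open>Carries a real identity to complex components. It is assumed only at the real and
  imaginary parts of the arguments because the identity it is applied to holds for horizontal
  vectors only.\<close>

lemma cextend_2_form_combination:
  fixes D E :: "'a tvec \<Rightarrow> 'a tvec \<Rightarrow> 'a tvec \<Rightarrow> 'a tvec \<Rightarrow> real" and G :: "'a tvec \<Rightarrow> 'a tvec \<Rightarrow> real"
  assumes "\<And>a b c d. a \<in> {re x, im x} \<Longrightarrow> b \<in> {re y, im y} \<Longrightarrow> c \<in> {re z, im z} \<Longrightarrow> d \<in> {re w, im w}
    \<Longrightarrow> D a b c d = r * (E a b c d - q * (G a c * G b d - G a d * G b c))"
  shows "cextend4 D x y z w = of_real r * (cextend4 E x y z w
    - of_real q * (cextend2 G x z * cextend2 G y w - cextend2 G x w * cextend2 G y z))"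
  unfolding cextend4_def cextend2_def cextend_def by (simp add: assms) (simp add: algebra_simps)

context kenmotsu
begin

section \<open>Components in A-frames\<close>

abbreviation "\<epsilon> p e \<equiv> a_frame A n \<Phi> \<xi> p e"

lemma a_frame_0: "re (\<epsilon> p e 0) = \<xi> p" "im (\<epsilon> p e 0) = 0"
  by (simp_all add: a_frame_def fun_eq_iff)

lemma a_frame_unhat:
  assumes "a \<in> {1..n}"
  shows "re (\<epsilon> p e a) = tsmult (1 / sqrt 2) (e a)"
    and "e a \<in> T p \<Longrightarrow> im (\<epsilon> p e a) = - J p (tsmult (1 / sqrt 2) (e a))"
  using assms
  by (simp_all add: a_frame_def fun_eq_iff J_tsmult tsmult_apply Re_divide_of_real Im_divide_of_real)

lemma a_frame_hat:
  assumes "i \<le> 2 * n" shows "\<epsilon> p e (hat n i) = (\<lambda>f. cnj (\<epsilon> p e i f))"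
  using assms by (auto simp: a_frame_def hat_def fun_eq_iff)

lemma a_frame_complex_tangent:
  assumes e: "adapted A n \<Phi> \<xi> g p e" and "i \<le> 2 * n" shows "\<epsilon> p e i \<in> complex_tangent p"
proof -
  have eT: "e a \<in> T p" if "a \<in> {1..n}" for a using e that by (simp add: adapted_def)
  have 1: "\<epsilon> p e a \<in> complex_tangent p" if a: "a \<in> {1..n}" for a
    unfolding complex_tangent_def mem_Collect_eq a_frame_unhat(1)[OF a] a_frame_unhat(2)[where e = e, OF a eT[OF a]]
    using eT[OF a] by simp
  show ?thesis
  proof (rule index_cases[OF assms(2)])
    fix a assume a: "a \<in> {1..n}" "i = hat n a"
    then show ?thesis
      using 1[OF a(1)] a_frame_hat[of a p e] by (simp add: complex_tangent_def uminus_im)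
  qed (simp_all only: 1, simp add: complex_tangent_def a_frame_0)
qed

lemma a_frame_horizontal:
  assumes e: "adapted A n \<Phi> \<xi> g p e" and "i \<in> {1..2 * n}"
  shows "v \<in> {re (\<epsilon> p e i), im (\<epsilon> p e i)} \<Longrightarrow> v \<in> T p \<and> \<eta> p v = 0"
proof -
  have 1: "re (\<epsilon> p e a) \<in> T p \<and> im (\<epsilon> p e a) \<in> T p \<and> \<eta> p (re (\<epsilon> p e a)) = 0 \<and> \<eta> p (im (\<epsilon> p e a)) = 0"
    if a: "a \<in> {1..n}" for a
  proof -
    have eT: "e a \<in> T p" "\<eta> p (e a) = 0" using e a by (simp_all add: adapted_iff)
    show ?thesis
      unfolding a_frame_unhat(1)[OF a] a_frame_unhat(2)[where e = e, OF a eT(1)]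
      using eT by (simp add: eta_tsmult eta_uminus)
  qed
  have 2: "re (\<epsilon> p e i) \<in> T p \<and> im (\<epsilon> p e i) \<in> T p \<and> \<eta> p (re (\<epsilon> p e i)) = 0 \<and> \<eta> p (im (\<epsilon> p e i)) = 0"
  proof (rule index_cases[of i n])
    fix a assume a: "a \<in> {1..n}" "i = hat n a"
    then show ?thesis using 1[OF a(1)] a_frame_hat[of a p e] by (simp add: uminus_im eta_uminus)
  qed (use 1 assms in auto)
  then show "v \<in> {re (\<epsilon> p e i), im (\<epsilon> p e i)} \<Longrightarrow> v \<in> T p \<and> \<eta> p v = 0" by blast
qed

text \<open>The values of the complexified form on \<epsilon>_a and on its conjugate determine
  L(e_a) and L(J e_a), so \<open>L\<close> vanishes on the real adapted basis. \<open>L\<close> is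
  complex-valued because it is used while other arguments are still complexified.\<close>

lemma linear_form_eq_0:
  fixes L :: "'a tvec \<Rightarrow> complex"
  assumes e: "adapted A n \<Phi> \<xi> g p e"
    and add: "\<And>u v. u \<in> T p \<Longrightarrow> v \<in> T p \<Longrightarrow> L (u + v) = L u + L v"
    and mult: "\<And>c u. u \<in> T p \<Longrightarrow> L (tsmult c u) = of_real c * L u"
    and zero: "\<And>i. i \<le> 2 * n \<Longrightarrow> cextend L (\<epsilon> p e i) = 0"
    and u: "u \<in> T p"
  shows "L u = 0"
proof -
  have L0: "L 0 = 0" using mult[of 0 0] by simp
  have Lm: "L (- v) = - L v" if "v \<in> T p" for v
    using mult[OF that, of "-1"] by (simp add: tsmult_def fun_Compl_def)
  have xi: "L (\<xi> p) = 0" using zero[of 0] by (simp add: cextend_def a_frame_0 L0)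
  have ea: "L (e a) = 0 \<and> L (J p (e a)) = 0" if a: "a \<in> {1..n}" for a
  proof -
    have eT: "e a \<in> T p" using e a by (simp add: adapted_def)
    have h: "hat n a \<le> 2 * n" "a \<le> 2 * n" using a by (auto simp: hat_def)
    let ?c = "complex_of_real (1 / sqrt 2)"
    have "?c * L (e a) - \<i> * (?c * L (J p (e a))) = 0"
      using zero[OF h(2)] eT
      by (simp add: cextend_def a_frame_unhat(1)[OF a] a_frame_unhat(2)[where e = e, OF a eT] Lm J_tsmult mult)
    moreover have "?c * L (e a) + \<i> * (?c * L (J p (e a))) = 0"
      using zero[OF h(1)] eT unfolding a_frame_hat[OF h(2)]
      by (simp add: cextend_def uminus_im a_frame_unhat(1)[OF a] a_frame_unhat(2)[where e = e, OF a eT] J_tsmult mult)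
    moreover have "v = 0 \<and> w = 0" if "?c * v - \<i> * (?c * w) = 0" "?c * v + \<i> * (?c * w) = 0" for v w
    proof -
      have "2 * (?c * v) = 0" using that by algebra
      moreover have "2 * \<i> * (?c * w) = 0" using that by algebra
      ultimately show ?thesis by simp
    qed
    ultimately show ?thesis by blast
  qed
  let ?F = "real_frame A n \<Phi> \<xi> p e"
  have F: "?F i \<in> T p" "L (?F i) = 0" if "i < DIM('e)" for i
  proof -
    show "?F i \<in> T p"
      using adapted_orthonormal[OF e] that by (simp add: orthonormal_basis_def)
    have "i = 0 \<or> i \<in> {1..n} \<or> (i > n \<and> i - n \<in> {1..n})" using that by (auto simp: DIM_eq)
    then show "L (?F i) = 0" using xi ea by (elim disjE) (auto simp: real_frame_def)
  qed
  have "L (\<Sum>i\<in>I. tsmult (g p u (?F i)) (?F i)) = 0" if "finite I" "I \<subseteq> {..<DIM('e)}" for I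
    using that
  proof (induction I rule: finite_induct)
    case (insert i I)
    have "(\<Sum>i\<in>I. tsmult (g p u (?F i)) (?F i)) \<in> T p"
      using insert.prems F(1) by (intro T_sum T_tsmult) blast
    moreover have "i < DIM('e)" using insert.prems by simp
    ultimately have "L (\<Sum>i\<in>insert i I. tsmult (g p u (?F i)) (?F i))
        = L (tsmult (g p u (?F i)) (?F i)) + L (\<Sum>i\<in>I. tsmult (g p u (?F i)) (?F i))"
      unfolding sum.insert[OF insert.hyps] by (intro add T_tsmult F(1))
    also have "\<dots> = 0"
      using insert.IH insert.prems mult[OF F(1)] F(2) \<open>i < DIM('e)\<close> by simp
    finally show ?case .
  qed (simp only: sum.empty L0)
  from this[OF finite_lessThan subset_refl] show ?thesis
    using arg_cong[OF orthonormal_expansion[OF adapted_orthonormal[OF e] u], of L] by simp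
qed

text \<open>The arguments are freed one at a time, starting with the outermost extension in
  \<open>cextend4\<close>: at each stage the remaining expression is a real-linear form in that
  argument which vanishes on the A-frame.\<close>

lemma curvature_like_eq_0:
  assumes e: "adapted A n \<Phi> \<xi> g p e" and D: "curvature_like p D"
    and zero: "\<And>i j k l. i \<le> 2 * n \<Longrightarrow> j \<le> 2 * n \<Longrightarrow> k \<le> 2 * n \<Longrightarrow> l \<le> 2 * n
      \<Longrightarrow> cextend4 D (\<epsilon> p e i) (\<epsilon> p e j) (\<epsilon> p e k) (\<epsilon> p e l) = 0"
    and x: "x \<in> T p" and y: "y \<in> T p" and z: "z \<in> T p" and w: "w \<in> T p"
  shows "D x y z w = 0"
proof -
  let ?E = "\<epsilon> p e"
  note C = complex_tangentD[OF a_frame_complex_tangent[OF e]]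
  note lin = curvature_like_linear[OF D]
  have 1: "cextend (\<lambda>b. cextend (\<lambda>c. cextend (\<lambda>d. complex_of_real (D a b c d)) (?E l)) (?E k)) (?E j) = 0"
    if "j \<le> 2 * n" "k \<le> 2 * n" "l \<le> 2 * n" "a \<in> T p" for j k l a
  proof (rule linear_form_eq_0[OF e, where L = "\<lambda>a. cextend (\<lambda>b. cextend (\<lambda>c. cextend
        (\<lambda>d. complex_of_real (D a b c d)) (?E l)) (?E k)) (?E j)"])
    show "cextend (\<lambda>a. cextend (\<lambda>b. cextend (\<lambda>c. cextend
        (\<lambda>d. complex_of_real (D a b c d)) (?E l)) (?E k)) (?E j)) (?E i) = 0" if "i \<le> 2 * n" for i
      using zero[OF that \<open>j \<le> 2 * n\<close> \<open>k \<le> 2 * n\<close> \<open>l \<le> 2 * n\<close>] by (simp only: cextend4_def)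
  qed (use that in \<open>simp_all add: cextend_def lin(1,2) C algebra_simps\<close>)
  have 2: "cextend (\<lambda>c. cextend (\<lambda>d. complex_of_real (D a b c d)) (?E l)) (?E k) = 0"
    if "k \<le> 2 * n" "l \<le> 2 * n" "a \<in> T p" "b \<in> T p" for k l a b
  proof (rule linear_form_eq_0[OF e, where L = "\<lambda>b. cextend (\<lambda>c. cextend
        (\<lambda>d. complex_of_real (D a b c d)) (?E l)) (?E k)"])
    show "cextend (\<lambda>b. cextend (\<lambda>c. cextend
        (\<lambda>d. complex_of_real (D a b c d)) (?E l)) (?E k)) (?E i) = 0" if "i \<le> 2 * n" for i
      by (rule 1) (use that \<open>k \<le> 2 * n\<close> \<open>l \<le> 2 * n\<close> \<open>a \<in> T p\<close> in auto)
  qed (use that in \<open>simp_all add: cextend_def lin(3,4) C algebra_simps\<close>)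
  have 3: "cextend (\<lambda>d. complex_of_real (D a b c d)) (?E l) = 0"
    if "l \<le> 2 * n" "a \<in> T p" "b \<in> T p" "c \<in> T p" for l a b c
  proof (rule linear_form_eq_0[OF e, where L = "\<lambda>c. cextend (\<lambda>d. complex_of_real (D a b c d)) (?E l)"])
    show "cextend (\<lambda>c. cextend (\<lambda>d. complex_of_real (D a b c d)) (?E l)) (?E i) = 0" if "i \<le> 2 * n" for i
      by (rule 2) (use that \<open>l \<le> 2 * n\<close> \<open>a \<in> T p\<close> \<open>b \<in> T p\<close> in auto)
  qed (use that in \<open>simp_all add: cextend_def lin(5,6) C algebra_simps\<close>)
  have "complex_of_real (D x y z w) = 0"
  proof (rule linear_form_eq_0[OF e, where L = "\<lambda>d. complex_of_real (D x y z d)"])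
    show "cextend (\<lambda>d. complex_of_real (D x y z d)) (?E i) = 0" if "i \<le> 2 * n" for i
      by (rule 3) (use that x y z in auto)
  qed (use x y z w in \<open>simp_all add: lin(7,8)\<close>)
  then show ?thesis by simp
qed

lemma cextend2_g_frame:
  assumes e: "adapted A n \<Phi> \<xi> g p e" and a: "a \<in> {1..n}" and b: "b \<in> {1..n}"
  shows "cextend2 (g p) (\<epsilon> p e a) (\<epsilon> p e b) = 0"
    and "cextend2 (g p) (\<epsilon> p e (hat n a)) (\<epsilon> p e b) = delta a b"
    and "cextend2 (g p) (\<epsilon> p e a) (\<epsilon> p e (hat n b)) = delta a b"
    and "cextend2 (g p) (\<epsilon> p e (hat n a)) (\<epsilon> p e (hat n b)) = 0"
proof -
  have eT: "e a \<in> T p" "e b \<in> T p" "\<eta> p (e a) = 0" "\<eta> p (e b) = 0"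
    and ab: "g p (e a) (e b) = (if a = b then 1 else 0)" "g p (e a) (J p (e b)) = 0"
    using e a b by (auto simp: adapted_iff)
  have h: "a \<le> 2 * n" "b \<le> 2 * n" using a b by auto
  have G: "g p (J p (e a)) (J p (e b)) = (if a = b then 1 else 0)" "g p (J p (e a)) (e b) = 0"
    using g_J_J[OF eT(1,2)] g_J_skew[OF eT(1,2)] eT ab by simp_all
  note simps = cextend2_def cextend_def a_frame_hat[OF h(1)] a_frame_hat[OF h(2)] uminus_im
    a_frame_unhat(1)[OF a] a_frame_unhat(2)[where e = e, OF a eT(1)] a_frame_unhat(1)[OF b]
    a_frame_unhat(2)[where e = e, OF b eT(2)] g_linear eT J_tsmult ab G delta_def
  show "cextend2 (g p) (\<epsilon> p e a) (\<epsilon> p e b) = 0"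
    by (simp add: simps)
  show "cextend2 (g p) (\<epsilon> p e (hat n a)) (\<epsilon> p e b) = delta a b"
    by (simp add: simps)
  show "cextend2 (g p) (\<epsilon> p e a) (\<epsilon> p e (hat n b)) = delta a b"
    by (simp add: simps)
  show "cextend2 (g p) (\<epsilon> p e (hat n a)) (\<epsilon> p e (hat n b)) = 0"
    by (simp add: simps)
qed

lemma curvature_like_Rm: "curvature_like p (Rm p)"
  unfolding curvature_like_def
  by (intro ballI conjI allI)
    (assumption | rule Rm_add1 Rm_tsmult1 Rm_antisym12 Rm_antisym34 Rm_pair)+

lemma cextend4_Rm_unhat:
  assumes e: "adapted A n \<Phi> \<xi> g p e"
    and a: "a \<in> {1..n}" and b: "b \<in> {1..n}" and c: "c \<in> {1..n}" and d: "d \<in> {1..n}"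
  shows "cextend4 (Rm p) (\<epsilon> p e a) (\<epsilon> p e b) (\<epsilon> p e c) (\<epsilon> p e d) = 0"
proof -
  have E: "e i \<in> T p" "\<eta> p (e i) = 0" if "i \<in> {1..n}" for i
    using e that by (auto simp: adapted_iff)
  \<comment> \<open>With this scaling \<epsilon>_a is u_a - \<i> J u_a, and the two identities of
    \<open>Rm_eigenspace\<close> become the real and imaginary parts of the component.\<close>
  define u where "u = (\<lambda>i. tsmult (1 / sqrt 2) (e i))"
  have u: "u i \<in> T p" "\<eta> p (u i) = 0" "re (\<epsilon> p e i) = u i" "im (\<epsilon> p e i) = - J p (u i)"
    if "i \<in> {1..n}" for i
    using E[OF that] a_frame_unhat(1)[OF that] a_frame_unhat(2)[where e = e, OF that]
    by (simp_all add: u_def eta_tsmult)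
  note R = Rm_eigenspace[OF u(1)[OF a] u(1)[OF b] u(1)[OF c] u(1)[OF d]
      u(2)[OF a] u(2)[OF b] u(2)[OF c] u(2)[OF d]]
  note uT = u(1)[OF a] u(1)[OF b] u(1)[OF c] u(1)[OF d]
  note parts = u(3,4)[OF a] u(3,4)[OF b] u(3,4)[OF c] u(3,4)[OF d]
  show ?thesis
  proof (rule complex_eqI)
    show "Re (cextend4 (Rm p) (\<epsilon> p e a) (\<epsilon> p e b) (\<epsilon> p e c) (\<epsilon> p e d)) = Re 0"
      unfolding cextend4_def cextend_def parts
      by (simp add: curvature_like_uminus[OF curvature_like_Rm] uT) (use R(1) in linarith)
    show "Im (cextend4 (Rm p) (\<epsilon> p e a) (\<epsilon> p e b) (\<epsilon> p e c) (\<epsilon> p e d)) = Im 0"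
      unfolding cextend4_def cextend_def parts
      by (simp add: curvature_like_uminus[OF curvature_like_Rm] uT) (use R(2) in linarith)
  qed
qed

end

section \<open>The generalized curvature tensor\<close>

text \<open>Pure bookkeeping: under the antisymmetries, the exchange of pairs and conjugation, the
  16 placements of hats fall into four classes, represented by no hat, one hat, one hat in each
  pair, and both hats in one pair. Placements with three or four hats are conjugate to ones with one
  or none.\<close>

lemma components_eq_0:
  fixes H :: "nat \<Rightarrow> nat \<Rightarrow> nat \<Rightarrow> nat \<Rightarrow> complex"
  assumes sym: "\<And>i j k l. i \<le> 2 * n \<Longrightarrow> j \<le> 2 * n \<Longrightarrow> k \<le> 2 * n \<Longrightarrow> l \<le> 2 * n \<Longrightarrow>
      H i j k l = - H j i k l \<and> H i j k l = - H i j l k \<and> H i j k l = H k l i j \<and>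
      H (hat n i) (hat n j) (hat n k) (hat n l) = cnj (H i j k l)"
    and zero: "\<And>j k l. j \<le> 2 * n \<Longrightarrow> k \<le> 2 * n \<Longrightarrow> l \<le> 2 * n \<Longrightarrow> H 0 j k l = 0"
    and comp: "\<And>a b c d. a \<in> {1..n} \<Longrightarrow> b \<in> {1..n} \<Longrightarrow> c \<in> {1..n} \<Longrightarrow> d \<in> {1..n} \<Longrightarrow>
      H a b c d = 0 \<and> H (hat n a) b c d = 0 \<and> H (hat n a) b c (hat n d) = 0 \<and>
      H (hat n a) (hat n b) c d = 0"
    and ijkl: "i \<le> 2 * n" "j \<le> 2 * n" "k \<le> 2 * n" "l \<le> 2 * n"
  shows "H i j k l = 0"
proof -
  have s1: "H i j k l = 0" if "H j i k l = 0" "i \<le> 2 * n" "j \<le> 2 * n" "k \<le> 2 * n" "l \<le> 2 * n" for i j k l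
    using sym[OF that(2-5)] that(1) by (metis neg_equal_0_iff_equal)
  have s2: "H i j k l = 0" if "H i j l k = 0" "i \<le> 2 * n" "j \<le> 2 * n" "k \<le> 2 * n" "l \<le> 2 * n" for i j k l
    using sym[OF that(2-5)] that(1) by (metis neg_equal_0_iff_equal)
  have s3: "H i j k l = 0" if "H k l i j = 0" "i \<le> 2 * n" "j \<le> 2 * n" "k \<le> 2 * n" "l \<le> 2 * n" for i j k l
    using sym[OF that(2-5)] that(1) by metis
  have s4: "H (hat n i) (hat n j) (hat n k) (hat n l) = 0"
    if "H i j k l = 0" "i \<le> 2 * n" "j \<le> 2 * n" "k \<le> 2 * n" "l \<le> 2 * n" for i j k l
    using sym[OF that(2-5)] that(1) by (metis complex_cnj_zero)
  \<comment> \<open>An index 0 in any place is moved to the front by exchanging the pairs and then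
    the first two indices.\<close>
  have z: "H i j k l = 0" if "i = 0 \<or> j = 0 \<or> k = 0 \<or> l = 0"
    "i \<le> 2 * n" "j \<le> 2 * n" "k \<le> 2 * n" "l \<le> 2 * n" for i j k l
  proof -
    have 1: "H i j k l = 0" if "i = 0 \<or> j = 0" "i \<le> 2 * n" "j \<le> 2 * n" "k \<le> 2 * n" "l \<le> 2 * n" for i j k l
      using that zero s1[of j i k l] by blast
    then show ?thesis using that s3[of k l i j] by blast
  qed
  have le: "a \<in> {1..n} \<Longrightarrow> a \<le> 2 * n" for a by simp
  have all: "H a b c d = 0" "H (hat n a) b c d = 0" "H a (hat n b) c d = 0" "H a b (hat n c) d = 0"
    "H a b c (hat n d) = 0" "H (hat n a) (hat n b) c d = 0" "H (hat n a) b (hat n c) d = 0"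
    "H (hat n a) b c (hat n d) = 0" "H a (hat n b) (hat n c) d = 0" "H a (hat n b) c (hat n d) = 0"
    "H a b (hat n c) (hat n d) = 0"
    if t: "a \<in> {1..n}" "b \<in> {1..n}" "c \<in> {1..n}" "d \<in> {1..n}" for a b c d
  proof -
    note c1 = comp[OF t] and B = le[OF t(1)] le[OF t(2)] le[OF t(3)] le[OF t(4)]
      hat_le(1)[OF t(1)] hat_le(1)[OF t(2)] hat_le(1)[OF t(3)] hat_le(1)[OF t(4)]
    show "H a b c d = 0" "H (hat n a) b c d = 0" "H (hat n a) b c (hat n d) = 0"
      "H (hat n a) (hat n b) c d = 0" using c1 by blast+
    show "H a (hat n b) c d = 0" by (rule s1) (use comp[OF t(2,1,3,4)] B in simp_all)
    show "H a b (hat n c) d = 0" by (rule s3) (use comp[OF t(3,4,1,2)] B in simp_all)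
    show "H a b c (hat n d) = 0"
    proof (rule s2)
      show "H a b (hat n d) c = 0" by (rule s3) (use comp[OF t(4,3,1,2)] B in simp_all)
    qed (use B in simp_all)
    show "H (hat n a) b (hat n c) d = 0" by (rule s2) (use comp[OF t(1,2,4,3)] B in simp_all)
    show "H a (hat n b) c (hat n d) = 0" by (rule s1) (use comp[OF t(2,1,3,4)] B in simp_all)
    show "H a (hat n b) (hat n c) d = 0"
    proof (rule s2)
      show "H a (hat n b) d (hat n c) = 0" by (rule s1) (use comp[OF t(2,1,4,3)] B in simp_all)
    qed (use B in simp_all)
    show "H a b (hat n c) (hat n d) = 0" by (rule s3) (use comp[OF t(3,4,1,2)] B in simp_all)
  qed
  have all': "H (hat n a) (hat n b) (hat n c) (hat n d) = 0" "H a (hat n b) (hat n c) (hat n d) = 0"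
    "H (hat n a) b (hat n c) (hat n d) = 0" "H (hat n a) (hat n b) c (hat n d) = 0"
    "H (hat n a) (hat n b) (hat n c) d = 0"
    if t: "a \<in> {1..n}" "b \<in> {1..n}" "c \<in> {1..n}" "d \<in> {1..n}" for a b c d
    using s4[OF all(1)[OF t]] s4[OF all(2)[OF t]] s4[OF all(3)[OF t]] s4[OF all(4)[OF t]]
      s4[OF all(5)[OF t]] t
    by (simp_all add: hat_hat hat_le(1) le)
  show ?thesis
    by (rule index_cases[OF ijkl(1)]; rule index_cases[OF ijkl(2)]; rule index_cases[OF ijkl(3)];
        rule index_cases[OF ijkl(4)]) (simp_all add: all all' z ijkl hat_le)
qed

context kenmotsu
begin

abbreviation "s \<equiv> scalar_curvature A g nab"
abbreviation "gen a0 a1 a2 \<equiv> gen_curvature A g nab a0 a1 a2"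

lemma curvature_like_gen: "curvature_like p (gen a0 a1 a2 p)"
  unfolding curvature_like_def
proof (intro ballI conjI allI)
  fix x y z w assume t: "x \<in> T p" "y \<in> T p" "z \<in> T p" "w \<in> T p"
  show "gen a0 a1 a2 p (x + x') y z w = gen a0 a1 a2 p x y z w + gen a0 a1 a2 p x' y z w"
    if "x' \<in> T p" for x'
    using t that by (simp add: gen_curvature_def Rm_add1 g_linear ric_add_left algebra_simps)
  show "gen a0 a1 a2 p (tsmult c x) y z w = c * gen a0 a1 a2 p x y z w" for c
    using t by (simp add: gen_curvature_def Rm_tsmult1 g_linear ric_tsmult_left algebra_simps)
  show "gen a0 a1 a2 p x y z w = - gen a0 a1 a2 p y x z w"
    using Rm_antisym12[OF t] by (simp add: gen_curvature_def algebra_simps)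
  show "gen a0 a1 a2 p x y z w = - gen a0 a1 a2 p x y w z"
    using Rm_antisym34[OF t] by (simp add: gen_curvature_def algebra_simps)
  show "gen a0 a1 a2 p x y z w = gen a0 a1 a2 p z w x y"
    using Rm_pair[OF t] g_sym[OF t(3,1)] g_sym[OF t(3,2)] g_sym[OF t(4,1)] g_sym[OF t(4,2)]
      ric_sym[OF t(3,1)] ric_sym[OF t(3,2)] ric_sym[OF t(4,1)] ric_sym[OF t(4,2)]
    by (simp add: gen_curvature_def algebra_simps)
qed

lemma flat_imp_eta_einstein:
  assumes flat: "flat_gen_curvature A g nab a0 a1 a2" and a1: "a1 p \<noteq> 0"
    and lam: "lam = (1 / a1 p) * (a0 p + 2 * real n * a1 p - 2 * a2 p * s p)"
    and u: "u \<in> T p" and v: "v \<in> T p"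
  shows "ric p u v = lam * g p u v - (2 * real n + lam) * \<eta> p u * \<eta> p v"
proof -
  have "gen a0 a1 a2 p (\<xi> p) u (\<xi> p) v = 0"
    using flat u v xi_T unfolding flat_gen_curvature_def by blast
  \<comment> \<open>The two mixed Ricci terms give 2n \<eta>(u) \<eta>(v) each, which makes the 4n;
    the term -2n g(u,v) is r(\<xi>,\<xi>) g(u,v).\<close>
  then have "a0 p * (\<eta> p u * \<eta> p v - g p u v)
      + a1 p * (ric p u v + 4 * real n * (\<eta> p u * \<eta> p v) - 2 * real n * g p u v)
      + 2 * a2 p * s p * (g p u v - \<eta> p u * \<eta> p v) = 0"
    using u v ric_xi[OF u] ric_xi[OF v] ric_xi[OF xi_T, of p] ric_sym[OF u xi_T]
      g_sym[OF xi_T u] g_sym[OF xi_T v] g_sym[OF v u]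
    by (simp add: gen_curvature_def Rm_xi eta_def algebra_simps)
  moreover have "a1 p * lam = a0 p + 2 * real n * a1 p - 2 * a2 p * s p"
    using a1 by (simp add: lam)
  moreover have "a1 p * (ric p u v - lam * g p u v + (2 * real n + lam) * \<eta> p u * \<eta> p v)
      = a1 p * ric p u v - (a1 p * lam) * g p u v
        + (2 * real n * a1 p + a1 p * lam) * (\<eta> p u * \<eta> p v)"
    by (simp add: algebra_simps)
  ultimately have "a1 p * (ric p u v - lam * g p u v + (2 * real n + lam) * \<eta> p u * \<eta> p v) = 0"
    by (simp only:) (simp add: algebra_simps)
  then show ?thesis using a1 by simp
qed

section \<open>The generalized curvature tensor under the Einstein condition\<close>

context
  fixes p :: 'a and lam mu :: real and a0 a1 a2 :: "'a \<Rightarrow> real"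
  assumes einstein: "\<And>u v. u \<in> T p \<Longrightarrow> v \<in> T p \<Longrightarrow> ric p u v = lam * g p u v + mu * \<eta> p u * \<eta> p v"
    and a0: "a0 p \<noteq> 0" and a1: "a1 p \<noteq> 0"
    and lam: "lam = (1 / a1 p) * (a0 p + 2 * real n * a1 p - 2 * a2 p * s p)"
    and mu: "mu = - (2 * real n + lam)"
begin

lemma a1_lam: "a1 p * lam = a0 p + 2 * real n * a1 p - 2 * a2 p * s p"
  using a1 by (simp add: lam)

text \<open>Antisymmetry in z and w removes the \<mu> terms, and everything left is a multiple of
  the one expression that curvature in the direction \<xi> allows. Its factor is zero by the choice
  of \<lambda>.\<close>

lemma gen_xi:
  assumes "y \<in> T p" "z \<in> T p" "w \<in> T p" shows "gen a0 a1 a2 p (\<xi> p) y z w = 0"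
proof -
  have "gen a0 a1 a2 p (\<xi> p) y z w = (a1 p * lam - 2 * real n * a1 p + 2 * a2 p * s p - a0 p)
      * (\<eta> p z * g p y w - \<eta> p w * g p y z)"
    using assms g_sym[OF xi_T assms(2)] g_sym[OF xi_T assms(3)] g_sym[OF assms(2,1)]
      g_sym[OF assms(3,1)] ric_xi[OF assms(2)] ric_xi[OF assms(3)]
    by (simp add: gen_curvature_def Rm_xi einstein eta_def mu algebra_simps)
  then show ?thesis by (simp add: a1_lam)
qed

lemma gen_horizontal:
  assumes "x \<in> T p" "y \<in> T p" "z \<in> T p" "w \<in> T p" "\<eta> p x = 0" "\<eta> p y = 0" "\<eta> p z = 0" "\<eta> p w = 0"
  shows "gen a0 a1 a2 p x y z w = a0 p * (Rm p x y z w
    - (a1 p / a0 p * mu - 1) * (g p x z * g p y w - g p x w * g p y z))"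
proof -
  have "gen a0 a1 a2 p x y z w = a0 p * Rm p x y z w
      + (2 * (a1 p * lam) + 2 * a2 p * s p) * (g p x z * g p y w - g p x w * g p y z)"
    using assms by (simp add: gen_curvature_def einstein algebra_simps)
  \<comment> \<open>By the choice of \<lambda>, a1 \<lambda> + 2 a2 s equals a0 + 2n a1; with the
    other a1 \<lambda> this is a0 + a1 (2n + \<lambda>), and 2n + \<lambda> is -\<mu>.\<close>
  also have "2 * (a1 p * lam) + 2 * a2 p * s p = - (a1 p * mu - a0 p)"
    using a1_lam by (simp add: mu algebra_simps)
  also have "a0 p * Rm p x y z w
      + - (a1 p * mu - a0 p) * (g p x z * g p y w - g p x w * g p y z)
      = a0 p * (Rm p x y z w
        - (a1 p / a0 p * mu - 1) * (g p x z * g p y w - g p x w * g p y z))"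
    using a0 by (simp add: field_simps)
  finally show ?thesis .
qed

context
  fixes e assumes e: "adapted A n \<Phi> \<xi> g p e"
begin

abbreviation "DC i j k l \<equiv> cextend4 (gen a0 a1 a2 p) (\<epsilon> p e i) (\<epsilon> p e j) (\<epsilon> p e k) (\<epsilon> p e l)"

lemma gen_component:
  assumes "i \<in> {1..2 * n}" "j \<in> {1..2 * n}" "k \<in> {1..2 * n}" "l \<in> {1..2 * n}"
  shows "DC i j k l = of_real (a0 p) * (cextend4 (Rm p) (\<epsilon> p e i) (\<epsilon> p e j) (\<epsilon> p e k) (\<epsilon> p e l)
    - of_real (a1 p / a0 p * mu - 1) * (cextend2 (g p) (\<epsilon> p e i) (\<epsilon> p e k) * cextend2 (g p) (\<epsilon> p e j) (\<epsilon> p e l)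
      - cextend2 (g p) (\<epsilon> p e i) (\<epsilon> p e l) * cextend2 (g p) (\<epsilon> p e j) (\<epsilon> p e k)))"
proof (rule cextend_2_form_combination)
  fix a b c d
  assume "a \<in> {re (\<epsilon> p e i), im (\<epsilon> p e i)}" "b \<in> {re (\<epsilon> p e j), im (\<epsilon> p e j)}"
    "c \<in> {re (\<epsilon> p e k), im (\<epsilon> p e k)}" "d \<in> {re (\<epsilon> p e l), im (\<epsilon> p e l)}"
  then have "a \<in> T p \<and> \<eta> p a = 0" "b \<in> T p \<and> \<eta> p b = 0" "c \<in> T p \<and> \<eta> p c = 0" "d \<in> T p \<and> \<eta> p d = 0"
    using a_frame_horizontal[OF e] assms by blast+
  then show "gen a0 a1 a2 p a b c d = a0 p * (Rm p a b c d
      - (a1 p / a0 p * mu - 1) * (g p a c * g p b d - g p a d * g p b c))"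
    by (intro gen_horizontal) simp_all
qed

text \<open>The upper index of \<open>riem_up\<close> becomes a hatted first index. The metric pairs
  hatted only with unhatted indices, so the metric term drops out of the first two types, loses one
  product in the third, and in the fourth gives twice the alternation.\<close>

lemma gen_components:
  assumes a: "a \<in> {1..n}" and b: "b \<in> {1..n}" and c: "c \<in> {1..n}" and d: "d \<in> {1..n}"
  defines "\<kappa> \<equiv> complex_of_real (a1 p / a0 p * mu)"
  shows "DC a b c d = 0"
    and "DC (hat n a) b c d = of_real (a0 p) * riem_up A n g nab (p, \<epsilon> p e) a b c d"
    and "DC (hat n a) b c (hat n d) = of_real (a0 p)
      * (riem_up A n g nab (p, \<epsilon> p e) a b c (hat n d) - (\<kappa> - 1) * (delta a c * delta d b))"
    and "DC (hat n a) (hat n b) c d = of_real (a0 p)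
      * (riem_up A n g nab (p, \<epsilon> p e) a (hat n b) c d
        - (\<kappa> - 1) * (2 * alt (\<lambda>c d. delta a c * delta b d) c d))"
proof -
  have r: "i \<in> {1..2 * n}" "hat n i \<in> {1..2 * n}" if "i \<in> {1..n}" for i
    using that by (auto simp: hat_def)
  note gf = cextend2_g_frame[OF e]
  have dl: "delta d b = delta b d" by (simp add: delta_def)
  show "DC a b c d = 0"
    unfolding gen_component[OF r(1)[OF a] r(1)[OF b] r(1)[OF c] r(1)[OF d]]
      cextend4_Rm_unhat[OF e a b c d] gf(1)[OF a c] gf(1)[OF a d]
    by simp
  show "DC (hat n a) b c d = of_real (a0 p) * riem_up A n g nab (p, \<epsilon> p e) a b c d"
    unfolding gen_component[OF r(2)[OF a] r(1)[OF b] r(1)[OF c] r(1)[OF d]]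
      gf(1)[OF b d] gf(1)[OF b c]
    by (simp add: riem_up_def)
  show "DC (hat n a) b c (hat n d) = of_real (a0 p)
      * (riem_up A n g nab (p, \<epsilon> p e) a b c (hat n d) - (\<kappa> - 1) * (delta a c * delta d b))"
    unfolding gen_component[OF r(2)[OF a] r(1)[OF b] r(1)[OF c] r(2)[OF d]]
      gf(2)[OF a c] gf(3)[OF b d] gf(4)[OF a d]
    by (simp add: riem_up_def \<kappa>_def dl)
  show "DC (hat n a) (hat n b) c d = of_real (a0 p)
      * (riem_up A n g nab (p, \<epsilon> p e) a (hat n b) c d
        - (\<kappa> - 1) * (2 * alt (\<lambda>c d. delta a c * delta b d) c d))"
    unfolding gen_component[OF r(2)[OF a] r(2)[OF b] r(1)[OF c] r(1)[OF d]]
      gf(2)[OF a c] gf(2)[OF b d] gf(2)[OF a d] gf(2)[OF b c]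
    by (simp add: riem_up_def \<kappa>_def alt_def)
qed

lemma gen_eq_0:
  assumes "\<And>a b c d. a \<in> {1..n} \<Longrightarrow> b \<in> {1..n} \<Longrightarrow> c \<in> {1..n} \<Longrightarrow> d \<in> {1..n} \<Longrightarrow>
      DC (hat n a) b c d = 0 \<and> DC (hat n a) b c (hat n d) = 0 \<and> DC (hat n a) (hat n b) c d = 0"
    and xyzw: "x \<in> T p" "y \<in> T p" "z \<in> T p" "w \<in> T p"
  shows "gen a0 a1 a2 p x y z w = 0"
proof (rule curvature_like_eq_0[OF e curvature_like_gen _ xyzw])
  note ct = a_frame_complex_tangent[OF e]
  fix i j k l assume ijkl: "i \<le> 2 * n" "j \<le> 2 * n" "k \<le> 2 * n" "l \<le> 2 * n"
  show "DC i j k l = 0"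
  proof (rule components_eq_0[where n = n and H = DC])
    show "DC i j k l = - DC j i k l \<and> DC i j k l = - DC i j l k \<and> DC i j k l = DC k l i j \<and>
        DC (hat n i) (hat n j) (hat n k) (hat n l) = cnj (DC i j k l)"
      if "i \<le> 2 * n" "j \<le> 2 * n" "k \<le> 2 * n" "l \<le> 2 * n" for i j k l
      using cextend4_symmetries[OF curvature_like_gen ct[OF that(1)] ct[OF that(2)] ct[OF that(3)]
          ct[OF that(4)]]
      unfolding a_frame_hat[OF that(1)] a_frame_hat[OF that(2)] a_frame_hat[OF that(3)]
        a_frame_hat[OF that(4)] by blast
    \<comment> \<open>The frame vector with index 0 is the real vector \<xi>, so only its real part
      enters and \<open>gen_xi\<close> applies to every remaining term.\<close>
    show "DC 0 j k l = 0" if "j \<le> 2 * n" "k \<le> 2 * n" "l \<le> 2 * n" for j k l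
      using complex_tangentD[OF ct[OF that(1)]] complex_tangentD[OF ct[OF that(2)]]
        complex_tangentD[OF ct[OF that(3)]]
      by (simp add: cextend4_def cextend_def a_frame_0 gen_xi
          curvature_like_zero[OF curvature_like_gen])
  qed (use assms(1) gen_components(1) ijkl in auto)
qed

end

end

lemma AG_space_iff: "(p, E) \<in> AG_space A n \<Phi> \<xi> g \<longleftrightarrow> (\<exists>e. adapted A n \<Phi> \<xi> g p e \<and> E = \<epsilon> p e)"
  by (auto simp: AG_space_def)

lemma cextend4_eq_0:
  assumes "\<And>x y z w. x \<in> T p \<Longrightarrow> y \<in> T p \<Longrightarrow> z \<in> T p \<Longrightarrow> w \<in> T p \<Longrightarrow> D x y z w = 0"
    and "x \<in> complex_tangent p" "y \<in> complex_tangent p" "z \<in> complex_tangent p" "w \<in> complex_tangent p"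
  shows "cextend4 D x y z w = 0"
  using complex_tangentD[OF assms(2)] complex_tangentD[OF assms(3)] complex_tangentD[OF assms(4)]
    complex_tangentD[OF assms(5)]
  by (simp add: cextend4_def cextend_def assms(1))

end

theorem theorem3p2:
  fixes A :: "('a::{t2_space, second_countable_topology}, 'e::euclidean_space) chart set"
    and n :: nat
    and \<Phi> :: "'a vfield \<Rightarrow> 'a vfield"
    and \<xi> :: "'a vfield"
    and g :: "'a metric"
    and nab :: "'a connection"
    and B :: "'a \<times> 'a cframe \<Rightarrow> nat \<Rightarrow> nat \<Rightarrow> nat \<Rightarrow> complex"
    and A1 A2 B1 B2 :: "'a \<times> 'a cframe \<Rightarrow> nat \<Rightarrow> nat \<Rightarrow> nat \<Rightarrow> nat \<Rightarrow> complex"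
    and a0 a1 a2 :: "'a \<Rightarrow> real"
  assumes "acr_manifold A n \<Phi> \<xi> g"
    and "levi_civita A g nab"
    and "kenmotsu_type A \<Phi> \<xi> g nab"
    and "structure_functions A n \<Phi> \<xi> g nab B A1 A2 B1 B2"
    and "\<And>p. a0 p \<noteq> 0"
    and "\<And>p. a1 p \<noteq> 0"
  shows "flat_gen_curvature A g nab a0 a1 a2 \<longleftrightarrow>
    (\<exists>lam mu :: 'a \<Rightarrow> real.
       eta_einstein A \<xi> g nab lam mu \<and>
       (\<forall>p. lam p = (1 / a1 p) * (a0 p + 2 * real n * a1 p
                                   - 2 * a2 p * scalar_curvature A g nab p)) \<and>
       (\<forall>p. mu p = - (2 * real n + lam p)) \<and>
       (\<forall>p \<epsilon>. (p, \<epsilon>) \<in> AG_space A n \<Phi> \<xi> g \<longrightarrow>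
          (\<forall>a\<in>{1..n}. \<forall>b\<in>{1..n}. \<forall>c\<in>{1..n}. \<forall>d\<in>{1..n}.
             A1 (p, \<epsilon>) a b c d = 0 \<and>
             A2 (p, \<epsilon>) a d b c
               = (\<Sum>h=1..n. B (p, \<epsilon>) a h c * cnj (B (p, \<epsilon>) b h d))
                 + complex_of_real (a1 p / a0 p * mu p) * (delta a c * delta d b) \<and>
             alt (B1 (p, \<epsilon>) a b) c d
               = complex_of_real (a1 p / a0 p * mu p)
                 * alt (\<lambda>c d. delta a c * delta b d) c d)))"
proof -
  interpret kenmotsu A g nab n \<Phi> \<xi>
    using assms(1-3) by unfold_locales (simp_all add: acr_manifold_def)
  note sf = assms(4)[unfolded structure_functions_def, THEN conjunct2, rule_format]
  show ?thesis
  proof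
    assume flat: "flat_gen_curvature A g nab a0 a1 a2"
    define lam where "lam = (\<lambda>p. (1 / a1 p) * (a0 p + 2 * real n * a1 p - 2 * a2 p * s p))"
    define mu where "mu = (\<lambda>p. - (2 * real n + lam p))"
    have einstein: "ric p u v = lam p * g p u v + mu p * \<eta> p u * \<eta> p v"
      if "u \<in> T p" "v \<in> T p" for p u v
      using flat_imp_eta_einstein[OF flat assms(6) fun_cong[OF lam_def] that]
      by (simp add: mu_def algebra_simps)
    have "A1 (p, E) a b c d = 0 \<and>
        A2 (p, E) a d b c = (\<Sum>h=1..n. B (p, E) a h c * cnj (B (p, E) b h d))
          + complex_of_real (a1 p / a0 p * mu p) * (delta a c * delta d b) \<and>
        alt (B1 (p, E) a b) c d
          = complex_of_real (a1 p / a0 p * mu p) * alt (\<lambda>c d. delta a c * delta b d) c d"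
      if AG: "(p, E) \<in> AG_space A n \<Phi> \<xi> g"
        and t: "a \<in> {1..n}" "b \<in> {1..n}" "c \<in> {1..n}" "d \<in> {1..n}" for p E a b c d
    proof -
      obtain e where e: "adapted A n \<Phi> \<xi> g p e" and E: "E = \<epsilon> p e"
        using AG by (auto simp: AG_space_iff)
      have ct: "i \<in> {1..n} \<Longrightarrow> \<epsilon> p e i \<in> complex_tangent p"
        "i \<in> {1..n} \<Longrightarrow> \<epsilon> p e (hat n i) \<in> complex_tangent p" for i
        using a_frame_complex_tangent[OF e] hat_le(1) by auto
      have gen0: "gen a0 a1 a2 p x y z w = 0"
        if "x \<in> T p" "y \<in> T p" "z \<in> T p" "w \<in> T p" for x y z w
        using flat that unfolding flat_gen_curvature_def by blast
      note z = cextend4_eq_0[of p "gen a0 a1 a2 p", OF gen0]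
      note comp = gen_components(2-4)[where p = p and lam = "lam p" and mu = "mu p" and ?a0.0 = a0 and ?a1.0 = a1 and ?a2.0 = a2,
          OF einstein assms(5) assms(6) fun_cong[OF lam_def] fun_cong[OF mu_def] e t]
      define K where "K = complex_of_real (a1 p / a0 p * mu p)"
      \<comment> \<open>Each component of the generalized tensor is a0 times the difference of the
        two sides; the component is zero and a0 is not.\<close>
      have "riem_up A n g nab (p, E) a b c d = 0"
        "riem_up A n g nab (p, E) a b c (hat n d) = (K - 1) * (delta a c * delta d b)"
        "riem_up A n g nab (p, E) a (hat n b) c d
          = (K - 1) * (2 * alt (\<lambda>c d. delta a c * delta b d) c d)"
        using comp assms(5)[of p] z ct t unfolding E K_def by simp_all
      then show ?thesis
        using sf[OF AG t] unfolding K_def[symmetric] by (simp add: algebra_simps)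
    qed
    then show "\<exists>lam mu :: 'a \<Rightarrow> real. eta_einstein A \<xi> g nab lam mu \<and>
       (\<forall>p. lam p = (1 / a1 p) * (a0 p + 2 * real n * a1 p
                                   - 2 * a2 p * scalar_curvature A g nab p)) \<and>
       (\<forall>p. mu p = - (2 * real n + lam p)) \<and>
       (\<forall>p \<epsilon>. (p, \<epsilon>) \<in> AG_space A n \<Phi> \<xi> g \<longrightarrow>
          (\<forall>a\<in>{1..n}. \<forall>b\<in>{1..n}. \<forall>c\<in>{1..n}. \<forall>d\<in>{1..n}.
             A1 (p, \<epsilon>) a b c d = 0 \<and>
             A2 (p, \<epsilon>) a d b c
               = (\<Sum>h=1..n. B (p, \<epsilon>) a h c * cnj (B (p, \<epsilon>) b h d))
                 + complex_of_real (a1 p / a0 p * mu p) * (delta a c * delta d b) \<and>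
             alt (B1 (p, \<epsilon>) a b) c d
               = complex_of_real (a1 p / a0 p * mu p)
                 * alt (\<lambda>c d. delta a c * delta b d) c d))"
      using einstein unfolding eta_einstein_def
      by (intro exI[of _ lam] exI[of _ mu]) (auto simp: lam_def mu_def)
  next
    assume "\<exists>lam mu :: 'a \<Rightarrow> real. eta_einstein A \<xi> g nab lam mu \<and>
       (\<forall>p. lam p = (1 / a1 p) * (a0 p + 2 * real n * a1 p
                                   - 2 * a2 p * scalar_curvature A g nab p)) \<and>
       (\<forall>p. mu p = - (2 * real n + lam p)) \<and>
       (\<forall>p \<epsilon>. (p, \<epsilon>) \<in> AG_space A n \<Phi> \<xi> g \<longrightarrow>
          (\<forall>a\<in>{1..n}. \<forall>b\<in>{1..n}. \<forall>c\<in>{1..n}. \<forall>d\<in>{1..n}.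
             A1 (p, \<epsilon>) a b c d = 0 \<and>
             A2 (p, \<epsilon>) a d b c
               = (\<Sum>h=1..n. B (p, \<epsilon>) a h c * cnj (B (p, \<epsilon>) b h d))
                 + complex_of_real (a1 p / a0 p * mu p) * (delta a c * delta d b) \<and>
             alt (B1 (p, \<epsilon>) a b) c d
               = complex_of_real (a1 p / a0 p * mu p)
                 * alt (\<lambda>c d. delta a c * delta b d) c d))"
    then obtain lam mu where einstein0: "eta_einstein A \<xi> g nab lam mu"
      and lam: "\<And>p. lam p = (1 / a1 p) * (a0 p + 2 * real n * a1 p - 2 * a2 p * s p)"
      and mu: "\<And>p. mu p = - (2 * real n + lam p)"
      and comps: "\<And>p E a b c d. (p, E) \<in> AG_space A n \<Phi> \<xi> g \<Longrightarrow> a \<in> {1..n} \<Longrightarrow> b \<in> {1..n} \<Longrightarrow>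
        c \<in> {1..n} \<Longrightarrow> d \<in> {1..n} \<Longrightarrow> A1 (p, E) a b c d = 0 \<and>
        A2 (p, E) a d b c = (\<Sum>h=1..n. B (p, E) a h c * cnj (B (p, E) b h d))
          + complex_of_real (a1 p / a0 p * mu p) * (delta a c * delta d b) \<and>
        alt (B1 (p, E) a b) c d
          = complex_of_real (a1 p / a0 p * mu p) * alt (\<lambda>c d. delta a c * delta b d) c d"
      by (elim exE conjE) blast
    have einstein: "ric p u v = lam p * g p u v + mu p * \<eta> p u * \<eta> p v"
      if "u \<in> T p" "v \<in> T p" for p u v
      using einstein0 that unfolding eta_einstein_def by blast
    have "gen a0 a1 a2 p x y z w = 0"
      if xyzw: "x \<in> T p" "y \<in> T p" "z \<in> T p" "w \<in> T p" for p x y z w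
    proof -
      \<comment> \<open>One adapted frame at each point is enough for this direction, because a
        curvature-like tensor whose components vanish in a single A-frame is zero.\<close>
      obtain e where e: "adapted A n \<Phi> \<xi> g p e" using adapted_exists by blast
      then have AG: "(p, \<epsilon> p e) \<in> AG_space A n \<Phi> \<xi> g" by (auto simp: AG_space_iff)
      show ?thesis
      proof (rule gen_eq_0[where p = p and lam = "lam p" and mu = "mu p" and ?a0.0 = a0 and ?a1.0 = a1 and ?a2.0 = a2,
            OF einstein assms(5) assms(6) lam mu e _ xyzw])
        fix a b c d assume t: "a \<in> {1..n}" "b \<in> {1..n}" "c \<in> {1..n}" "d \<in> {1..n}"
        note comp = gen_components(2-4)[where p = p and lam = "lam p" and mu = "mu p" and ?a0.0 = a0 and ?a1.0 = a1 and ?a2.0 = a2,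
            OF einstein assms(5) assms(6) lam mu e t]
        have "riem_up A n g nab (p, \<epsilon> p e) a b c d = 0"
          "riem_up A n g nab (p, \<epsilon> p e) a b c (hat n d)
            = (complex_of_real (a1 p / a0 p * mu p) - 1) * (delta a c * delta d b)"
          "riem_up A n g nab (p, \<epsilon> p e) a (hat n b) c d
            = (complex_of_real (a1 p / a0 p * mu p) - 1) * (2 * alt (\<lambda>c d. delta a c * delta b d) c d)"
          using sf[OF AG t] comps[OF AG t] by (simp_all add: algebra_simps)
        then show "cextend4 (gen a0 a1 a2 p) (\<epsilon> p e (hat n a)) (\<epsilon> p e b) (\<epsilon> p e c) (\<epsilon> p e d) = 0 \<and>
            cextend4 (gen a0 a1 a2 p) (\<epsilon> p e (hat n a)) (\<epsilon> p e b) (\<epsilon> p e c) (\<epsilon> p e (hat n d)) = 0 \<and>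
            cextend4 (gen a0 a1 a2 p) (\<epsilon> p e (hat n a)) (\<epsilon> p e (hat n b)) (\<epsilon> p e c) (\<epsilon> p e d) = 0"
          using comp by simp
      qed
    qed
    then show "flat_gen_curvature A g nab a0 a1 a2"
      unfolding flat_gen_curvature_def by blast
  qed
qed

end
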